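(* $L^3(\mathbb R^3)$ is a good space.
   Context: $\mathcal S$, $\mathcal S'$ are the Schwartz space and the space of tempered distributions on $\mathbb R^3$. Littlewood-Paley operators: fix $\varphi^0\in C^\infty([0,\infty))$ with $\varphi^0=1$ on $[0,\frac14]$ and $\operatorname{Supp}\varphi^0\subset[0,1]$, and put $\psi^0=\varphi^0(\frac{\cdot}{4})-\varphi^0$. For $j\in\mathbb Z$, $S_j=\varphi^0(-4^{-j}\Delta)$ and $\Delta_j=\psi^0(-4^{-j}\Delta)$, where $\Delta$ is the Laplacian (Fourier multipliers $\varphi^0(4^{-j}|\xi|^2)$ and $\psi^0(4^{-j}|\xi|^2)$). $\Gamma_j=\{\xi\in\mathbb R^3: 2^{j-1}\le|\xi|\le 2^{j+1}\}$. Functional space: a Banach space $E$ such that (a) $\mathcal S\subset E\subset\mathcal S'$ with continuous injections; (b) either $\mathcal S$ is dense in $E$, or $\mathcal S$ is dense in a Banach space of which $E$ is the dual; (c) for $f\in E$, $S_jf\to0$ in $\mathcal S'$ as $j\to-\infty$. Good space: a functional space $E$ which is invariant, i.e. $\|\lambda f(\lambda\cdot-x_0)\|_E=\|f\|_E$ for all $f\in E$, $x_0\in\mathbb R^3$, $\lambda>0$, and for which there is a nonnegative sequence $\eta=(\eta_n)_{n\in\mathbb Z}\in\ell^1(\mathbb Z)$ such that, whenever $f,g\in E$ with $\operatorname{Supp}\widehat f\subset\Gamma_k$, $\operatorname{Supp}\widehat g\subset\Gamma_l$, $k,l\in\mathbb Z$, and $j\in\mathbb Z$, one has $\Delta_j(fg)\in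 E$ and $$\|\Delta_j(fg)\|_E\le\eta_{\max(k-j,\,l-j)}\,2^{k+l-j}\,\|f\|_E\|g\|_E.$$ *)

theory Defs
  imports "HOL-Analysis.Analysis" "HOL-Library.Function_Algebras"
begin

text \<open>All vector spaces below are complex subspaces of some type \<open>'a \<Rightarrow> complex\<close>.\<close>

lemma vector_space_cfun: "vector_space (\<lambda>(c::complex) (f::'a \<Rightarrow> complex) x. c * f x)"
  by unfold_locales (auto simp: fun_eq_iff algebra_simps)

definition seminorm_topology ::
    "('a \<Rightarrow> complex) set \<Rightarrow> (('a \<Rightarrow> complex) \<Rightarrow> real) set \<Rightarrow> ('a \<Rightarrow> complex) topology" where
  "seminorm_topology V P =
     topology_generated_by {{y \<in> V. p (y - x) < r} | x p r. x \<in> V \<and> p \<in> P \<and> 0 < r}"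

definition complex_banach :: "('a \<Rightarrow> complex) set \<Rightarrow> (('a \<Rightarrow> complex) \<Rightarrow> real) \<Rightarrow> bool" where
  "complex_banach V N \<longleftrightarrow>
     module.subspace (\<lambda>c f x. c * f x) V \<and>
     (\<forall>f\<in>V. 0 \<le> N f) \<and>
     (\<forall>f\<in>V. N f = 0 \<longleftrightarrow> f = 0) \<and>
     (\<forall>f\<in>V. \<forall>c. N (\<lambda>x. c * f x) = cmod c * N f) \<and>
     (\<forall>f\<in>V. \<forall>g\<in>V. N (f + g) \<le> N f + N g) \<and>
     (\<forall>X. (\<forall>n. X n \<in> V) \<and> (\<forall>e>0. \<exists>M. \<forall>m\<ge>M. \<forall>n\<ge>M. N (X m - X n) < e)
        \<longrightarrow> (\<exists>f\<in>V. (\<lambda>n::nat. N (X n - f)) \<longlonglongrightarrow> 0))"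

definition clinear_on ::
    "('a \<Rightarrow> complex) set \<Rightarrow> (('a \<Rightarrow> complex) \<Rightarrow> complex) \<Rightarrow> bool" where
  "clinear_on V L \<longleftrightarrow>
     (\<forall>f\<in>V. \<forall>g\<in>V. L (f + g) = L f + L g) \<and> (\<forall>f\<in>V. \<forall>c. L (\<lambda>x. c * f x) = c * L f)"

definition bounded_functional ::
    "('a \<Rightarrow> complex) set \<Rightarrow> (('a \<Rightarrow> complex) \<Rightarrow> real) \<Rightarrow> (('a \<Rightarrow> complex) \<Rightarrow> complex) \<Rightarrow> bool" where
  "bounded_functional V N L \<longleftrightarrow> clinear_on V L \<and> (\<exists>C. \<forall>f\<in>V. cmod (L f) \<le> C * N f)"

definition dual_norm ::
    "('a \<Rightarrow> complex) set \<Rightarrow> (('a \<Rightarrow> complex) \<Rightarrow> real) \<Rightarrow> (('a \<Rightarrow> complex) \<Rightarrow> complex) \<Rightarrow> real" where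
  "dual_norm V N L = (SUP f\<in>{f \<in> V. N f \<le> 1}. cmod (L f))"

type_synonym R3 = "real^3"
type_synonym func = "R3 \<Rightarrow> complex"
type_synonym dist = "func \<Rightarrow> complex"

definition partial :: "3 \<Rightarrow> func \<Rightarrow> func" where
  "partial i f = (\<lambda>x. frechet_derivative f (at x) (axis i 1))"

definition partials :: "3 list \<Rightarrow> func \<Rightarrow> func" where
  "partials is f = foldr partial is f"

definition schwartz :: "func set" where
  "schwartz = {f. \<forall>is. partials is f differentiable_on UNIV \<and>
                 (\<forall>k::nat. bounded (range (\<lambda>x. (1 + norm x) ^ k *\<^sub>R partials is f x)))}"

definition schwartz_seminorm :: "nat \<Rightarrow> 3 list \<Rightarrow> func \<Rightarrow> real" where
  "schwartz_seminorm k is f = (SUP x. (1 + norm x) ^ k * cmod (partials is f x))"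

definition schwartz_topology :: "func topology" where
  "schwartz_topology = seminorm_topology schwartz {schwartz_seminorm k is | k is. True}"

text \<open>
  A tempered distribution is a functional on all functions which vanishes by convention outside
  \<^const>\<open>schwartz\<close>; thus two tempered distributions are equal as soon as they agree on
  \<^const>\<open>schwartz\<close>. The convention is enforced by the following operator.
\<close>

definition on_schwartz :: "dist \<Rightarrow> dist" where
  "on_schwartz T = (\<lambda>\<phi>. if \<phi> \<in> schwartz then T \<phi> else 0)"

definition tempered :: "dist set" where
  "tempered = {T. clinear_on schwartz T \<and> continuous_map schwartz_topology euclidean T \<and>
                  on_schwartz T = T}"

definition tempered_topology :: "dist topology" where
  "tempered_topology = seminorm_topology tempered {\<lambda>T. cmod (T \<phi>) | \<phi>. \<phi> \<in> schwartz}"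

definition regular :: "func \<Rightarrow> dist" where
  "regular u = on_schwartz (\<lambda>\<phi>. LINT x|lborel. u x * \<phi> x)"

definition dist_support :: "dist \<Rightarrow> R3 set" where
  "dist_support T =
     - \<Union>{U. open U \<and>
           (\<forall>\<phi>\<in>schwartz. compact (closure {x. \<phi> x \<noteq> 0}) \<and> closure {x. \<phi> x \<noteq> 0} \<subseteq> U
              \<longrightarrow> T \<phi> = 0)}"

text \<open>The distribution \<open>\<lambda> T(\<lambda> \<cdot> - x\<^sub>0)\<close>: substitute \<open>y = \<lambda> x - x\<^sub>0\<close> in the test integral.\<close>

definition dist_rescale :: "real \<Rightarrow> R3 \<Rightarrow> dist \<Rightarrow> dist" where
  "dist_rescale r x0 T =
     on_schwartz (\<lambda>\<phi>. of_real r * (of_real (1 / r ^ 3) * T (\<lambda>y. \<phi> ((1 / r) *\<^sub>R (y + x0)))))"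

text \<open>
  A distribution with compactly supported Fourier transform is given by a unique continuous
  function of polynomial growth (Paley--Wiener--Schwartz); the product of two such distributions
  is given by the pointwise product of these functions.
\<close>

definition dist_function :: "dist \<Rightarrow> func" where
  "dist_function T =
     (THE u. continuous_on UNIV u \<and> (\<exists>C k. \<forall>x. cmod (u x) \<le> C * (1 + norm x) ^ k) \<and>
             T = regular u)"

definition dist_product :: "dist \<Rightarrow> dist \<Rightarrow> dist" where
  "dist_product S T = regular (\<lambda>x. dist_function S x * dist_function T x)"

definition fourier :: "func \<Rightarrow> func" where
  "fourier \<phi> = (\<lambda>\<xi>. LINT x|lborel. exp (- (\<i> * of_real (x \<bullet> \<xi>))) * \<phi> x)"

definition inv_fourier :: "func \<Rightarrow> func" where
  "inv_fourier \<phi> =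
     (\<lambda>x. of_real (1 / (2 * pi) ^ 3) * (LINT \<xi>|lborel. exp (\<i> * of_real (x \<bullet> \<xi>)) * \<phi> \<xi>))"

definition dist_fourier :: "dist \<Rightarrow> dist" where
  "dist_fourier T = on_schwartz (\<lambda>\<phi>. T (fourier \<phi>))"

definition dist_inv_fourier :: "dist \<Rightarrow> dist" where
  "dist_inv_fourier T = on_schwartz (\<lambda>\<phi>. T (inv_fourier \<phi>))"

definition dist_mult :: "func \<Rightarrow> dist \<Rightarrow> dist" where
  "dist_mult m T = on_schwartz (\<lambda>\<phi>. T (\<lambda>\<xi>. m \<xi> * \<phi> \<xi>))"

definition fourier_multiplier :: "func \<Rightarrow> dist \<Rightarrow> dist" where
  "fourier_multiplier m T = dist_inv_fourier (dist_mult m (dist_fourier T))"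

text \<open>Membership in \<open>C\<^sup>\<infinity>([0,\<infinity>))\<close>, with one-sided derivatives at \<open>0\<close>.\<close>

definition smooth_half_line :: "(real \<Rightarrow> complex) \<Rightarrow> bool" where
  "smooth_half_line \<phi> \<longleftrightarrow>
     (\<exists>D. (\<forall>t\<ge>0. D 0 t = \<phi> t) \<and>
          (\<forall>n::nat. \<forall>t\<ge>0. (D n has_vector_derivative D (Suc n) t) (at t within {0..})))"

definition cutoff :: "(real \<Rightarrow> complex) \<Rightarrow> bool" where
  "cutoff \<phi>0 \<longleftrightarrow>
     smooth_half_line \<phi>0 \<and> (\<forall>t\<in>{0..1/4}. \<phi>0 t = 1) \<and> closure {t. 0 \<le> t \<and> \<phi>0 t \<noteq> 0} \<subseteq> {0..1}"

definition LP_S :: "(real \<Rightarrow> complex) \<Rightarrow> int \<Rightarrow> dist \<Rightarrow> dist" where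
  "LP_S \<phi>0 j = fourier_multiplier (\<lambda>\<xi>. \<phi>0 (4 powi (- j) * (norm \<xi>)\<^sup>2))"

definition LP_Delta :: "(real \<Rightarrow> complex) \<Rightarrow> int \<Rightarrow> dist \<Rightarrow> dist" where
  "LP_Delta \<phi>0 j =
     (let \<psi>0 = (\<lambda>t. \<phi>0 (t / 4) - \<phi>0 t)
      in fourier_multiplier (\<lambda>\<xi>. \<psi>0 (4 powi (- j) * (norm \<xi>)\<^sup>2)))"

definition dyadic_annulus :: "int \<Rightarrow> R3 set" where
  "dyadic_annulus j = {\<xi>. 2 powi (j - 1) \<le> norm \<xi> \<and> norm \<xi> \<le> 2 powi (j + 1)}"

text \<open>
  \<open>E\<close> with norm \<open>N\<close> is the dual of a Banach space \<open>F\<close> (with norm \<open>M\<close>) which contains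
  \<^const>\<open>schwartz\<close> (through the embedding \<open>\<iota>\<close>) as a dense subspace: restriction of functionals
  from \<open>F\<close> to \<^const>\<open>schwartz\<close> is an isometric bijection from the dual of \<open>F\<close> onto \<open>E\<close>.
  Every Banach space whose dual is \<open>E\<close> is, by evaluation, a space of functions on \<open>E\<close>; so
  realising \<open>F\<close> inside the type \<^typ>\<open>dist \<Rightarrow> complex\<close> is no restriction.
\<close>

definition dual_of_schwartz_completion :: "dist set \<Rightarrow> (dist \<Rightarrow> real) \<Rightarrow> bool" where
  "dual_of_schwartz_completion E N \<longleftrightarrow>
     (\<exists>(F :: (dist \<Rightarrow> complex) set) M \<iota>.
        complex_banach F M \<and>
        (\<forall>\<phi>\<in>schwartz. \<forall>\<psi>\<in>schwartz. \<iota> (\<phi> + \<psi>) = \<iota> \<phi> + \<iota> \<psi>) \<and>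
        (\<forall>\<phi>\<in>schwartz. \<forall>c. \<iota> (\<lambda>x. c * \<phi> x) = (\<lambda>T. c * \<iota> \<phi> T)) \<and>
        inj_on \<iota> schwartz \<and>
        continuous_map schwartz_topology (seminorm_topology F {M}) \<iota> \<and>
        seminorm_topology F {M} closure_of (\<iota> ` schwartz) = F \<and>
        (\<forall>T\<in>E. \<exists>L. bounded_functional F M L \<and> (\<forall>\<phi>\<in>schwartz. L (\<iota> \<phi>) = T \<phi>) \<and>
                    N T = dual_norm F M L) \<and>
        (\<forall>L. bounded_functional F M L \<longrightarrow> (\<exists>T\<in>E. \<forall>\<phi>\<in>schwartz. L (\<iota> \<phi>) = T \<phi>)))"

definition functional_space :: "(real \<Rightarrow> complex) \<Rightarrow> dist set \<Rightarrow> (dist \<Rightarrow> real) \<Rightarrow> bool" where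
  "functional_space \<phi>0 E N \<longleftrightarrow>
     complex_banach E N \<and>
     regular ` schwartz \<subseteq> E \<and> E \<subseteq> tempered \<and>
     continuous_map schwartz_topology (seminorm_topology E {N}) regular \<and>
     continuous_map (seminorm_topology E {N}) tempered_topology (\<lambda>T. T) \<and>
     (seminorm_topology E {N} closure_of (regular ` schwartz) = E \<or>
      dual_of_schwartz_completion E N) \<and>
     (\<forall>T\<in>E. limitin tempered_topology (\<lambda>j. LP_S \<phi>0 j T) 0 at_bot)"

definition good_space :: "(real \<Rightarrow> complex) \<Rightarrow> dist set \<Rightarrow> (dist \<Rightarrow> real) \<Rightarrow> bool" where
  "good_space \<phi>0 E N \<longleftrightarrow>
     functional_space \<phi>0 E N \<and>
     (\<forall>T\<in>E. \<forall>x0. \<forall>r>0. dist_rescale r x0 T \<in> E \<and> N (dist_rescale r x0 T) = N T) \<and>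
     (\<exists>\<eta> :: int \<Rightarrow> real.
        (\<forall>n. 0 \<le> \<eta> n) \<and> \<eta> summable_on UNIV \<and>
        (\<forall>S\<in>E. \<forall>T\<in>E. \<forall>k l j.
           dist_support (dist_fourier S) \<subseteq> dyadic_annulus k \<and>
           dist_support (dist_fourier T) \<subseteq> dyadic_annulus l \<longrightarrow>
           LP_Delta \<phi>0 j (dist_product S T) \<in> E \<and>
           N (LP_Delta \<phi>0 j (dist_product S T))
             \<le> \<eta> (max (k - j) (l - j)) * 2 powi (k + l - j) * N S * N T))"

definition Lp_functions :: "real \<Rightarrow> func set" where
  "Lp_functions p =
     {u \<in> borel_measurable lborel. integrable lborel (\<lambda>x. cmod (u x) powr p)}"

definition Lp_space :: "real \<Rightarrow> dist set" where
  "Lp_space p = regular ` Lp_functions p"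

text \<open>The value does not depend on the representative: functions in \<open>L\<^sup>p\<close>, \<open>p \<ge> 1\<close>, which
  define the same distribution agree almost everywhere.\<close>

definition Lp_norm :: "real \<Rightarrow> dist \<Rightarrow> real" where
  "Lp_norm p T =
     (THE r. \<exists>u\<in>Lp_functions p. T = regular u \<and>
             r = (LINT x|lborel. cmod (u x) powr p) powr (1 / p))"

end

theory Submission
  imports Defs "HOL-Probability.Sinc_Integral" "HOL-Probability.Characteristic_Functions"
begin

text \<open>
  Let \<open>k\<^sub>j\<close> be the inverse Fourier transform of \<open>\<phi>0(4\<^sup>-\<^sup>j|\<xi>|\<^sup>2)\<close>. The operator \<open>S\<^sub>j\<close> is the
  convolution with \<open>k\<^sub>j\<close>, and the \<open>k\<^sub>j\<close> are \<open>L\<^sup>1\<close>-normalised dilates of one Schwartz function; hence the \<open>S\<^sub>j\<close>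
  are uniformly bounded on \<open>L\<^sup>3\<close>, and they map \<open>L\<^sup>3\<close> into \<open>L\<^sup>\<infinity>\<close> with norm \<open>O(2\<^sup>j)\<close>. A function with
  spectrum in \<open>\<Gamma>\<^sub>k\<close> is reproduced by \<open>S\<^sub>k\<^sub>+\<^sub>3\<close>, so it is bounded by \<open>O(2\<^sup>k)\<close> times its \<open>L\<^sup>3\<close> norm. Since
  \<open>\<Delta>\<^sub>j = S\<^sub>j\<^sub>+\<^sub>1 - S\<^sub>j\<close>, the norm of \<open>\<Delta>\<^sub>j(fg)\<close> is at most a constant times
  \<open>2\<^bsup>min(k,l)\<^esup> = 2\<^bsup>-max(k-j,l-j)\<^esup> 2\<^bsup>k+l-j\<^esup>\<close> times the norms of \<open>f\<close> and \<open>g\<close>. If \<open>max(k-j,l-j) < -5\<close>, then the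
  spectrum of \<open>fg\<close> lies where the multiplier of \<open>\<Delta>\<^sub>j\<close> vanishes, so \<open>\<eta>\<^sub>n\<close> may be set to \<open>0\<close> for \<open>n < -5\<close>
  and becomes summable.
\<close>

section \<open>Schwartz functions\<close>

text \<open>\<open>dist_support\<close> is probed only by compactly supported test functions,
  whereas the proof must pair \<open>regular u\<close> with \<open>fourier h\<close> for Schwartz
  \<open>h\<close> of unbounded support. The bridge is \<open>regular_fourier_eq_0\<close>:
  \<open>h\<close> is truncated in frequency, and the remainder w is controlled by Hoelder's
  inequality in the form ||w||_{3/2}^3 <= ||w||_1^2 ||w||_inf, where the first norm stays bounded
  and the second tends to 0. The product of two distributions is formed from representatives chosen
  by a definite description. The reproducing formula therefore serves twice: it yields the sup
  bound, and it exhibits the continuous representative that the description selects. The spectrum of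
  a product is not obtained as the support of a convolution of distributions. Fubini moves one
  factor onto the test function, and the spectral hypothesis is then applied to the other factor
  alone. Fourier inversion is proved up to a nonzero factor \<open>\<kappa>\<close>, by which the
  reproducing formula is divided; no Gaussian integral has to be evaluated. The Hoelder and
  Minkowski inequalities for exponent 3 both come from 3xy^2 <= x^3 + 2y^3.\<close>

definition rapid :: "func \<Rightarrow> bool" where
  "rapid f \<longleftrightarrow> (\<forall>k::nat. \<exists>C. \<forall>x. (1 + norm x) ^ k * cmod (f x) \<le> C)"

lemma rapidD:
  assumes "rapid f" obtains C where "C > 0" "\<And>x. (1 + norm x) ^ k * cmod (f x) \<le> C"
proof -
  obtain C where C: "\<And>x. (1 + norm x) ^ k * cmod (f x) \<le> C"
    using assms unfolding rapid_def by blast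
  show thesis
    by (rule that[of "max C 1"]) (use C in \<open>auto simp: le_max_iff_disj\<close>)
qed

lemma rapid_bounded_iff:
  "(\<forall>k::nat. bounded (range (\<lambda>x. (1 + norm x) ^ k *\<^sub>R f x))) \<longleftrightarrow> rapid f"
  unfolding rapid_def bounded_iff by (auto simp: norm_power abs_of_nonneg)

lemma rapid_add: "rapid f \<Longrightarrow> rapid g \<Longrightarrow> rapid (\<lambda>x. f x + g x)"
  unfolding rapid_def
proof
  fix k :: nat
  assume "\<forall>k::nat. \<exists>C. \<forall>x. (1 + norm x) ^ k * cmod (f x) \<le> C"
    and "\<forall>k::nat. \<exists>C. \<forall>x. (1 + norm x) ^ k * cmod (g x) \<le> C"
  then obtain C D where "\<forall>x. (1 + norm x) ^ k * cmod (f x) \<le> C" "\<forall>x. (1 + norm x) ^ k * cmod (g x) \<le> D"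
    by meson
  moreover have "(1 + norm x) ^ k * cmod (f x + g x) \<le> (1 + norm x) ^ k * cmod (f x) + (1 + norm x) ^ k * cmod (g x)" for x
    by (simp add: norm_triangle_ineq mult_left_mono flip: distrib_left)
  ultimately show "\<exists>C. \<forall>x. (1 + norm x) ^ k * cmod (f x + g x) \<le> C"
    by (intro exI[of _ "C + D"] allI) (smt (verit))
qed

lemma rapid_mult_le:
  assumes f: "rapid f" and b: "\<And>x. cmod (g x) \<le> M * (1 + norm x) ^ n * cmod (f x)"
  shows "rapid g"
  unfolding rapid_def
proof
  fix k :: nat
  obtain C where C: "C > 0" "\<And>x. (1 + norm x) ^ (k + n) * cmod (f x) \<le> C"
    using rapidD[OF f] by metis
  have "(1 + norm x) ^ k * cmod (g x) \<le> \<bar>M\<bar> * C" for x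
  proof -
    have "(1 + norm x) ^ k * cmod (g x) \<le> (1 + norm x) ^ k * (\<bar>M\<bar> * (1 + norm x) ^ n * cmod (f x))"
      by (intro mult_left_mono order_trans[OF b]) (auto intro!: mult_right_mono)
    also have "\<dots> = \<bar>M\<bar> * ((1 + norm x) ^ (k + n) * cmod (f x))"
      by (simp add: power_add)
    also have "\<dots> \<le> \<bar>M\<bar> * C"
      by (intro mult_left_mono C) auto
    finally show ?thesis .
  qed
  then show "\<exists>C. \<forall>x. (1 + norm x) ^ k * cmod (g x) \<le> C" by blast
qed

lemma schwartz_iff:
  "f \<in> schwartz \<longleftrightarrow> (\<forall>is. partials is f differentiable_on UNIV \<and> rapid (partials is f))"
  by (simp add: schwartz_def rapid_bounded_iff)

lemma partials_simps [simp]: "partials [] f = f" "partials (i # is) f = partial i (partials is f)"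
  by (simp_all add: partials_def)

lemma partials_append: "partials (is @ js) f = partials is (partials js f)"
  by (simp add: partials_def)

text \<open>\<open>schwartz\<close> is the largest set of differentiable, rapidly decreasing
  functions that is stable under all \<open>partial i\<close>. Exhibiting a stable set replaces
  computations with iterated partial derivatives.\<close>

lemma schwartz_coinduct:
  assumes "f \<in> A"
    and "\<And>g. g \<in> A \<Longrightarrow> g differentiable_on UNIV"
    and "\<And>g. g \<in> A \<Longrightarrow> rapid g"
    and "\<And>g i. g \<in> A \<Longrightarrow> partial i g \<in> A"
  shows "f \<in> schwartz"
proof -
  have "partials is f \<in> A" for "is"
    by (induction "is") (auto intro: assms)
  then show ?thesis
    using assms by (auto simp: schwartz_iff)
qed

lemma schwartz_differentiable: "f \<in> schwartz \<Longrightarrow> f differentiable_on UNIV"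
  and schwartz_rapid: "f \<in> schwartz \<Longrightarrow> rapid f"
  unfolding schwartz_iff by (metis partials_simps(1))+

lemma schwartz_partial: "f \<in> schwartz \<Longrightarrow> partial i f \<in> schwartz"
  unfolding schwartz_iff by (metis partials_append partials_simps)

lemma partial_eqI: "(f has_derivative f') (at x) \<Longrightarrow> partial i f x = f' (axis i 1)"
  by (simp add: partial_def frechet_derivative_at[symmetric])

lemma has_derivative_frechet:
  "f differentiable_on UNIV \<Longrightarrow> (f has_derivative frechet_derivative f (at x)) (at x)"
  by (simp add: differentiable_on_def frechet_derivative_works)

lemma
  assumes f: "f differentiable_on UNIV" and g: "g differentiable_on UNIV"
  shows partial_add: "partial i (\<lambda>x. f x + g x) = (\<lambda>x. partial i f x + partial i g x)"
    and partial_mult: "partial i (\<lambda>x. f x * g x) = (\<lambda>x. partial i f x * g x + f x * partial i g x)"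
  by (rule ext, rule partial_eqI[THEN trans],
      rule has_derivative_add has_derivative_mult,
      rule has_derivative_frechet[OF f], rule has_derivative_frechet[OF g],
      simp add: partial_def)+

lemma partial_cmult:
  assumes f: "f differentiable_on UNIV"
  shows "partial i (\<lambda>x. c * f x) = (\<lambda>x. c * partial i f x)"
  by (rule ext, rule partial_eqI[THEN trans], rule has_derivative_mult_right,
      rule has_derivative_frechet[OF f], simp add: partial_def)

lemma partial_coord:
  "partial i (\<lambda>x. complex_of_real (x $ j)) = (\<lambda>x. if i = j then 1 else 0)"
proof
  fix x :: R3
  have "((\<lambda>x. complex_of_real (x $ j)) has_derivative (\<lambda>x. complex_of_real (x $ j))) (at x)"
    by (intro bounded_linear_imp_has_derivative bounded_linear_compose[OF bounded_linear_of_real]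
      bounded_linear_vec_nth)
  from partial_eqI[OF this, of i] show "partial i (\<lambda>x. complex_of_real (x $ j)) x = (if i = j then 1 else 0)"
    by (simp add: axis_def)
qed

lemma differentiable_coord: "(\<lambda>x::R3. complex_of_real (x $ j)) differentiable_on UNIV"
  by (intro differentiable_at_imp_differentiable_on bounded_linear_imp_differentiable
      bounded_linear_compose[OF bounded_linear_of_real] bounded_linear_vec_nth)

lemma rapid_cmult: "rapid f \<Longrightarrow> rapid (\<lambda>x. c * f x)"
  by (rule rapid_mult_le[of f _ "cmod c" 0]) (auto simp: norm_mult)

lemma rapid_coord:
  assumes "rapid f" shows "rapid (\<lambda>x. complex_of_real (x $ i) * f x)"
proof (rule rapid_mult_le[OF assms, of _ 1 1])
  have "\<bar>x $ i\<bar> \<le> 1 + norm x" for x :: R3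
    using component_le_norm_cart[of x i] by linarith
  then show "cmod (complex_of_real (x $ i) * f x) \<le> 1 * (1 + norm x) ^ 1 * cmod (f x)" for x
    by (simp add: norm_mult mult_right_mono)
qed

lemma rapid_mult:
  assumes "rapid f" "rapid g" shows "rapid (\<lambda>x. f x * g x)"
proof -
  obtain C where C: "\<And>x. cmod (g x) \<le> C"
    using rapidD[OF assms(2), of 0] by (metis mult_1 power_0)
  show ?thesis
    by (rule rapid_mult_le[OF assms(1), of _ C 0])
      (use C in \<open>auto simp: norm_mult mult.commute[of _ "cmod (g _)"] intro!: mult_right_mono\<close>)
qed

text \<open>Closing under all operations at once makes the set stable under partial derivatives, so that
  coinduction applies to it.\<close>

inductive_set schwartz_algebra :: "func set" where
  base: "f \<in> schwartz \<Longrightarrow> f \<in> schwartz_algebra"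
| zero: "(\<lambda>x. 0) \<in> schwartz_algebra"
| add: "f \<in> schwartz_algebra \<Longrightarrow> g \<in> schwartz_algebra \<Longrightarrow> (\<lambda>x. f x + g x) \<in> schwartz_algebra"
| cmult: "f \<in> schwartz_algebra \<Longrightarrow> (\<lambda>x. c * f x) \<in> schwartz_algebra"
| coord: "f \<in> schwartz_algebra \<Longrightarrow> (\<lambda>x. complex_of_real (x $ i) * f x) \<in> schwartz_algebra"
| mult: "f \<in> schwartz_algebra \<Longrightarrow> g \<in> schwartz_algebra \<Longrightarrow> (\<lambda>x. f x * g x) \<in> schwartz_algebra"

lemma partial_zero: "partial i (\<lambda>x. 0) = (\<lambda>x. 0)"
  by (rule ext, rule partial_eqI[OF has_derivative_const])

lemma schwartz_algebra_eq: "schwartz_algebra = schwartz"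
proof -
  have *: "h differentiable_on UNIV \<and> rapid h \<and> (\<forall>i. partial i h \<in> schwartz_algebra)"
    if "h \<in> schwartz_algebra" for h
    using that
  proof induction
    case (base f)
    then show ?case
      by (simp add: schwartz_differentiable schwartz_rapid schwartz_partial schwartz_algebra.base)
  next
    case zero
    then show ?case
      by (auto simp: partial_zero rapid_def intro: schwartz_algebra.zero)
  next
    case (add f g)
    then show ?case
      by (simp add: partial_add differentiable_on_add rapid_add schwartz_algebra.add)
  next
    case (cmult f c)
    then show ?case
      by (simp add: partial_cmult differentiable_on_mult rapid_cmult schwartz_algebra.cmult)
  next
    case (coord f j)
    have "partial i (\<lambda>x. complex_of_real (x $ j) * f x) = (\<lambda>x. (if i = j then 1 else 0) * f x + complex_of_real (x $ j) * partial i f x)" for i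
      using coord by (simp add: partial_mult differentiable_coord partial_coord)
    moreover have "(\<lambda>x. (if i = j then 1 else 0) * f x + complex_of_real (x $ j) * partial i f x) \<in> schwartz_algebra" for i
      using coord by (intro schwartz_algebra.add[OF schwartz_algebra.cmult schwartz_algebra.coord]) auto
    ultimately show ?case
      using coord by (simp add: differentiable_on_mult differentiable_coord rapid_coord)
  next
    case (mult f g)
    then show ?case
      by (simp add: partial_mult differentiable_on_mult rapid_mult
          schwartz_algebra.add[OF schwartz_algebra.mult schwartz_algebra.mult])
  qed
  have "h \<in> schwartz" if "h \<in> schwartz_algebra" for h
    by (rule schwartz_coinduct[OF that]) (use * in simp_all)
  then show ?thesis
    by (auto intro: schwartz_algebra.base)
qed

lemmas schwartz_0 = schwartz_algebra.zero[unfolded schwartz_algebra_eq]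
  and schwartz_add_fun = schwartz_algebra.add[unfolded schwartz_algebra_eq]
  and schwartz_cmult = schwartz_algebra.cmult[unfolded schwartz_algebra_eq]
  and schwartz_coord = schwartz_algebra.coord[unfolded schwartz_algebra_eq]
  and schwartz_mult = schwartz_algebra.mult[unfolded schwartz_algebra_eq]

lemma schwartz_diff_fun: "f \<in> schwartz \<Longrightarrow> g \<in> schwartz \<Longrightarrow> (\<lambda>x. f x - g x) \<in> schwartz"
  using schwartz_add_fun[OF _ schwartz_cmult[of g "-1"], of f] by simp

text \<open>For fixed \<open>c\<close> and \<open>a\<close>, the functions f(cx + a) with
  \<open>f\<close> Schwartz form a set stable under partial derivatives: the chain-rule factor
  \<open>c\<close> is absorbed into \<open>f\<close>.\<close>

lemma schwartz_rescale:
  assumes f: "f \<in> schwartz" and c: "c \<noteq> 0"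
  shows "(\<lambda>x. f (c *\<^sub>R x + a)) \<in> schwartz"
proof (rule schwartz_coinduct[where A = "{\<lambda>x. f (c *\<^sub>R x + a) |f. f \<in> schwartz}"])
  show "(\<lambda>x. f (c *\<^sub>R x + a)) \<in> {\<lambda>x. f (c *\<^sub>R x + a) |f. f \<in> schwartz}"
    using f by blast
next
  fix g assume "g \<in> {\<lambda>x. f (c *\<^sub>R x + a) |f. f \<in> schwartz}"
  then obtain f where g: "g = (\<lambda>x. f (c *\<^sub>R x + a))" and f: "f \<in> schwartz" by blast
  have d: "(g has_derivative (\<lambda>h. frechet_derivative f (at (c *\<^sub>R x + a)) (c *\<^sub>R h))) (at x)" for x
    unfolding g
    by (rule has_derivative_compose[OF _ has_derivative_frechet[OF schwartz_differentiable[OF f]]])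
      (auto intro!: derivative_eq_intros)
  then show "g differentiable_on UNIV"
    by (meson differentiableI differentiable_at_imp_differentiable_on)
  show "rapid g"
    unfolding rapid_def
  proof
    fix k :: nat
    obtain C where C: "C > 0" "\<And>x. (1 + norm x) ^ k * cmod (f x) \<le> C"
      using rapidD[OF schwartz_rapid[OF f]] by metis
    \<comment> \<open>Large enough for 1 + |x| <= M (1 + |cx + a|), so that decay in cx + a becomes
      decay in x.\<close>
    define M where "M = 1 + (1 + norm a) / \<bar>c\<bar> + norm a"
    have "(1 + norm x) ^ k * cmod (g x) \<le> M ^ k * C" for x
    proof -
      have "\<bar>c\<bar> * norm x \<le> norm (c *\<^sub>R x + a) + norm a"
        by (metis norm_scaleR norm_triangle_sub add_diff_cancel_right' add.commute norm_minus_commute norm_triangle_ineq2 diff_le_eq)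
      then have "norm x \<le> norm (c *\<^sub>R x + a) / \<bar>c\<bar> + norm a / \<bar>c\<bar>"
        using c by (simp add: field_simps)
      also have "\<dots> + 1 \<le> M * (1 + norm (c *\<^sub>R x + a))"
        using c by (simp add: M_def field_simps)
      finally have *: "1 + norm x \<le> M * (1 + norm (c *\<^sub>R x + a))" by simp
      have "(1 + norm x) ^ k * cmod (g x) \<le> (M * (1 + norm (c *\<^sub>R x + a))) ^ k * cmod (g x)"
        by (intro mult_right_mono power_mono *) auto
      also have "\<dots> = M ^ k * ((1 + norm (c *\<^sub>R x + a)) ^ k * cmod (f (c *\<^sub>R x + a)))"
        by (simp add: g power_mult_distrib)
      also have "\<dots> \<le> M ^ k * C"
        by (intro mult_left_mono C) (auto simp: M_def)
      finally show ?thesis .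
    qed
    then show "\<exists>C. \<forall>x. (1 + norm x) ^ k * cmod (g x) \<le> C" by blast
  qed
  fix i
  have "partial i g x = c *\<^sub>R partial i f (c *\<^sub>R x + a)" for x
    using partial_eqI[OF d[of x], of i]
      linear_scale[OF has_derivative_linear[OF has_derivative_frechet[OF schwartz_differentiable[OF f]]]]
    by (simp add: partial_def)
  then have "partial i g = (\<lambda>x. (\<lambda>y. complex_of_real c * partial i f y) (c *\<^sub>R x + a))"
    by (simp add: scaleR_conv_of_real fun_eq_iff)
  then show "partial i g \<in> {\<lambda>x. f (c *\<^sub>R x + a) |f. f \<in> schwartz}"
    using schwartz_cmult[OF schwartz_partial[OF f, of i], of "complex_of_real c"]
    by (intro CollectI exI[of _ "\<lambda>y. complex_of_real c * partial i f y"]) simp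
qed

lemma schwartz_seminorm_upper:
  assumes "f \<in> schwartz" shows "(1 + norm x) ^ k * cmod (f x) \<le> schwartz_seminorm k [] f"
proof -
  obtain C where "\<And>x. (1 + norm x) ^ k * cmod (f x) \<le> C"
    using rapidD[OF schwartz_rapid[OF assms]] by metis
  then have "bdd_above (range (\<lambda>x. (1 + norm x) ^ k * cmod (f x)))"
    by (auto intro!: bdd_aboveI2)
  then show ?thesis
    unfolding schwartz_seminorm_def partials_simps by (rule cSUP_upper[OF UNIV_I])
qed

lemma schwartz_seminorm_nonneg: "f \<in> schwartz \<Longrightarrow> schwartz_seminorm k [] f \<ge> 0"
  using order_trans[OF norm_ge_zero[of "f 0"]] schwartz_seminorm_upper[of f 0 k] by simp

lemma schwartz_le_seminorm: "f \<in> schwartz \<Longrightarrow> cmod (f x) \<le> schwartz_seminorm 0 [] f"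
  using schwartz_seminorm_upper[of f x 0] by simp

text \<open>Structural induction on the polynomial; a linear form is expanded in coordinates.
  \<open>f\<close> stays arbitrary because the product case applies one induction hypothesis to the
  result of the other.\<close>

lemma real_polynomial_mult_schwartz:
  assumes "real_polynomial_function p" "f \<in> schwartz"
  shows "(\<lambda>x. complex_of_real (p x) * f x) \<in> schwartz"
  using assms
proof (induction p arbitrary: f rule: real_polynomial_function.induct)
  case (linear p)
  have "p x = (\<Sum>i\<in>UNIV. (x $ i) * p (axis i 1))" for x
  proof -
    have "(\<Sum>i\<in>UNIV. (x $ i) *\<^sub>R axis i 1) = x"
      using basis_expansion[of x] by (simp only: scalar_mult_eq_scaleR)
    moreover have "p (\<Sum>i\<in>UNIV. (x $ i) *\<^sub>R axis i 1) = (\<Sum>i\<in>UNIV. (x $ i) * p (axis i 1))"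
      by (simp add: linear_sum[OF bounded_linear.linear[OF linear(1)]] linear_scale[OF bounded_linear.linear[OF linear(1)]])
    ultimately show ?thesis by (simp only:)
  qed
  then obtain c where "\<And>x. p x = (\<Sum>i\<in>UNIV. (x $ i) * c i)"
    by (rule that[of "\<lambda>i. p (axis i 1)"])
  then have "(\<lambda>x. complex_of_real (p x) * f x) = (\<lambda>x. \<Sum>i\<in>UNIV. of_real (c i) * (of_real (x $ i) * f x))"
    unfolding fun_eq_iff by (simp add: sum_distrib_left sum_distrib_right mult_ac)
  moreover have "(\<lambda>x. \<Sum>i\<in>I. of_real (c i) * (of_real (x $ i) * f x)) \<in> schwartz" if "finite I" for I
    using that by induction (auto intro!: schwartz_0 schwartz_add_fun schwartz_cmult schwartz_coord linear)
  ultimately show ?case by simp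
next
  case (const c)
  then show ?case by (intro schwartz_cmult)
next
  case (add p q)
  from schwartz_add_fun[OF add.IH(1)[OF add.prems] add.IH(2)[OF add.prems]]
  show ?case by (simp add: distrib_right)
next
  case (mult p q)
  from mult.IH(1)[OF mult.IH(2)[OF mult.prems]]
  show ?case by (simp add: mult.assoc)
qed

lemma schwartz_reflect: "f \<in> schwartz \<Longrightarrow> (\<lambda>x. f (- x)) \<in> schwartz"
  using schwartz_rescale[of f "-1" 0] by simp

lemma schwartz_shift: "f \<in> schwartz \<Longrightarrow> (\<lambda>x. f (x + a)) \<in> schwartz"
  using schwartz_rescale[of f 1 a] by simp

lemma schwartz_scale: "f \<in> schwartz \<Longrightarrow> c \<noteq> 0 \<Longrightarrow> (\<lambda>x. f (c *\<^sub>R x)) \<in> schwartz"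
  using schwartz_rescale[of f c 0] by simp

lemma schwartz_convolution_point: "f \<in> schwartz \<Longrightarrow> (\<lambda>x. f (a - x)) \<in> schwartz"
  using schwartz_rescale[of f "-1" a] by simp

lemma rapid_compact_support:
  assumes c: "continuous_on UNIV f" and s: "\<And>x. norm x > r \<Longrightarrow> f x = 0"
  shows "rapid f"
  unfolding rapid_def
proof
  fix k :: nat
  have "continuous_on (cball 0 r) (\<lambda>x. (1 + norm x) ^ k * cmod (f x))"
    using continuous_on_subset[OF c, of "cball 0 r"] by (intro continuous_intros) auto
  then have "compact ((\<lambda>x. (1 + norm x) ^ k * cmod (f x)) ` cball 0 r)"
    by (rule compact_continuous_image) (rule compact_cball)
  then have "bdd_above ((\<lambda>x. (1 + norm x) ^ k * cmod (f x)) ` cball 0 r)"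
    by (rule bounded_imp_bdd_above[OF compact_imp_bounded])
  then obtain C where "\<forall>y \<in> (\<lambda>x. (1 + norm x) ^ k * cmod (f x)) ` cball 0 r. y \<le> C"
    unfolding bdd_above_def ..
  then have "(1 + norm x) ^ k * cmod (f x) \<le> C" if "norm x \<le> r" for x
    using that by (simp add: Ball_def)
  then have "(1 + norm x) ^ k * cmod (f x) \<le> max C 0" for x
    using s[of x] by (cases "norm x \<le> r") (simp_all add: le_max_iff_disj)
  then show "\<exists>C. \<forall>x. (1 + norm x) ^ k * cmod (f x) \<le> C" by blast
qed

text \<open>\<open>D n\<close> will be the n-th derivative of the cutoff. Since the i-th partial
  derivative of D_n(x . x) is 2 x_i D_{n+1}(x . x), this is a stable set for
  \<open>schwartz_coinduct\<close>; the argument x . x instead of |x| keeps everything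
  differentiable at the origin.\<close>

inductive_set radial_class :: "(nat \<Rightarrow> real \<Rightarrow> complex) \<Rightarrow> func set" for D where
  base: "(\<lambda>x. D n (x \<bullet> x)) \<in> radial_class D"
| add: "f \<in> radial_class D \<Longrightarrow> g \<in> radial_class D \<Longrightarrow> (\<lambda>x. f x + g x) \<in> radial_class D"
| coord: "f \<in> radial_class D \<Longrightarrow> (\<lambda>x. complex_of_real (x $ i) * f x) \<in> radial_class D"

lemma cutoff_eq_0:
  assumes "cutoff \<phi>0" "t > 1" shows "\<phi>0 t = 0"
proof (rule ccontr)
  assume "\<phi>0 t \<noteq> 0"
  then have "t \<in> closure {t. 0 \<le> t \<and> \<phi>0 t \<noteq> 0}"
    using assms(2) by (intro subsetD[OF closure_subset]) simp
  moreover have "closure {t. 0 \<le> t \<and> \<phi>0 t \<noteq> 0} \<subseteq> {0..1}"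
    using assms(1) by (simp add: cutoff_def)
  ultimately show False
    using assms(2) by (auto simp del: closure_subset)
qed

lemma radial_schwartz:
  assumes \<phi>: "cutoff \<phi>0" shows "(\<lambda>x. \<phi>0 ((norm x)\<^sup>2)) \<in> schwartz"
proof -
  have "smooth_half_line \<phi>0"
    using \<phi> by (simp add: cutoff_def)
  then obtain D where DD: "(\<forall>t\<ge>0. D 0 t = \<phi>0 t) \<and>
      (\<forall>n. \<forall>t\<ge>0. (D n has_vector_derivative D (Suc n) t) (at t within {0..}))"
    unfolding smooth_half_line_def ..
  then have D0: "D 0 t = \<phi>0 t"
    and D: "(D n has_vector_derivative D (Suc n) t) (at t within {0..})" if "t \<ge> 0" for n t
    using that by simp_all
  \<comment> \<open>On the open half-line beyond 1 each \<open>D n\<close> is identically 0, hence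
    so is its derivative \<open>D (Suc n)\<close>.\<close>
  have zero: "D n t = 0" if "t > 1" for n t
    using that
  proof (induction n arbitrary: t)
    case 0
    then show ?case using D0[of t] cutoff_eq_0[OF \<phi>, of t] by simp
  next
    case (Suc n)
    have "(D n has_vector_derivative D (Suc n) t) (at t within {1<..})"
      by (rule has_vector_derivative_within_subset[OF D]) (use Suc in auto)
    then have "(D n has_vector_derivative D (Suc n) t) (at t)"
      using Suc by (simp add: at_within_open[of t "{1<..}"])
    moreover have "(D n has_vector_derivative 0) (at t)"
      by (rule has_vector_derivative_transform_within_open[where S="{1<..}" and f="\<lambda>_. 0"])
         (use Suc in auto)
    ultimately show ?case
      by (metis vector_derivative_at)
  qed
  have der: "((\<lambda>x. D n (x \<bullet> x)) has_derivative (\<lambda>h. (2 * (x \<bullet> h)) *\<^sub>R D (Suc n) (x \<bullet> x))) (at x)" for n and x :: R3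
  proof -
    \<comment> \<open>x . x takes values in [0, \<infinity>) only, so the derivative within that
      half-line, one-sided at 0, is enough for the chain rule.\<close>
    have "(D n has_derivative (\<lambda>h. h *\<^sub>R D (Suc n) (x \<bullet> x))) (at (x \<bullet> x) within range (\<lambda>x::R3. x \<bullet> x))"
      using D[of "x \<bullet> x" n] unfolding has_vector_derivative_def
      by (rule has_derivative_subset) auto
    moreover have "((\<lambda>x. x \<bullet> x) has_derivative (\<lambda>h. 2 * (x \<bullet> h))) (at x)"
      by (auto intro!: derivative_eq_intros simp: inner_commute)
    ultimately show ?thesis
      using has_derivative_in_compose[of "\<lambda>x. x \<bullet> x" _ x UNIV "D n"] by auto
  qed
  have *: "h differentiable_on UNIV \<and> (\<forall>x. norm x > 1 \<longrightarrow> h x = 0) \<and> (\<forall>i. partial i h \<in> radial_class D)"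
    if "h \<in> radial_class D" for h
    using that
  proof induction
    case (base n)
    have "partial i (\<lambda>x. D n (x \<bullet> x)) = (\<lambda>x. complex_of_real (x $ i) * D (Suc n) (x \<bullet> x) + complex_of_real (x $ i) * D (Suc n) (x \<bullet> x))" for i
      by (rule ext, subst partial_eqI[OF der]) (simp add: inner_axis scaleR_conv_of_real)
    then have "partial i (\<lambda>x. D n (x \<bullet> x)) \<in> radial_class D" for i
      by (simp only:) (intro radial_class.intros)
    moreover have "(\<lambda>x::R3. D n (x \<bullet> x)) differentiable_on UNIV"
      using der[of n] by (meson differentiableI differentiable_at_imp_differentiable_on)
    moreover have "D n (x \<bullet> x) = 0" if "norm x > 1" for x :: R3
      using that zero[of "x \<bullet> x" n] by (metis one_less_power power2_norm_eq_inner zero_less_numeral)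
    ultimately show ?case
      by blast
  next
    case (add f g)
    then show ?case
      by (auto simp: partial_add intro!: differentiable_on_add radial_class.intros)
  next
    case (coord f j)
    have "partial i (\<lambda>x. complex_of_real (x $ j) * f x) = (\<lambda>x. (if i = j then 1 else 0) * f x + complex_of_real (x $ j) * partial i f x)" for i
      using coord by (simp add: partial_mult differentiable_coord partial_coord)
    also have "(\<lambda>x. (if i = j then 1 else 0) * f x + complex_of_real (x $ j) * partial i f x) \<in> radial_class D" for i
      using coord by (cases "i = j") (auto intro!: radial_class.intros)
    finally show ?case
      using coord by (auto simp: differentiable_coord intro!: differentiable_on_mult)
  qed
  have "(\<lambda>x. D 0 (x \<bullet> x)) \<in> schwartz"
    by (rule schwartz_coinduct[where A = "radial_class D"])
       (use * in \<open>auto intro: radial_class.base rapid_compact_support[where r=1] differentiable_imp_continuous_on\<close>)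
  then show ?thesis
    by (simp add: D0 power2_norm_eq_inner)
qed

lemma cutoff_eq_1: "cutoff \<phi>0 \<Longrightarrow> 0 \<le> t \<Longrightarrow> t \<le> 1/4 \<Longrightarrow> \<phi>0 t = 1"
  by (auto simp: cutoff_def)

section \<open>The Fourier transform on Schwartz functions\<close>

lemma schwartz_continuous: "f \<in> schwartz \<Longrightarrow> continuous_on UNIV f"
  by (intro differentiable_imp_continuous_on schwartz_differentiable)

lemma schwartz_measurable [measurable_dest]: "f \<in> schwartz \<Longrightarrow> f \<in> borel_measurable borel"
  by (intro borel_measurable_continuous_onI schwartz_continuous)

section \<open>An integrable weight on R^3\<close>

definition weight :: "R3 \<Rightarrow> real" where
  "weight x = inverse ((1 + norm x) ^ 6)"

lemma weight_bounds: "0 \<le> weight x" "weight x \<le> 1"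
  by (auto simp: weight_def inverse_le_1_iff one_le_power)

lemma le_weight:
  assumes "(1 + norm x) ^ 6 * c \<le> S" shows "c \<le> S * weight x"
proof -
  have "(1 + norm x) ^ 6 > 0" by (intro zero_less_power add_pos_nonneg) auto
  then show ?thesis using assms by (simp add: weight_def field_simps)
qed

text \<open>Each of the three factors 1 + x_b^2 is at most (1 + |x|)^2; this is where the exponent 6
  comes from. The weight is thus dominated by a product of functions 1/(1 + t^2) of one
  variable.\<close>

lemma integrable_weight: "integrable lborel weight"
  unfolding weight_def[abs_def]
proof (rule integrableI_bounded)
  show "(\<lambda>x::R3. inverse ((1 + norm x) ^ 6)) \<in> borel_measurable lborel" by measurable
  have le: "inverse ((1 + norm x) ^ 6) \<le> (\<Prod>b\<in>Basis. inverse (1 + (x \<bullet> b)\<^sup>2))" for x :: R3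
  proof -
    have "(\<Prod>b\<in>Basis. (1 + (x \<bullet> b)\<^sup>2)) \<le> (\<Prod>b\<in>(Basis::R3 set). (1 + norm x)\<^sup>2)"
    proof (rule prod_mono, safe)
      fix b :: R3 assume "b \<in> Basis"
      then have "\<bar>x \<bullet> b\<bar> \<le> norm x"
        by (rule Basis_le_norm)
      then have "(x \<bullet> b)\<^sup>2 \<le> (norm x)\<^sup>2"
        by (rule abs_le_square_iff[THEN iffD1, of "x \<bullet> b" "norm x", simplified])
      then show "1 + (x \<bullet> b)\<^sup>2 \<le> (1 + norm x)\<^sup>2"
        by (simp only: power2_sum power_one mult_1_right) (use norm_ge_zero[of x] in linarith)
    qed simp
    also have "\<dots> = (1 + norm x) ^ 6"
      by (simp add: power_mult[symmetric])
    finally have "inverse ((1 + norm x) ^ 6) \<le> inverse (\<Prod>b\<in>Basis. (1 + (x \<bullet> b)\<^sup>2))"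
      by (intro le_imp_inverse_le prod_pos) (auto intro: add_pos_nonneg)
    then show ?thesis by (simp add: prod_inversef[symmetric] o_def)
  qed
  have fin: "(\<integral>\<^sup>+t. ennreal (inverse (1 + t\<^sup>2)) \<partial>lborel) < \<infinity>"
  proof -
    have "integrable lborel (\<lambda>t::real. inverse (1 + t\<^sup>2))"
      using integrable_inverse_1_plus_square by (simp add: set_integrable_def)
    then show ?thesis
      by (subst nn_integral_eq_integral) auto
  qed
  have "(\<integral>\<^sup>+x. ennreal (norm (inverse ((1 + norm (x::R3)) ^ 6))) \<partial>lborel)
     \<le> (\<integral>\<^sup>+x. (\<Prod>b\<in>Basis. ennreal (inverse (1 + ((x::R3) \<bullet> b)\<^sup>2))) \<partial>lborel)"
    by (intro nn_integral_mono) (use ennreal_leI[OF le] in \<open>simp add: prod_ennreal\<close>)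
  also have "\<dots> = (\<Prod>b\<in>(Basis::R3 set). (\<integral>\<^sup>+t. ennreal (inverse (1 + t\<^sup>2)) \<partial>lborel))"
    by (rule nn_integral_lborel_prod) auto
  also have "\<dots> < \<infinity>"
    using fin by (simp add: power_less_top_ennreal)
  finally show "(\<integral>\<^sup>+x. ennreal (norm (inverse ((1 + norm (x::R3)) ^ 6))) \<partial>lborel) < \<infinity>" .
qed

text \<open>Peetre's inequality 1 + |x| <= (1 + |x + y|)(1 + |y|). It supplies one dominating
  function for all translates by vectors of length at most \<open>b\<close>.\<close>

lemma le_weight_shift:
  fixes x y :: R3
  assumes "(1 + norm (x + y)) ^ 6 * c \<le> S" "c \<ge> 0" "norm y \<le> b"
  shows "c \<le> S * (1 + b) ^ 6 * weight x"
proof (rule le_weight)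
  have "norm x \<le> norm (x + y) + norm y"
    using norm_triangle_ineq4[of "x + y" y] by simp
  also have "\<dots> \<le> norm (x + y) + b" using assms(3) by simp
  finally have "1 + norm x \<le> 1 + norm (x + y) + b" by simp
  moreover have "0 \<le> norm (x + y) * b"
    using order_trans[OF norm_ge_zero assms(3)] by simp
  ultimately have "1 + norm x \<le> (1 + norm (x + y)) * (1 + b)"
    by (simp add: algebra_simps)
  then have "(1 + norm x) ^ 6 * c \<le> ((1 + norm (x + y)) * (1 + b)) ^ 6 * c"
    by (intro mult_right_mono power_mono assms) auto
  also have "\<dots> = (1 + b) ^ 6 * ((1 + norm (x + y)) ^ 6 * c)"
    by (simp only: power_mult_distrib mult_ac)
  also have "\<dots> \<le> (1 + b) ^ 6 * S"
    using order_trans[OF norm_ge_zero assms(3)] by (intro mult_left_mono assms) auto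
  finally show "(1 + norm x) ^ 6 * c \<le> S * (1 + b) ^ 6" by (simp only: mult.commute)
qed

lemma rapid_integrable:
  assumes "rapid f" and [measurable]: "f \<in> borel_measurable borel"
  shows "integrable lborel f"
proof -
  obtain C where C: "C > 0" "\<And>x. (1 + norm x) ^ 6 * cmod (f x) \<le> C"
    using rapidD[OF assms(1)] by metis
  show ?thesis
  proof (rule Bochner_Integration.integrable_bound)
    show "integrable lborel (\<lambda>x. C * weight x)"
      by (intro integrable_mult_right integrable_weight)
    show "AE x in lborel. norm (f x) \<le> norm (C * weight x)"
      using le_weight[OF C(2)] by (intro AE_I2) (auto intro: order_trans[OF _ abs_ge_self])
  qed simp
qed

lemma schwartz_integrable: "f \<in> schwartz \<Longrightarrow> integrable lborel f"
  by (intro rapid_integrable schwartz_rapid schwartz_measurable)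

section \<open>Affine changes of variables in R^3\<close>

lemma nn_integral_affine:
  fixes f :: "R3 \<Rightarrow> ennreal"
  assumes [measurable]: "f \<in> borel_measurable borel" and c: "c \<noteq> 0"
  shows "(\<integral>\<^sup>+x. f (c *\<^sub>R x + a) \<partial>lborel) = ennreal (1 / \<bar>c\<bar> ^ 3) * (\<integral>\<^sup>+x. f x \<partial>lborel)"
proof -
  have "(\<integral>\<^sup>+x. f x \<partial>lborel) = (\<integral>\<^sup>+x. f x \<partial>(density (distr lborel borel (\<lambda>x. a + c *\<^sub>R x)) (\<lambda>_. \<bar>c\<bar> ^ DIM(R3))))"
    using lborel_affine[OF c, of a] by simp
  also have "\<dots> = (\<integral>\<^sup>+x. ennreal (\<bar>c\<bar> ^ 3) * f (c *\<^sub>R x + a) \<partial>lborel)"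
    by (simp add: nn_integral_density nn_integral_distr add.commute power3_eq_cube mult_ac)
  also have "\<dots> = ennreal (\<bar>c\<bar> ^ 3) * (\<integral>\<^sup>+x. f (c *\<^sub>R x + a) \<partial>lborel)"
    by (rule nn_integral_cmult) measurable
  finally show ?thesis
    using c by (simp add: mult.assoc[symmetric] ennreal_mult[symmetric])
qed

lemma integrable_affine:
  fixes f :: "R3 \<Rightarrow> 'b :: {banach, second_countable_topology}"
  assumes f: "integrable lborel f" and c: "c \<noteq> 0"
  shows "integrable lborel (\<lambda>x. f (c *\<^sub>R x + a))"
proof -
  have [measurable]: "f \<in> borel_measurable borel" using f by auto
  show ?thesis
    using f c unfolding integrable_iff_bounded
    by (auto simp: nn_integral_affine[where f = "\<lambda>x. ennreal (norm (f x))"] ennreal_mult_less_top)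
qed

lemma integral_affine:
  fixes f :: "R3 \<Rightarrow> 'b :: {banach, second_countable_topology}"
  assumes [measurable]: "f \<in> borel_measurable borel" and c: "c \<noteq> 0"
  shows "(LINT x|lborel. f (c *\<^sub>R x + a)) = (1 / \<bar>c\<bar> ^ 3) *\<^sub>R (LINT x|lborel. f x)"
proof -
  have "(LINT x|lborel. f x) = (LINT x|(density (distr lborel borel (\<lambda>x. a + c *\<^sub>R x)) (\<lambda>_. \<bar>c\<bar> ^ DIM(R3))). f x)"
    using lborel_affine[OF c, of a] by simp
  also have "\<dots> = (LINT x|lborel. (\<bar>c\<bar> ^ 3) *\<^sub>R f (c *\<^sub>R x + a))"
    by (simp add: integral_density integral_distr add.commute)
      (simp add: power3_eq_cube)
  also have "\<dots> = (\<bar>c\<bar> ^ 3) *\<^sub>R (LINT x|lborel. f (c *\<^sub>R x + a))"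
    by simp
  finally show ?thesis
    using c by simp
qed

lemma integral_shift:
  fixes f :: "R3 \<Rightarrow> 'b :: {banach, second_countable_topology}"
  assumes "f \<in> borel_measurable borel"
  shows "(LINT x|lborel. f (x + a)) = (LINT x|lborel. f x)"
  using integral_affine[OF assms, of 1 a] by simp

lemma integral_reflect_shift:
  fixes f :: "R3 \<Rightarrow> 'b :: {banach, second_countable_topology}"
  assumes "f \<in> borel_measurable borel"
  shows "(LINT y|lborel. f (x - y)) = (LINT x|lborel. f x)"
  using integral_affine[OF assms, of "-1" x] by simp

section \<open>The Fourier transform exchanges decay and smoothness\<close>

abbreviation echar :: "real \<Rightarrow> complex" where
  "echar t \<equiv> exp (- (\<i> * complex_of_real t))"

lemma cmod_exp_i [simp]:
  "cmod (echar t) = 1" "cmod (exp (\<i> * complex_of_real t)) = 1"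
  by (simp_all add: norm_exp_eq_Re)

lemma integrable_exp_mult [intro]:
  fixes f :: func
  assumes f: "integrable lborel f"
  shows "integrable lborel (\<lambda>x. echar (x \<bullet> \<xi>) * f x)"
proof (rule Bochner_Integration.integrable_bound[OF f])
  have [measurable]: "f \<in> borel_measurable borel" using f by auto
  show "(\<lambda>x. echar (x \<bullet> \<xi>) * f x) \<in> borel_measurable lborel"
    by measurable
qed (simp add: norm_mult)

lemma cmod_fourier_le:
  assumes "integrable lborel f" shows "cmod (fourier f \<xi>) \<le> (LINT x|lborel. cmod (f x))"
proof -
  have "cmod (fourier f \<xi>) \<le> (LINT x|lborel. cmod (echar (x \<bullet> \<xi>) * f x))"
    unfolding fourier_def by (rule integral_norm_bound)
  then show ?thesis by (simp add: norm_mult)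
qed

lemma fourier_add: "integrable lborel f \<Longrightarrow> integrable lborel g \<Longrightarrow>
  fourier (\<lambda>x. f x + g x) = (\<lambda>\<xi>. fourier f \<xi> + fourier g \<xi>)"
  by (simp add: fourier_def fun_eq_iff distrib_left integral_add integrable_exp_mult)

lemma fourier_modulate:
  "fourier (\<lambda>x. echar (x \<bullet> \<zeta>) * f x) \<xi> = fourier f (\<xi> + \<zeta>)"
proof -
  have "echar (x \<bullet> \<xi>) * echar (x \<bullet> \<zeta>) = echar (x \<bullet> (\<xi> + \<zeta>))" for x
    by (simp add: exp_add[symmetric] inner_add_right distrib_left)
  then show ?thesis
    by (simp add: fourier_def mult.assoc[symmetric])
qed

lemma fourier_diff: "integrable lborel f \<Longrightarrow> integrable lborel g \<Longrightarrow>
  fourier (\<lambda>x. f x - g x) = (\<lambda>\<xi>. fourier f \<xi> - fourier g \<xi>)"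
  by (simp add: fourier_def fun_eq_iff right_diff_distrib integral_diff integrable_exp_mult)

lemma fourier_cmult: "fourier (\<lambda>x. c * f x) = (\<lambda>\<xi>. c * fourier f \<xi>)"
  by (simp add: fourier_def fun_eq_iff mult.left_commute)

lemma cmod_exp_taylor: "cmod (echar t - 1 + \<i> * of_real t) \<le> t\<^sup>2"
proof -
  have "cmod (exp (\<i> * of_real (- t)) - (\<Sum>k\<le>1. (\<i> * of_real (- t)) ^ k / fact k)) \<le> \<bar>- t\<bar> ^ Suc 1 / fact (Suc 1)"
    using iexp_approx1[of "- t" 1] by simp
  moreover have "exp (\<i> * of_real (- t)) - (\<Sum>k\<le>1. (\<i> * of_real (- t)) ^ k / fact k) = echar t - 1 + \<i> * of_real t"
    by simp
  ultimately have "cmod (echar t - 1 + \<i> * of_real t) \<le> \<bar>- t\<bar> ^ Suc 1 / fact (Suc 1)"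
    by (simp only:)
  also have "\<dots> = t\<^sup>2 / 2"
    by (simp add: power2_eq_square)
  finally have "cmod (echar t - 1 + \<i> * of_real t) \<le> t\<^sup>2 / 2" .
  then show ?thesis
    using zero_le_power2[of t] by linarith
qed

text \<open>A shift of the frequency by h is a modulation of \<open>f\<close>, so the whole
  first-order remainder is the transform of (e^{-ix.h} - 1 + i x.h) f(x). Its size is at most |h|^2
  times the second absolute moment of \<open>f\<close>, a quantitative bound that replaces
  differentiation under the integral.\<close>

lemma fourier_has_derivative:
  assumes f: "f \<in> schwartz"
  shows "(fourier f has_derivative (\<lambda>h. fourier (\<lambda>x. - \<i> * (of_real (x \<bullet> h) * f x)) \<xi>)) (at \<xi>)"
proof -
  let ?g = "\<lambda>h x. - \<i> * (of_real (x \<bullet> h) * f x)"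
  define B where "B = (LINT x|lborel. (norm x)\<^sup>2 * cmod (f x))"
  have i2: "integrable lborel (\<lambda>x. (norm x)\<^sup>2 * cmod (f x))"
  proof -
    have "rapid (\<lambda>x. of_real ((norm x)\<^sup>2) * f x)"
      by (rule rapid_mult_le[OF schwartz_rapid[OF f], of _ 1 2])
         (auto simp: norm_mult norm_power intro!: mult_right_mono power_mono)
    then have "integrable lborel (\<lambda>x. of_real ((norm x)\<^sup>2) * f x)"
      by (rule rapid_integrable) (use schwartz_measurable[OF f] in measurable)
    from integrable_norm[OF this] show ?thesis by (simp add: norm_mult norm_power)
  qed
  have g: "integrable lborel (?g h)" for h
    by (intro integrable_mult_right schwartz_integrable real_polynomial_mult_schwartz f
        real_polynomial_function.intros(1) bounded_linear_inner_left)
  have lin: "linear (\<lambda>h. fourier (?g h) \<xi>)"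
  proof (rule linearI)
    fix a b :: R3 and c :: real
    have "?g (a + b) = (\<lambda>x. ?g a x + ?g b x)"
      by (simp add: fun_eq_iff inner_add_right algebra_simps)
    then show "fourier (?g (a + b)) \<xi> = fourier (?g a) \<xi> + fourier (?g b) \<xi>"
      by (simp only: fourier_add[OF g g])
    have "?g (c *\<^sub>R a) = (\<lambda>x. of_real c * ?g a x)"
      by (simp add: fun_eq_iff)
    then show "fourier (?g (c *\<^sub>R a)) \<xi> = c *\<^sub>R fourier (?g a) \<xi>"
      by (simp only: fourier_cmult scaleR_conv_of_real)
  qed
  have bound: "cmod (fourier f \<eta> - fourier f \<xi> - fourier (?g (\<eta> - \<xi>)) \<xi>) \<le> B * (norm (\<eta> - \<xi>))\<^sup>2" for \<eta>
  proof -
    define h where "h = \<eta> - \<xi>"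
    let ?m = "\<lambda>x. echar (x \<bullet> h) * f x" and ?e = "\<lambda>x. (echar (x \<bullet> h) - 1 + \<i> * of_real (x \<bullet> h)) * f x"
    note i = integrable_exp_mult[OF schwartz_integrable[OF f], of h] schwartz_integrable[OF f]
    have e: "?e = (\<lambda>x. ?m x - f x - ?g h x)"
      by (simp add: fun_eq_iff algebra_simps)
    have ie: "integrable lborel ?e"
      unfolding e by (intro Bochner_Integration.integrable_diff i g)
    have "fourier f \<eta> = fourier ?m \<xi>"
      by (simp add: fourier_modulate h_def)
    then have "cmod (fourier f \<eta> - fourier f \<xi> - fourier (?g h) \<xi>) = cmod (fourier ?e \<xi>)"
      unfolding e fourier_diff[OF Bochner_Integration.integrable_diff[OF i] g] fourier_diff[OF i] by (simp only:)
    also have "\<dots> \<le> (LINT x|lborel. cmod (?e x))"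
      by (rule cmod_fourier_le[OF ie])
    also have "\<dots> \<le> (LINT x|lborel. (norm h)\<^sup>2 * ((norm x)\<^sup>2 * cmod (f x)))"
    proof (rule integral_mono[OF integrable_norm[OF ie] integrable_mult_right[OF i2]])
      fix x
      have "cmod (echar (x \<bullet> h) - 1 + \<i> * of_real (x \<bullet> h)) \<le> (x \<bullet> h)\<^sup>2"
        by (rule cmod_exp_taylor)
      also have "\<dots> \<le> (norm x * norm h)\<^sup>2"
        using power_mono[OF Cauchy_Schwarz_ineq2[of x h] abs_ge_zero, of 2] by simp
      finally have "cmod (?e x) \<le> (norm x * norm h)\<^sup>2 * cmod (f x)"
        unfolding norm_mult by (rule mult_right_mono) simp
      then show "cmod (?e x) \<le> (norm h)\<^sup>2 * ((norm x)\<^sup>2 * cmod (f x))"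
        by (simp only: power_mult_distrib mult_ac)
    qed
    also have "\<dots> = B * (norm h)\<^sup>2"
      by (simp add: B_def)
    finally show ?thesis unfolding h_def .
  qed
  have H: "((\<lambda>\<eta>. B * norm (\<eta> - \<xi>)) \<longlongrightarrow> 0) (at \<xi>)"
    by (rule tendsto_eq_intros | simp)+
  show ?thesis
  proof (rule has_derivativeI_sandwich[OF zero_less_one _ _ H])
    show "bounded_linear (\<lambda>h. fourier (?g h) \<xi>)"
      using lin by (simp only: linear_conv_bounded_linear)
    fix \<eta> assume "\<eta> \<noteq> \<xi>"
    then show "cmod (fourier f \<eta> - fourier f \<xi> - fourier (?g (\<eta> - \<xi>)) \<xi>) / norm (\<eta> - \<xi>) \<le> B * norm (\<eta> - \<xi>)"
      using bound[of \<eta>] by (simp add: divide_le_eq power2_eq_square mult.assoc)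
  qed
qed

lemma fourier_differentiable: "f \<in> schwartz \<Longrightarrow> fourier f differentiable_on UNIV"
  using fourier_has_derivative by (meson differentiableI differentiable_at_imp_differentiable_on)

lemma partial_fourier:
  assumes "f \<in> schwartz" shows "partial i (fourier f) = fourier (\<lambda>x. - \<i> * (of_real (x $ i) * f x))"
  using partial_eqI[OF fourier_has_derivative[OF assms], of i] by (simp add: fun_eq_iff inner_axis)

lemma fourier_shift:
  assumes [measurable]: "f \<in> borel_measurable borel"
  shows "fourier (\<lambda>x. f (x + a)) \<xi> = exp (\<i> * of_real (a \<bullet> \<xi>)) * fourier f \<xi>"
proof -
  have "fourier (\<lambda>x. f (x + a)) \<xi> = (LINT x|lborel. (\<lambda>y. exp (\<i> * of_real (a \<bullet> \<xi>)) * (echar (y \<bullet> \<xi>) * f y)) (x + a))"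
    unfolding fourier_def
    by (intro Bochner_Integration.integral_cong refl) (simp add: mult.assoc[symmetric] exp_add[symmetric] inner_add_left algebra_simps)
  also have "\<dots> = (LINT y|lborel. exp (\<i> * of_real (a \<bullet> \<xi>)) * (echar (y \<bullet> \<xi>) * f y))"
    by (rule integral_shift) measurable
  finally show ?thesis by (simp add: fourier_def)
qed

lemma norm_axis_R3: "norm (axis i t :: R3) = \<bar>t\<bar>"
  by (simp add: norm_eq_sqrt_inner inner_axis_axis)

text \<open>Mean value inequality along a segment of length at most 1. The result is the integrable
  majorant needed in \<open>fourier_partial\<close>.\<close>

lemma schwartz_difference_quotient:
  assumes f: "f \<in> schwartz"
  obtains C where "\<And>x h. h \<in> {0..1} \<Longrightarrow> cmod (f (x + h *\<^sub>R axis i 1) - f x) \<le> h * (C * weight x)"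
proof -
  let ?f = "\<lambda>x t. f (x + t *\<^sub>R axis i 1)"
  obtain C where C: "C > 0" "\<And>x. (1 + norm x) ^ 6 * cmod (partial i f x) \<le> C"
    using rapidD[OF schwartz_rapid[OF schwartz_partial[OF f]]] by metis
  have der: "(?f x has_derivative (\<lambda>s. s *\<^sub>R partial i f (x + t *\<^sub>R axis i 1))) (at t within {0..1})" for x t
  proof -
    have 1: "((\<lambda>t. x + t *\<^sub>R axis i 1) has_derivative (\<lambda>s. s *\<^sub>R axis i 1)) (at t within {0..1})"
      by (auto intro!: derivative_eq_intros)
    have "(?f x has_derivative (\<lambda>s. frechet_derivative f (at (x + t *\<^sub>R axis i 1)) (s *\<^sub>R axis i 1))) (at t within {0..1})"
      by (rule has_derivative_compose[OF 1 has_derivative_frechet[OF schwartz_differentiable[OF f]]])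
    moreover have "frechet_derivative f (at y) (s *\<^sub>R axis i 1) = s *\<^sub>R partial i f y" for y s
      unfolding partial_def
      using linear_scale[OF has_derivative_linear[OF has_derivative_frechet[OF schwartz_differentiable[OF f]]]] .
    ultimately show ?thesis by simp
  qed
  show thesis
  proof (rule that)
    fix x :: R3 and h :: real assume h: "h \<in> {0..1}"
    have "cmod (?f x h - ?f x 0) \<le> (C * (1 + 1) ^ 6 * weight x) * norm (h - 0)"
    proof (rule differentiable_bound[OF _ der])
      fix t :: real assume "t \<in> {0..1}"
      then have "cmod (partial i f (x + t *\<^sub>R axis i 1)) \<le> C * (1 + 1) ^ 6 * weight x"
        by (intro le_weight_shift[OF C(2)]) (auto simp: norm_axis_R3)
      then show "onorm (\<lambda>s. s *\<^sub>R partial i f (x + t *\<^sub>R axis i 1)) \<le> C * (1 + 1) ^ 6 * weight x"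
        by (simp add: onorm_scaleR_left[OF bounded_linear_ident] onorm_id)
    qed (use h in auto)
    then show "cmod (f (x + h *\<^sub>R axis i 1) - f x) \<le> h * (C * (1 + 1) ^ 6 * weight x)"
      using h by (simp add: mult.commute)
  qed
qed

text \<open>Instead of integrating by parts, difference quotients are passed to the limit under the
  integral: the transform of a translate is a character times the transform, and the difference
  quotient of the character tends to i \<xi>_i.\<close>

lemma fourier_partial:
  assumes f: "f \<in> schwartz" shows "fourier (partial i f) \<xi> = \<i> * of_real (\<xi> $ i) * fourier f \<xi>"
proof -
  obtain C where C: "\<And>x h. h \<in> {0..1} \<Longrightarrow> cmod (f (x + h *\<^sub>R axis i 1) - f x) \<le> h * (C * weight x)"
    using schwartz_difference_quotient[OF f] by blast
  define h where "h n = inverse (real (Suc n))" for n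
  have h: "h \<longlonglongrightarrow> 0" "h n \<in> {0..1}" "h n > 0" for n
    unfolding h_def by (rule LIMSEQ_inverse_real_of_nat) (auto simp: field_simps)
  define q where "q n x = (f (x + h n *\<^sub>R axis i 1) - f x) / of_real (h n)" for n x
  have [measurable]: "f \<in> borel_measurable borel" "partial i f \<in> borel_measurable borel"
    by (intro schwartz_measurable schwartz_partial f)+
  have lim: "(\<lambda>n. q n x) \<longlonglongrightarrow> partial i f x" for x
  proof -
    have "((\<lambda>v. norm (f (x + v) - f x - frechet_derivative f (at x) v) / norm v) \<longlongrightarrow> 0) (at 0)"
      using has_derivative_frechet[OF schwartz_differentiable[OF f], of x] unfolding has_derivative_at by simp
    moreover have "filterlim (\<lambda>n. h n *\<^sub>R axis i 1 :: R3) (at 0) sequentially"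
    proof (rule filterlim_atI)
      show "(\<lambda>n. h n *\<^sub>R axis i 1 :: R3) \<longlonglongrightarrow> 0"
        using tendsto_scaleR[OF h(1) tendsto_const, of "axis i 1 :: R3"] by simp
      show "\<forall>\<^sub>F n in sequentially. h n *\<^sub>R axis i 1 \<noteq> (0::R3)"
        using h(3) by (auto simp: axis_eq_0_iff less_imp_neq[THEN not_sym])
    qed
    ultimately have "(\<lambda>n. norm (f (x + h n *\<^sub>R axis i 1) - f x - frechet_derivative f (at x) (h n *\<^sub>R axis i 1)) / norm (h n *\<^sub>R axis i 1 :: R3)) \<longlonglongrightarrow> 0"
      by (rule filterlim_compose)
    moreover have "norm (f (x + h n *\<^sub>R axis i 1) - f x - frechet_derivative f (at x) (h n *\<^sub>R axis i 1)) / norm (h n *\<^sub>R axis i 1 :: R3)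
       = norm (q n x - partial i f x)" for n
    proof -
      have "frechet_derivative f (at x) (h n *\<^sub>R axis i 1) = of_real (h n) * partial i f x"
        unfolding partial_def
        using linear_scale[OF has_derivative_linear[OF has_derivative_frechet[OF schwartz_differentiable[OF f]]]]
        by (simp add: scaleR_conv_of_real)
      moreover have "q n x - partial i f x = (f (x + h n *\<^sub>R axis i 1) - f x - of_real (h n) * partial i f x) / of_real (h n)"
        using h(3)[of n] by (simp add: q_def field_simps)
      ultimately show ?thesis using h(3)[of n] by (simp add: norm_divide norm_axis_R3)
    qed
    ultimately show ?thesis
      by (simp add: tendsto_norm_zero_iff LIM_zero_iff)
  qed
  have "(\<lambda>n. fourier (q n) \<xi>) \<longlonglongrightarrow> fourier (partial i f) \<xi>"
    unfolding fourier_def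
  proof (rule integral_dominated_convergence)
    show "integrable lborel (\<lambda>x. C * weight x)"
      by (intro integrable_mult_right integrable_weight)
    show "AE x in lborel. (\<lambda>n. echar (x \<bullet> \<xi>) * q n x) \<longlonglongrightarrow> echar (x \<bullet> \<xi>) * partial i f x"
      by (intro AE_I2 tendsto_mult tendsto_const lim)
    show "AE x in lborel. cmod (echar (x \<bullet> \<xi>) * q n x) \<le> C * weight x" for n
      using C[OF h(2)[of n]] h(3)[of n] by (auto simp: q_def norm_mult norm_divide pos_divide_le_eq mult.commute)
  qed (auto simp: q_def)
  moreover have "fourier (q n) \<xi> = (exp (\<i> * of_real (h n * \<xi> $ i)) - 1) / of_real (h n) * fourier f \<xi>" for n
  proof -
    have "fourier (\<lambda>x. f (x + h n *\<^sub>R axis i 1) - f x) \<xi> = exp (\<i> * of_real (h n * \<xi> $ i)) * fourier f \<xi> - fourier f \<xi>"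
      by (subst fourier_diff) (simp_all add: fourier_shift inner_axis' schwartz_integrable schwartz_shift f)
    moreover have "fourier (q n) \<xi> = inverse (of_real (h n)) * fourier (\<lambda>x. f (x + h n *\<^sub>R axis i 1) - f x) \<xi>"
      unfolding fourier_cmult[symmetric, THEN fun_cong] by (simp add: q_def[abs_def] field_simps)
    ultimately show ?thesis by (simp add: field_simps)
  qed
  moreover have "(\<lambda>n. (exp (\<i> * of_real (h n * \<xi> $ i)) - 1) / of_real (h n) * fourier f \<xi>) \<longlonglongrightarrow> \<i> * of_real (\<xi> $ i) * fourier f \<xi>"
  proof (rule tendsto_mult[OF _ tendsto_const])
    have d: "((\<lambda>t. exp (\<i> * of_real (\<xi> $ i) * t)) has_field_derivative \<i> * of_real (\<xi> $ i)) (at 0)"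
      by (auto intro!: derivative_eq_intros)
    have "filterlim (\<lambda>n. complex_of_real (h n)) (at 0) sequentially"
    proof (rule filterlim_atI)
      show "(\<lambda>n. complex_of_real (h n)) \<longlonglongrightarrow> 0"
        using tendsto_of_real[OF h(1)] by simp
      show "\<forall>\<^sub>F n in sequentially. complex_of_real (h n) \<noteq> 0"
        using h(3) by (auto simp: less_imp_neq[THEN not_sym])
    qed
    from filterlim_compose[OF d[unfolded DERIV_def] this]
    show "(\<lambda>n. (exp (\<i> * of_real (h n * \<xi> $ i)) - 1) / of_real (h n)) \<longlonglongrightarrow> \<i> * of_real (\<xi> $ i)"
      by (simp add: mult_ac)
  qed
  ultimately show ?thesis
    using LIMSEQ_unique by (simp only:)
qed

text \<open>Each further factor 1 + |\<xi>| is bounded by 1 plus the sum of the |\<xi>_i|, and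
  |\<xi>_i| is traded for a partial derivative of \<open>f\<close>; hence the induction generalises
  over \<open>f\<close>.\<close>

lemma fourier_rapid:
  assumes "f \<in> schwartz" shows "rapid (fourier f)"
  unfolding rapid_def
proof
  fix k :: nat
  show "\<exists>C. \<forall>\<xi>. (1 + norm \<xi>) ^ k * cmod (fourier f \<xi>) \<le> C"
    using assms
  proof (induction k arbitrary: f)
    case 0
    then show ?case
      using cmod_fourier_le[OF schwartz_integrable] by auto
  next
    case (Suc k)
    obtain C where C: "\<And>\<xi>. (1 + norm \<xi>) ^ k * cmod (fourier f \<xi>) \<le> C"
      using Suc by blast
    have "\<forall>i. \<exists>D. \<forall>\<xi>. (1 + norm \<xi>) ^ k * cmod (fourier (partial i f) \<xi>) \<le> D"
      using Suc schwartz_partial by blast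
    then obtain D where D: "\<And>i \<xi>. (1 + norm \<xi>) ^ k * cmod (fourier (partial i f) \<xi>) \<le> D i"
      by metis
    have "(1 + norm \<xi>) ^ Suc k * cmod (fourier f \<xi>) \<le> C + (\<Sum>i\<in>UNIV. D i)" for \<xi>
    proof -
      have "(1 + norm \<xi>) ^ Suc k * cmod (fourier f \<xi>) = (1 + norm \<xi>) * ((1 + norm \<xi>) ^ k * cmod (fourier f \<xi>))"
        by simp
      also have "\<dots> \<le> (1 + (\<Sum>i\<in>UNIV. \<bar>\<xi> $ i\<bar>)) * ((1 + norm \<xi>) ^ k * cmod (fourier f \<xi>))"
        by (intro mult_right_mono add_left_mono norm_le_l1_cart) auto
      also have "\<dots> = (1 + norm \<xi>) ^ k * cmod (fourier f \<xi>) + (\<Sum>i\<in>UNIV. (1 + norm \<xi>) ^ k * (\<bar>\<xi> $ i\<bar> * cmod (fourier f \<xi>)))"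
        by (simp add: algebra_simps sum_distrib_left sum_distrib_right)
      also have "(\<Sum>i\<in>UNIV. (1 + norm \<xi>) ^ k * (\<bar>\<xi> $ i\<bar> * cmod (fourier f \<xi>))) = (\<Sum>i\<in>UNIV. (1 + norm \<xi>) ^ k * cmod (fourier (partial i f) \<xi>))"
        by (simp add: fourier_partial[OF Suc.prems] norm_mult)
      also have "(1 + norm \<xi>) ^ k * cmod (fourier f \<xi>) + \<dots> \<le> C + (\<Sum>i\<in>UNIV. D i)"
        by (intro add_mono sum_mono C D)
      finally show ?thesis .
    qed
    then show ?case by blast
  qed
qed

lemma fourier_schwartz:
  assumes "f \<in> schwartz" shows "fourier f \<in> schwartz"
proof (rule schwartz_coinduct[where A = "fourier ` schwartz"])
  fix g i assume "g \<in> fourier ` schwartz"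
  then obtain f where g: "g = fourier f" and f: "f \<in> schwartz" by blast
  show "g differentiable_on UNIV" "rapid g"
    unfolding g using f by (rule fourier_differentiable fourier_rapid)+
  show "partial i g \<in> fourier ` schwartz"
    unfolding g partial_fourier[OF f] by (intro imageI schwartz_cmult schwartz_coord f)
qed (use assms in blast)

lemma inv_fourier_eq: "inv_fourier f = (\<lambda>x. of_real (1 / (2 * pi) ^ 3) * fourier f (- x))"
  by (simp add: inv_fourier_def fourier_def fun_eq_iff inner_commute)

lemma inv_fourier_schwartz: "f \<in> schwartz \<Longrightarrow> inv_fourier f \<in> schwartz"
  unfolding inv_fourier_eq by (intro schwartz_cmult schwartz_reflect fourier_schwartz)

section \<open>Low-pass multipliers and approximation by Schwartz functions\<close>

locale lp_cutoff =
  fixes \<phi>0 :: "real \<Rightarrow> complex"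
  assumes cutoff: "cutoff \<phi>0"
begin

text \<open>The symbol of S_j. It also serves as the bump function of the whole development, being 1
  for |\<xi>| <= 2^{j-1} and 0 for |\<xi>| > 2^j: for spatial truncation, for Fourier inversion and
  for localisation on a cover.\<close>

definition low_pass :: "int \<Rightarrow> func" where
  "low_pass j \<xi> = \<phi>0 (4 powi (- j) * (norm \<xi>)\<^sup>2)"

lemma four_powi: "(4::real) powi j = (2 powi j)\<^sup>2"
  using power_int_mult_distrib[of 2 "2::real" j] by (simp add: power2_eq_square)

lemma low_pass_scale: "low_pass j \<xi> = low_pass 0 ((2 powi (- j)) *\<^sub>R \<xi>)"
  by (simp add: low_pass_def four_powi power_mult_distrib)

lemma low_pass_eq_1: assumes "norm \<xi> \<le> 2 powi (j - 1)" shows "low_pass j \<xi> = 1"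
proof -
  have "2 powi (- j) * norm \<xi> \<le> 2 powi (- j) * 2 powi (j - 1)"
    using assms by (intro mult_left_mono) auto
  also have "\<dots> = 1/2"
    by (subst power_int_add[symmetric]) auto
  finally have "(2 powi (- j) * norm \<xi>)\<^sup>2 \<le> (1/2)\<^sup>2"
    by (intro power_mono) auto
  then show ?thesis
    unfolding low_pass_def four_powi
    by (intro cutoff_eq_1[OF cutoff]) (auto simp: power_mult_distrib power_divide)
qed

lemma low_pass_eq_0: assumes "norm \<xi> > 2 powi j" shows "low_pass j \<xi> = 0"
proof -
  have "1 = 2 powi (- j) * (2::real) powi j"
    by (subst power_int_add[symmetric]) auto
  also have "\<dots> < 2 powi (- j) * norm \<xi>"
    using assms by (intro mult_strict_left_mono) auto
  finally have "1 < (2 powi (- j) * norm \<xi>)\<^sup>2"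
    by (simp add: one_less_power)
  then show ?thesis
    unfolding low_pass_def four_powi
    by (intro cutoff_eq_0[OF cutoff]) (auto simp: power_mult_distrib)
qed

lemma low_pass_schwartz: "low_pass j \<in> schwartz"
proof -
  have "low_pass 0 \<in> schwartz"
    using radial_schwartz[OF cutoff] by (simp add: low_pass_def[abs_def])
  then have "(\<lambda>\<xi>. low_pass 0 ((2 powi (- j)) *\<^sub>R \<xi>)) \<in> schwartz"
    by (rule schwartz_scale) simp
  then show ?thesis
    by (simp only: low_pass_scale[symmetric])
qed

lemma low_pass_bounded: "cmod (low_pass j \<xi>) \<le> schwartz_seminorm 0 [] (low_pass 0)"
  by (subst low_pass_scale) (rule schwartz_le_seminorm[OF low_pass_schwartz])

lemma two_powi_ge:
  fixes r :: real
  obtains n :: nat where "r \<le> 2 powi (int n - 1)"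
proof -
  obtain n where "r < 2 ^ n"
    using real_arch_pow[of 2 r] by auto
  then have "r \<le> 2 powi (int (Suc n) - 1)"
    by simp
  then show thesis by (rule that)
qed

end

lemma polynomial_mult_schwartz:
  fixes p :: func
  assumes p: "polynomial_function p" and f: "f \<in> schwartz"
  shows "(\<lambda>x. p x * f x) \<in> schwartz"
proof -
  have "real_polynomial_function (\<lambda>x. Re (p x))" "real_polynomial_function (\<lambda>x. Im (p x))"
    using p bounded_linear_Re bounded_linear_Im unfolding polynomial_function_def o_def by auto
  from this[THEN real_polynomial_mult_schwartz, OF f]
  have "(\<lambda>x. complex_of_real (Re (p x)) * f x + \<i> * (complex_of_real (Im (p x)) * f x)) \<in> schwartz"
    by (intro schwartz_add_fun schwartz_cmult)
  moreover have "complex_of_real (Re (p x)) * f x + \<i> * (complex_of_real (Im (p x)) * f x) = p x * f x" for x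
    by (subst (3) complex_eq[of "p x"]) (simp add: algebra_simps)
  ultimately show ?thesis by simp
qed

text \<open>The set where \<open>f\<close> is nonzero is open, and a nonempty open set is not
  negligible.\<close>

lemma continuous_AE_zero:
  fixes f :: "'a::euclidean_space \<Rightarrow> complex"
  assumes c: "continuous_on UNIV f" and ae: "AE x in lborel. f x = 0"
  shows "f x = 0"
proof -
  have op: "open {x. f x \<noteq> 0}"
    using continuous_open_preimage[OF c open_UNIV, of "- {0}"] by (simp add: vimage_def Collect_neg_eq open_Compl)
  moreover have "negligible {x. f x \<noteq> 0}"
  proof -
    have "{x \<in> space lborel. \<not> f x = 0} \<in> sets lborel"
      using op by simp
    from AE_iff_null[OF this] ae have "{x. f x \<noteq> 0} \<in> null_sets lborel"
      by simp
    then show ?thesis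
      by (simp add: negligible_iff_null_sets null_sets_completionI)
  qed
  ultimately have "{x. f x \<noteq> 0} = {}"
    using open_not_negligible by blast
  then show ?thesis by blast
qed

text \<open>A measurable function is an almost everywhere limit of continuous ones; these are
  replaced by polynomials on a ball (Weierstrass) and cut off by \<open>low_pass\<close>. The common
  majorant makes dominated convergence available, so no mollifiers are needed.\<close>

lemma (in lp_cutoff) schwartz_AE_approximation:
  assumes h: "h \<in> borel_measurable borel" and b: "\<And>x. cmod (h x) \<le> 1" and s: "\<And>x. norm x > r \<Longrightarrow> h x = 0"
  obtains \<phi> B R where "\<And>n::nat. \<phi> n \<in> schwartz" "AE x in lborel. (\<lambda>n. \<phi> n x) \<longlonglongrightarrow> h x"
    "\<And>n x. cmod (\<phi> n x) \<le> B * indicator (cball 0 R) x" "B > 0"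
proof -
  obtain j :: nat where j: "r \<le> 2 powi (int j - 1)"
    using two_powi_ge by blast
  define R where "R = (2::real) powi (int j)"
  define M where "M = 1 + schwartz_seminorm 0 [] (low_pass 0)"
  have M: "M > 0" "\<And>j \<xi>. cmod (low_pass j \<xi>) \<le> M"
    using schwartz_seminorm_nonneg[OF low_pass_schwartz] low_pass_bounded
    by (auto simp: M_def intro: add_pos_nonneg add_increasing)
  have "h \<in> borel_measurable lebesgue"
    using h by (simp add: measurable_completion)
  then have "h measurable_on UNIV"
    by (subst measurable_on_iff_borel_measurable) auto
  then obtain N g where N: "negligible N" and g: "\<And>n::nat. continuous_on UNIV (g n)"
    and lim: "\<And>x. x \<notin> N \<Longrightarrow> (\<lambda>n. g n x) \<longlonglongrightarrow> h x"
    unfolding measurable_on_def by auto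
  \<comment> \<open>Radial retraction onto the unit disc. It is continuous and fixes
    \<open>h x\<close>, so the limit is unchanged while the approximants become uniformly
    bounded.\<close>
  define t where "t n x = g n x / of_real (max 1 (cmod (g n x)))" for n x
  have tc: "continuous_on UNIV (t n)" for n
    unfolding t_def by (intro continuous_intros g) (auto simp: max_def)
  have tb: "cmod (t n x) \<le> 1" for n x
    by (auto simp: t_def norm_divide max_def divide_le_eq)
  have tlim: "(\<lambda>n. t n x) \<longlonglongrightarrow> h x" if "x \<notin> N" for x
  proof -
    have "(\<lambda>n. t n x) \<longlonglongrightarrow> h x / of_real (max 1 (cmod (h x)))"
      unfolding t_def by (intro tendsto_intros lim that) (auto simp: max_def)
    then show ?thesis using b[of x] by (simp add: max_absorb1)
  qed
  have "\<exists>p. polynomial_function p \<and> (\<forall>x\<in>cball 0 R. cmod (t n x - p x) < inverse (real (Suc n)))" for n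
    by (rule Stone_Weierstrass_polynomial_function) (auto intro: continuous_on_subset[OF tc])
  then obtain p where p: "\<And>n. polynomial_function (p n)"
    and pt: "\<And>n x. x \<in> cball 0 R \<Longrightarrow> cmod (t n x - p n x) < inverse (real (Suc n))"
    by metis
  define \<phi> where "\<phi> n x = p n x * low_pass j x" for n x
  show thesis
  \<comment> \<open>The polynomials are within 1 of functions bounded by 1 on the ball of radius
    \<open>R\<close>, hence bounded by 2 there; \<open>M\<close> bounds the cutoff, which vanishes
    outside that ball.\<close>
  proof (rule that[of \<phi> "2 * M" R])
    show "\<phi> n \<in> schwartz" for n
      unfolding \<phi>_def[abs_def] by (intro polynomial_mult_schwartz p low_pass_schwartz)
    show "cmod (\<phi> n x) \<le> 2 * M * indicator (cball 0 R) x" for n x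
    proof (cases "x \<in> cball 0 R")
      case True
      have "inverse (real (Suc n)) \<le> 1" by (simp add: field_simps)
      moreover have "cmod (p n x) \<le> cmod (t n x) + cmod (t n x - p n x)"
        using norm_triangle_ineq4[of "t n x" "t n x - p n x"] by simp
      ultimately have "cmod (p n x) \<le> 2" using pt[OF True, of n] tb[of n x] by linarith
      then have "cmod (p n x) * cmod (low_pass j x) \<le> 2 * M"
        using M by (intro mult_mono) auto
      then show ?thesis using True by (simp add: \<phi>_def norm_mult)
    next
      case False
      then have "low_pass j x = 0"
        by (intro low_pass_eq_0) (simp add: R_def dist_norm)
      then show ?thesis using M(1) by (simp add: \<phi>_def indicator_def)
    qed
    have *: "(\<lambda>n. \<phi> n x) \<longlonglongrightarrow> h x" if "x \<notin> N" for x
    proof (cases "x \<in> cball 0 R")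
      case True
      have "(\<lambda>n. t n x - p n x) \<longlonglongrightarrow> 0"
        by (rule Lim_null_comparison[OF _ LIMSEQ_inverse_real_of_nat])
           (use pt[OF True] in \<open>auto intro!: always_eventually less_imp_le\<close>)
      then have "(\<lambda>n. t n x - (t n x - p n x)) \<longlonglongrightarrow> h x - 0"
        by (intro tendsto_diff tlim that)
      then have "(\<lambda>n. \<phi> n x) \<longlonglongrightarrow> h x * low_pass j x"
        unfolding \<phi>_def by (intro tendsto_mult tendsto_const) simp
      moreover have "h x * low_pass j x = h x"
        using s[of x] j low_pass_eq_1[of x j] by (cases "norm x \<le> r") auto
      ultimately show ?thesis by simp
    next
      case False
      then have 1: "low_pass j x = 0"
        by (intro low_pass_eq_0) (simp add: R_def dist_norm)
      have "2 powi (int j - 1) \<le> R"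
        unfolding R_def by (intro power_int_increasing) auto
      then have "h x = 0"
        using False j by (intro s) (simp add: dist_norm)
      then show ?thesis by (simp add: \<phi>_def 1)
    qed
    have "AE x in lebesgue. x \<notin> N"
      using N by (simp add: negligible_iff_null_sets AE_not_in)
    then have "AE x in lborel. x \<notin> N"
      by (simp add: AE_completion_iff)
    then show "AE x in lborel. (\<lambda>n. \<phi> n x) \<longlonglongrightarrow> h x"
      using * by (auto elim: AE_mp)
  qed (use M in auto)
qed

text \<open>The ideal test function on a ball is the conjugate sign of \<open>w\<close>, whose
  pairing with \<open>w\<close> is the integral of |w| there. It is reached by dominated limits of
  Schwartz functions.\<close>

lemma (in lp_cutoff) AE_zero_if_orthogonal_schwartz:
  assumes [measurable]: "w \<in> borel_measurable borel"
    and int: "\<And>R. integrable lborel (\<lambda>x. indicator (cball 0 R) x * cmod (w x))"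
    and orth: "\<And>\<phi>. \<phi> \<in> schwartz \<Longrightarrow> (LINT x|lborel. w x * \<phi> x) = 0"
  shows "AE x in lborel. w x = 0"
proof -
  have "AE x in lborel. norm x \<le> real m \<longrightarrow> w x = 0" for m :: nat
  proof -
    define h where "h x = cnj (sgn (w x)) * indicator (cball 0 (real m)) x" for x
    have hm: "h \<in> borel_measurable borel"
    proof -
      have "(\<lambda>x. cnj (w x / of_real (cmod (w x))) * indicator (cball 0 (real m)) x) \<in> borel_measurable borel"
        by (intro borel_measurable_times borel_measurable_indicator borel_closed closed_cball
             measurable_compose[OF _ borel_measurable_continuous_onI[of cnj]] continuous_intros) measurable
      then show ?thesis by (simp add: h_def[abs_def] sgn_eq)
    qed
    have hb: "cmod (h x) \<le> 1" for x
      by (auto simp: h_def norm_mult norm_sgn indicator_def)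
    have hs: "h x = 0" if "norm x > real m" for x
      using that by (simp add: h_def)
    obtain \<phi> B R where \<phi>: "\<And>n::nat. \<phi> n \<in> schwartz" "AE x in lborel. (\<lambda>n. \<phi> n x) \<longlonglongrightarrow> h x"
        and bd: "\<And>n x. cmod (\<phi> n x) \<le> B * indicator (cball 0 R) x" "B > 0"
      by (rule schwartz_AE_approximation[OF hm hb hs]) blast+
    have "(\<lambda>n. LINT x|lborel. w x * \<phi> n x) \<longlonglongrightarrow> (LINT x|lborel. w x * h x)"
    proof (rule integral_dominated_convergence)
      show "integrable lborel (\<lambda>x. B * (indicator (cball 0 R) x * cmod (w x)))"
        by (intro integrable_mult_right int)
      show "AE x in lborel. (\<lambda>n. w x * \<phi> n x) \<longlonglongrightarrow> w x * h x"
        using \<phi>(2) by eventually_elim (intro tendsto_intros)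
      show "AE x in lborel. cmod (w x * \<phi> n x) \<le> B * (indicator (cball 0 R) x * cmod (w x))" for n
        using mult_left_mono[OF bd(1) norm_ge_zero, of "w _"] by (intro AE_I2) (simp add: norm_mult mult_ac)
      show "(\<lambda>x. w x * \<phi> n x) \<in> borel_measurable lborel" for n
        using schwartz_measurable[OF \<phi>(1)] by simp
    qed (use hm in simp)
    then have 0: "(LINT x|lborel. w x * h x) = 0"
      using orth[OF \<phi>(1)] LIMSEQ_unique[OF _ tendsto_const[of 0]] by simp
    have "w x * h x = of_real (indicator (cball 0 (real m)) x * cmod (w x))" for x
      by (auto simp: h_def sgn_eq complex_norm_square[symmetric] power2_eq_square indicator_def)
    then have "(LINT x|lborel. indicator (cball 0 (real m)) x * cmod (w x)) = 0"
      using 0 by (simp only: integral_complex_of_real of_real_eq_0_iff)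
    then have "AE x in lborel. indicator (cball 0 (real m)) x * cmod (w x) = 0"
      by (subst (asm) integral_nonneg_eq_0_iff_AE[OF int]) auto
    then show ?thesis
      by eventually_elim (auto simp: indicator_def split: if_splits)
  qed
  then have "AE x in lborel. \<forall>m::nat. norm x \<le> real m \<longrightarrow> w x = 0"
    by (subst AE_all_countable) blast
  then show ?thesis
    by eventually_elim (meson real_arch_simple)
qed

section \<open>Fourier inversion up to a constant\<close>

text \<open>A uniform L^1 bound on the slices \<open>G x\<close> makes the double integral
  absolutely convergent. The multiplication formula, Young's inequality and the duality
  \<open>conv_test\<close> are all instances.\<close>

lemma Fubini_bounded_kernel:
  fixes a :: "R3 \<Rightarrow> 'b :: {real_normed_field, banach, second_countable_topology}" and G :: "R3 \<Rightarrow> R3 \<Rightarrow> 'b"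
  assumes a: "integrable lborel a"
    and G [measurable]: "(\<lambda>(x, y). G x y) \<in> borel_measurable (lborel \<Otimes>\<^sub>M lborel)"
    and Gi: "\<And>x. integrable lborel (G x)"
    and C: "\<And>x. (LINT y|lborel. norm (G x y)) \<le> C"
  shows "(LINT x|lborel. a x * (LINT y|lborel. G x y)) = (LINT y|lborel. LINT x|lborel. a x * G x y)"
    and "integrable lborel (\<lambda>y. LINT x|lborel. a x * G x y)"
proof -
  have [measurable]: "a \<in> borel_measurable lborel" using a by simp
  have G': "(\<lambda>p. G (fst p) (snd p)) \<in> borel_measurable (lborel \<Otimes>\<^sub>M lborel)"
    using G by (simp add: case_prod_beta')
  have i: "integrable (lborel \<Otimes>\<^sub>M lborel) (\<lambda>(x, y). a x * G x y)"
  proof (rule lborel_pair.Fubini_integrable)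
    show "(\<lambda>(x, y). a x * G x y) \<in> borel_measurable (lborel \<Otimes>\<^sub>M lborel)"
      using G' by (simp add: case_prod_beta')
    have "integrable lborel (\<lambda>x. norm (a x) * (LINT y|lborel. norm (G x y)))"
    proof (rule Bochner_Integration.integrable_bound)
      show "integrable lborel (\<lambda>x. norm (a x) * C)"
        using a by simp
      have "(\<lambda>p. norm (G (fst p) (snd p))) \<in> borel_measurable (lborel \<Otimes>\<^sub>M lborel)"
        using G' by simp
      then have "(\<lambda>x. LINT y|lborel. norm (G x y)) \<in> borel_measurable lborel"
        by (intro lborel.borel_measurable_lebesgue_integral) (simp add: case_prod_beta')
      then show "(\<lambda>x. norm (a x) * (LINT y|lborel. norm (G x y))) \<in> borel_measurable lborel"
        by simp
      have "\<bar>LINT y|lborel. norm (G x y)\<bar> \<le> \<bar>C\<bar>" for x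
        using order_trans[OF C[of x] abs_ge_self] by simp
      then show "AE x in lborel. norm (norm (a x) * (LINT y|lborel. norm (G x y))) \<le> norm (norm (a x) * C)"
        by (auto simp: abs_mult mult_left_mono)
    qed
    then show "integrable lborel (\<lambda>x. LINT y|lborel. norm (case (x, y) of (x, y) \<Rightarrow> a x * G x y))"
      by (simp add: norm_mult)
    show "AE x in lborel. integrable lborel (\<lambda>y. case (x, y) of (x, y) \<Rightarrow> a x * G x y)"
      using Gi by simp
  qed
  show "(LINT x|lborel. a x * (LINT y|lborel. G x y)) = (LINT y|lborel. LINT x|lborel. a x * G x y)"
    using lborel_pair.Fubini_integral[OF i] by simp
  show "integrable lborel (\<lambda>y. LINT x|lborel. a x * G x y)"
    using lborel_pair.integrable_snd[OF i] by simp
qed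

lemma Young_L1:
  fixes k a :: "R3 \<Rightarrow> real"
  assumes k: "integrable lborel k" "\<And>x. k x \<ge> 0" and a: "integrable lborel a"
  shows "(LINT x|lborel. LINT y|lborel. k (x - y) * a y) = (LINT x|lborel. k x) * (LINT x|lborel. a x)"
    and "integrable lborel (\<lambda>x. LINT y|lborel. k (x - y) * a y)"
proof -
  have [measurable]: "k \<in> borel_measurable borel" using k by auto
  have ki: "integrable lborel (\<lambda>x. k (x - y))" "(LINT x|lborel. k (x - y)) = (LINT x|lborel. k x)" for y
    using integrable_affine[OF k(1), of 1 "- y"] integral_shift[of k "- y"] by simp_all
  have m: "(\<lambda>(y, x). k (x - y)) \<in> borel_measurable (lborel \<Otimes>\<^sub>M lborel)" by measurable
  have C: "(LINT x|lborel. norm (k (x - y))) \<le> (LINT x|lborel. k x)" for y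
    using k(2) ki(2) by simp
  note F = Fubini_bounded_kernel[OF a m ki(1) C]
  show "(LINT x|lborel. LINT y|lborel. k (x - y) * a y) = (LINT x|lborel. k x) * (LINT x|lborel. a x)"
    using F(1) by (simp add: ki(2) mult.commute)
  show "integrable lborel (\<lambda>x. LINT y|lborel. k (x - y) * a y)"
    using F(2) by (simp add: mult.commute)
qed

lemma fourier_kernel_measurable [measurable]:
  assumes [measurable]: "g \<in> borel_measurable borel"
  shows "(\<lambda>(x, y). echar (x \<bullet> y) * g y) \<in> borel_measurable (lborel \<Otimes>\<^sub>M lborel)"
  by measurable

lemma fourier_multiplication_formula:
  assumes f: "integrable lborel f" and g: "integrable lborel g"
  shows "(LINT x|lborel. f x * fourier g x) = (LINT x|lborel. fourier f x * g x)"
proof -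
  have [measurable]: "g \<in> borel_measurable borel" using g by auto
  have "(LINT x|lborel. f x * fourier g x) = (LINT x|lborel. f x * (LINT y|lborel. echar (x \<bullet> y) * g y))"
    by (simp add: fourier_def inner_commute)
  also have "\<dots> = (LINT y|lborel. LINT x|lborel. f x * (echar (x \<bullet> y) * g y))"
  proof (rule Fubini_bounded_kernel(1)[OF f])
    show "integrable lborel (\<lambda>y. echar (x \<bullet> y) * g y)" for x
      using integrable_exp_mult[OF g, of x] by (simp add: inner_commute)
    show "(LINT y|lborel. cmod (echar (x \<bullet> y) * g y)) \<le> (LINT y|lborel. cmod (g y))" for x
      by (simp add: norm_mult)
  qed measurable
  also have "\<dots> = (LINT y|lborel. LINT x|lborel. (echar (x \<bullet> y) * f x) * g y)"
    by (simp add: mult_ac)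
  also have "\<dots> = (LINT y|lborel. fourier f y * g y)"
    by (simp add: fourier_def)
  finally show ?thesis .
qed

lemma fourier_scale:
  assumes [measurable]: "g \<in> borel_measurable borel" and c: "c \<noteq> 0"
  shows "fourier (\<lambda>x. g (c *\<^sub>R x)) \<xi> = of_real (1 / \<bar>c\<bar> ^ 3) * fourier g ((1 / c) *\<^sub>R \<xi>)"
proof -
  have "fourier (\<lambda>x. g (c *\<^sub>R x)) \<xi> = (LINT x|lborel. (\<lambda>y. echar (y \<bullet> ((1 / c) *\<^sub>R \<xi>)) * g y) (c *\<^sub>R x + 0))"
    using c by (simp add: fourier_def)
  also have "\<dots> = (1 / \<bar>c\<bar> ^ 3) *\<^sub>R (LINT y|lborel. echar (y \<bullet> ((1 / c) *\<^sub>R \<xi>)) * g y)"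
    by (rule integral_affine[OF _ c]) measurable
  finally show ?thesis by (simp add: fourier_def scaleR_conv_of_real[where 'a=complex])
qed

lemma fourier_reflect: "f \<in> borel_measurable borel \<Longrightarrow> fourier (\<lambda>x. f (- x)) \<xi> = fourier f (- \<xi>)"
  using fourier_scale[of f "-1" \<xi>] by simp

context lp_cutoff
begin

text \<open>The exact value of the constant in Fourier inversion is irrelevant; only its being nonzero
  matters.\<close>

definition \<kappa> :: complex where
  "\<kappa> = of_real (1 / (2 * pi) ^ 3) * (LINT \<xi>|lborel. fourier (low_pass 0) \<xi>)"

lemma low_pass_0: "low_pass j 0 = 1"
  by (rule low_pass_eq_1) simp

text \<open>Test the multiplication formula against \<open>low_pass 0 (\<xi> / n)\<close> and let \<open>n\<close> tend to infinity.\<close>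

lemma integral_fourier:
  assumes f: "f \<in> schwartz"
  shows "(LINT \<xi>|lborel. fourier f \<xi>) = (LINT \<xi>|lborel. fourier (low_pass 0) \<xi>) * f 0"
proof -
  let ?g = "low_pass 0"
  have [measurable]: "f \<in> borel_measurable borel" "?g \<in> borel_measurable borel"
     "fourier f \<in> borel_measurable borel" "fourier ?g \<in> borel_measurable borel"
    by (intro schwartz_measurable fourier_schwartz f low_pass_schwartz)+
  define t where "t n = inverse (real (Suc n))" for n
  have t: "t \<longlonglongrightarrow> 0" "t n > 0" for n
    unfolding t_def by (rule LIMSEQ_inverse_real_of_nat) auto
  have t0: "(\<lambda>n. t n *\<^sub>R x) \<longlonglongrightarrow> 0" for x :: R3
    using tendsto_scaleR[OF t(1) tendsto_const, of x] by simp
  have lim_at_0: "(\<lambda>n. h (t n *\<^sub>R x)) \<longlonglongrightarrow> h 0" if "h \<in> schwartz" for h x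
    using continuous_on_tendsto_compose[OF schwartz_continuous[OF that] t0] by simp
  note M = schwartz_le_seminorm[OF low_pass_schwartz[of 0]] and F = schwartz_le_seminorm[OF f]
  have gs: "(\<lambda>\<xi>. ?g (t n *\<^sub>R \<xi>)) \<in> schwartz" for n
    using t(2)[of n] by (intro schwartz_scale low_pass_schwartz) auto
  \<comment> \<open>The dilation of the bump is moved to the other side by the substitution x = t y.
    As t tends to 0, the bump tends to its value 1 at the origin on the left and \<open>f\<close> to
    \<open>f 0\<close> on the right.\<close>
  have eq: "(LINT \<xi>|lborel. fourier f \<xi> * ?g (t n *\<^sub>R \<xi>)) = (LINT y|lborel. f (t n *\<^sub>R y) * fourier ?g y)" for n
  proof -
    have "(LINT \<xi>|lborel. fourier f \<xi> * ?g (t n *\<^sub>R \<xi>)) = (LINT x|lborel. f x * fourier (\<lambda>\<xi>. ?g (t n *\<^sub>R \<xi>)) x)"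
      by (rule fourier_multiplication_formula[symmetric]) (intro schwartz_integrable f gs)+
    also have "\<dots> = (LINT x|lborel. of_real (1 / t n ^ 3) * (f x * fourier ?g ((1 / t n) *\<^sub>R x)))"
      using t(2)[of n] by (simp add: fourier_scale mult_ac)
    also have "\<dots> = of_real (1 / t n ^ 3) * (LINT x|lborel. f x * fourier ?g ((1 / t n) *\<^sub>R x))"
      by simp
    also have "(LINT y|lborel. (\<lambda>x. f x * fourier ?g ((1 / t n) *\<^sub>R x)) (t n *\<^sub>R y + 0)) = (1 / \<bar>t n\<bar> ^ 3) *\<^sub>R (LINT x|lborel. f x * fourier ?g ((1 / t n) *\<^sub>R x))"
      using t(2)[of n] by (intro integral_affine) auto
    then have "of_real (1 / t n ^ 3) * (LINT x|lborel. f x * fourier ?g ((1 / t n) *\<^sub>R x)) = (LINT y|lborel. f (t n *\<^sub>R y) * fourier ?g y)"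
      using t(2)[of n] by (simp add: scaleR_conv_of_real[where 'a=complex])
    finally show ?thesis .
  qed
  have "(\<lambda>n. LINT \<xi>|lborel. fourier f \<xi> * ?g (t n *\<^sub>R \<xi>)) \<longlonglongrightarrow> (LINT \<xi>|lborel. fourier f \<xi> * ?g 0)"
  proof (rule integral_dominated_convergence)
    show "integrable lborel (\<lambda>\<xi>. cmod (fourier f \<xi>) * schwartz_seminorm 0 [] ?g)"
      by (intro integrable_mult_left integrable_norm schwartz_integrable fourier_schwartz f)
    show "AE \<xi> in lborel. (\<lambda>n. fourier f \<xi> * ?g (t n *\<^sub>R \<xi>)) \<longlonglongrightarrow> fourier f \<xi> * ?g 0"
      by (intro AE_I2 tendsto_intros lim_at_0 low_pass_schwartz)
    show "AE \<xi> in lborel. cmod (fourier f \<xi> * ?g (t n *\<^sub>R \<xi>)) \<le> cmod (fourier f \<xi>) * schwartz_seminorm 0 [] ?g" for n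
      using M by (auto simp: norm_mult mult_left_mono)
  qed measurable
  moreover have "(\<lambda>n. LINT y|lborel. f (t n *\<^sub>R y) * fourier ?g y) \<longlonglongrightarrow> (LINT y|lborel. f 0 * fourier ?g y)"
  proof (rule integral_dominated_convergence)
    show "integrable lborel (\<lambda>\<xi>. schwartz_seminorm 0 [] f * cmod (fourier ?g \<xi>))"
      by (intro integrable_mult_right integrable_norm schwartz_integrable fourier_schwartz low_pass_schwartz)
    show "AE y in lborel. (\<lambda>n. f (t n *\<^sub>R y) * fourier ?g y) \<longlonglongrightarrow> f 0 * fourier ?g y"
      by (intro AE_I2 tendsto_intros lim_at_0 f)
    show "AE y in lborel. cmod (f (t n *\<^sub>R y) * fourier ?g y) \<le> schwartz_seminorm 0 [] f * cmod (fourier ?g y)" for n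
      using F by (auto simp: norm_mult mult_right_mono)
  qed measurable
  ultimately show ?thesis
    using LIMSEQ_unique by (simp add: eq low_pass_0 mult.commute)
qed

text \<open>Translating \<open>f\<close> by \<open>x\<close> reduces the claim to the value at 0,
  which is \<open>integral_fourier\<close>.\<close>

lemma inv_fourier_fourier:
  assumes f: "f \<in> schwartz" shows "inv_fourier (fourier f) x = \<kappa> * f x"
proof -
  have "(LINT \<xi>|lborel. exp (\<i> * of_real (x \<bullet> \<xi>)) * fourier f \<xi>) = (LINT \<xi>|lborel. fourier (\<lambda>y. f (y + x)) \<xi>)"
    by (simp add: fourier_shift schwartz_measurable f)
  also have "\<dots> = (LINT \<xi>|lborel. fourier (low_pass 0) \<xi>) * f (0 + x)"
    by (rule integral_fourier[OF schwartz_shift[OF f]])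
  finally show ?thesis
    by (simp add: inv_fourier_def \<kappa>_def)
qed

lemma fourier_inv_fourier:
  assumes f: "f \<in> schwartz" shows "fourier (inv_fourier f) x = \<kappa> * f x"
proof -
  have "fourier (inv_fourier f) x = of_real (1 / (2 * pi) ^ 3) * fourier (\<lambda>x. fourier f (- x)) x"
    unfolding inv_fourier_eq by (subst fourier_cmult) simp
  also have "\<dots> = of_real (1 / (2 * pi) ^ 3) * fourier (fourier f) (- x)"
    by (simp add: fourier_reflect schwartz_measurable fourier_schwartz f)
  also have "\<dots> = inv_fourier (fourier f) x"
    by (simp add: inv_fourier_eq)
  finally show ?thesis using inv_fourier_fourier[OF f] by simp
qed

text \<open>If \<open>\<kappa>\<close> were 0, inversion would make the transform of the conjugate
  of \<open>fourier f\<close> vanish, and the multiplication formula would give that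
  \<open>fourier f\<close> has L^2 norm 0. Then every Schwartz function has integral 0; applied to
  \<open>low_pass 0\<close> times an arbitrary test function this forces \<open>low_pass 0\<close> =
  0, against its value 1 at the origin.\<close>

lemma \<kappa>_nonzero: "\<kappa> \<noteq> 0"
proof
  assume 0: "\<kappa> = 0"
  have "fourier f \<xi> = 0" if f: "f \<in> schwartz" for f \<xi>
  proof -
    let ?F = "fourier f"
    have F: "?F \<in> schwartz" using f by (rule fourier_schwartz)
    have [measurable]: "?F \<in> borel_measurable borel" using F by (rule schwartz_measurable)
    have ci: "integrable lborel (\<lambda>x. cnj (?F x))"
      using schwartz_integrable[OF F] by simp
    have "fourier (\<lambda>x. cnj (?F x)) y = 0" for y
    proof -
      have "fourier (\<lambda>x. cnj (?F x)) y = cnj (LINT x|lborel. exp (\<i> * of_real (y \<bullet> x)) * ?F x)"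
        unfolding Bochner_Integration.integral_cnj[symmetric] fourier_def[of "\<lambda>x. cnj (?F x)"]
        by (simp add: exp_cnj inner_commute)
      also have "(LINT x|lborel. exp (\<i> * of_real (y \<bullet> x)) * ?F x) = 0"
        using inv_fourier_fourier[OF f, of y] 0 by (simp add: inv_fourier_def)
      finally show ?thesis by simp
    qed
    then have "(LINT x|lborel. ?F x * cnj (?F x)) = 0"
      using fourier_multiplication_formula[OF schwartz_integrable[OF f] ci] by simp
    then have z: "(LINT x|lborel. (cmod (?F x))\<^sup>2) = 0"
      by (simp only: complex_norm_square[symmetric] integral_complex_of_real of_real_eq_0_iff flip: of_real_power)
    have i: "integrable lborel (\<lambda>x. (cmod (?F x))\<^sup>2)"
    proof -
      have "integrable lborel (\<lambda>x. ?F x * ?F x)"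
        by (intro schwartz_integrable schwartz_mult F)
      from integrable_norm[OF this] show ?thesis by (simp add: norm_mult power2_eq_square)
    qed
    have "AE x in lborel. (cmod (?F x))\<^sup>2 = 0"
      using z by (subst (asm) integral_nonneg_eq_0_iff_AE[OF i]) auto
    then have "AE x in lborel. ?F x = 0" by simp
    then show ?thesis
      by (rule continuous_AE_zero[OF schwartz_continuous[OF F]])
  qed
  then have "(LINT x|lborel. f x) = 0" if "f \<in> schwartz" for f
    using that[THEN \<open>\<And>f \<xi>. f \<in> schwartz \<Longrightarrow> fourier f \<xi> = 0\<close>, of 0] by (simp add: fourier_def)
  then have "(LINT x|lborel. low_pass 0 x * f x) = 0" if "f \<in> schwartz" for f
    using that by (simp add: schwartz_mult low_pass_schwartz)
  then have "AE x in lborel. low_pass 0 x = 0"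
  proof (rule AE_zero_if_orthogonal_schwartz[rotated 2])
    show "low_pass 0 \<in> borel_measurable borel"
      by (intro schwartz_measurable low_pass_schwartz)
    have "integrable lborel (\<lambda>x. cmod (low_pass 0 x))"
      by (intro integrable_norm schwartz_integrable low_pass_schwartz)
    from integrable_real_mult_indicator[OF _ this]
    show "integrable lborel (\<lambda>x. indicator (cball 0 R) x * cmod (low_pass 0 x))" for R
      by (simp add: mult.commute)
  qed
  then have "low_pass 0 0 = 0"
    by (rule continuous_AE_zero[OF schwartz_continuous[OF low_pass_schwartz]])
  then show False by (simp add: low_pass_0)
qed

end

section \<open>Estimates in \<open>L\<^sup>3\<close>\<close>

lemma amgm3:
  fixes x y :: real assumes "x \<ge> 0" "y \<ge> 0" shows "3 * x * y\<^sup>2 \<le> x ^ 3 + 2 * y ^ 3"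
proof -
  have "0 \<le> (x - y)\<^sup>2 * (x + 2 * y)" using assms by simp
  also have "\<dots> = x ^ 3 + 2 * y ^ 3 - 3 * x * y\<^sup>2"
    by (simp add: power2_eq_square power3_eq_cube algebra_simps)
  finally show ?thesis by simp
qed

text \<open>Optimising the parameter \<open>t\<close> in \<open>3xt\<^sup>2 \<le> x\<^sup>3 + 2t\<^sup>3\<close> replaces Hoelder's inequality for the
  exponents \<open>3\<close> and \<open>3/2\<close>.\<close>

lemma cube_le_if_parametric:
  fixes A B K :: real
  assumes A: "A \<ge> 0" and B: "B \<ge> 0" and K: "K \<ge> 0" and t: "\<And>t. t > 0 \<Longrightarrow> 3 * A * t\<^sup>2 \<le> B + 2 * t ^ 3 * K"
  shows "A ^ 3 \<le> K\<^sup>2 * B"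
proof (cases "A = 0")
  case False
  then have A: "A > 0" using A by simp
  show ?thesis
  proof (cases "K = 0")
    case True
    \<comment> \<open>With \<open>K\<close> = 0 the hypothesis must fail for large parameters:
      \<open>s\<close> >= 1 and A s = B + 1 + A > B give the contradiction.\<close>
    define s where "s = (B + 1) / A + 1"
    have "s \<ge> 1" using A B by (simp add: s_def)
    then have "s * 1 \<le> s * s"
      by (intro mult_left_mono) auto
    then have "3 * A * s \<le> 3 * A * s\<^sup>2"
      using A by (simp add: power2_eq_square)
    also have "\<dots> \<le> B"
      using t[of s] \<open>s \<ge> 1\<close> True by simp
    finally have "3 * (A * s) \<le> B" by simp
    moreover have "A * s = B + 1 + A"
      using A by (simp add: s_def field_simps)
    ultimately show ?thesis using A B by linarith
  next
    case False
    then have K: "K > 0" using K by simp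
    \<comment> \<open>t = A/K is the optimal parameter.\<close>
    have "3 * A * (A / K)\<^sup>2 \<le> B + 2 * (A / K) ^ 3 * K"
      using A K by (intro t) simp
    then have "3 * A ^ 3 / K\<^sup>2 \<le> B + 2 * A ^ 3 / K\<^sup>2"
      using K by (simp add: power_divide power2_eq_square power3_eq_cube)
    then have "A ^ 3 / K\<^sup>2 \<le> B" by simp
    then show ?thesis using K by (simp add: pos_divide_le_eq mult.commute)
  qed
qed (use B in simp)

text \<open>Hoelder's inequality with exponents 3 and 3/2 for the measure with density
  \<open>w\<close>, applied to \<open>f\<close> and 1. The pointwise inequality \<open>amgm3\<close>
  is integrated against \<open>w\<close> with a free parameter; parameter 1 already yields
  integrability.\<close>

lemma weighted_cube_inequality:
  fixes w f :: "'a \<Rightarrow> real"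
  assumes w: "integrable M w" and [measurable]: "f \<in> borel_measurable M"
    and wf: "integrable M (\<lambda>x. w x * f x ^ 3)"
    and nn: "\<And>x. w x \<ge> 0" "\<And>x. f x \<ge> 0"
  shows "integrable M (\<lambda>x. w x * f x)"
    and "(LINT x|M. w x * f x) ^ 3 \<le> (LINT x|M. w x)\<^sup>2 * (LINT x|M. w x * f x ^ 3)"
proof -
  have [measurable]: "w \<in> borel_measurable M" using w by simp
  show i: "integrable M (\<lambda>x. w x * f x)"
  proof (rule Bochner_Integration.integrable_bound)
    show "integrable M (\<lambda>x. w x * f x ^ 3 + 2 * w x)"
      by (intro Bochner_Integration.integrable_add integrable_mult_right w wf)
    have "w x * f x \<le> w x * f x ^ 3 + 2 * w x" for x
    proof -
      have "w x * (3 * f x * 1\<^sup>2) \<le> w x * (f x ^ 3 + 2 * 1 ^ 3)"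
        by (intro mult_left_mono amgm3 nn) simp
      moreover have "0 \<le> w x * f x" using nn by simp
      ultimately show ?thesis by (simp add: algebra_simps)
    qed
    then show "AE x in M. norm (w x * f x) \<le> norm (w x * f x ^ 3 + 2 * w x)"
      using nn by (intro AE_I2) (simp add: abs_of_nonneg)
  qed measurable
  show "(LINT x|M. w x * f x) ^ 3 \<le> (LINT x|M. w x)\<^sup>2 * (LINT x|M. w x * f x ^ 3)"
  proof (rule cube_le_if_parametric)
    fix t :: real assume t: "t > 0"
    have "3 * (LINT x|M. w x * f x) * t\<^sup>2 = (LINT x|M. 3 * (w x * f x) * t\<^sup>2)"
      by simp
    also have "\<dots> \<le> (LINT x|M. w x * f x ^ 3 + 2 * t ^ 3 * w x)"
    proof (rule integral_mono)
      show "3 * (w x * f x) * t\<^sup>2 \<le> w x * f x ^ 3 + 2 * t ^ 3 * w x" for x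
        using mult_left_mono[OF amgm3[of "f x" t] nn(1)[of x]] nn t by (simp add: algebra_simps)
    qed (intro Bochner_Integration.integrable_add integrable_mult_right integrable_mult_left w wf i)+
    also have "\<dots> = (LINT x|M. w x * f x ^ 3) + 2 * t ^ 3 * (LINT x|M. w x)"
      using w wf by simp
    finally show "3 * (LINT x|M. w x * f x) * t\<^sup>2 \<le> (LINT x|M. w x * f x ^ 3) + 2 * t ^ 3 * (LINT x|M. w x)" .
  qed (use nn in auto)
qed

section \<open>The space L^3 of functions: Minkowski and Hoelder inequalities\<close>

abbreviation L3 :: "func set" where "L3 \<equiv> Lp_functions 3"

text \<open>The function-level form of \<open>Lp_norm 3\<close>, with the same \<open>powr\<close>
  expression, so that estimates can be made on representatives and transferred by
  \<open>Lp_norm_regular\<close>.\<close>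

definition L3_norm :: "func \<Rightarrow> real" where
  "L3_norm u = (LINT x|lborel. cmod (u x) powr 3) powr (1 / 3)"

lemma L3_iff: "u \<in> L3 \<longleftrightarrow> u \<in> borel_measurable borel \<and> integrable lborel (\<lambda>x. cmod (u x) ^ 3)"
  by (simp add: Lp_functions_def)

lemma L3_measurable: "u \<in> L3 \<Longrightarrow> u \<in> borel_measurable borel"
  and L3_integrable: "u \<in> L3 \<Longrightarrow> integrable lborel (\<lambda>x. cmod (u x) ^ 3)"
  by (simp_all add: L3_iff)

lemma L3_norm_nonneg [simp]: "L3_norm u \<ge> 0"
  by (simp add: L3_norm_def)

lemma L3_norm_cubed: "L3_norm u ^ 3 = (LINT x|lborel. cmod (u x) ^ 3)"
proof -
  define I where "I = (LINT x|lborel. cmod (u x) ^ 3)"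
  have I: "I \<ge> 0" by (simp add: I_def)
  have "(I powr (1 / 3)) ^ 3 = (I powr (1 / 3)) powr 3"
    by (subst powr_numeral) auto
  also have "\<dots> = I powr 1"
    by (simp only: powr_powr) simp
  finally show ?thesis using I by (simp add: L3_norm_def I_def)
qed

lemma L3_norm_le_iff: "c \<ge> 0 \<Longrightarrow> L3_norm u \<le> c \<longleftrightarrow> (LINT x|lborel. cmod (u x) ^ 3) \<le> c ^ 3"
  unfolding L3_norm_cubed[symmetric] by (subst power_mono_iff) auto

lemma L3_norm_eqI: "c \<ge> 0 \<Longrightarrow> (LINT x|lborel. cmod (u x) ^ 3) = c ^ 3 \<Longrightarrow> L3_norm u = c"
  unfolding L3_norm_cubed[symmetric] by (subst (asm) power_eq_iff_eq_base) auto

lemma L3_bound: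
  assumes "v \<in> L3" "u \<in> borel_measurable borel" "\<And>x. cmod (u x) \<le> cmod (v x)"
  shows "u \<in> L3" "L3_norm u \<le> L3_norm v"
proof -
  show u: "u \<in> L3"
    unfolding L3_iff using assms(1,2)
    by (auto intro!: Bochner_Integration.integrable_bound[OF L3_integrable[OF assms(1)]] power_mono assms(3))
  show "L3_norm u \<le> L3_norm v"
    by (subst L3_norm_le_iff) (auto simp: L3_norm_cubed intro!: integral_mono power_mono assms L3_integrable u)
qed

lemma L3_cmult: assumes "u \<in> L3" shows "(\<lambda>x. c * u x) \<in> L3" "L3_norm (\<lambda>x. c * u x) = cmod c * L3_norm u"
  using assms
  by (auto simp: L3_iff norm_mult power_mult_distrib L3_norm_cubed intro!: L3_norm_eqI)

lemma L3_mult_bounded: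
  assumes u: "u \<in> L3" and v: "v \<in> borel_measurable borel" "\<And>x. cmod (v x) \<le> S"
  shows "(\<lambda>x. v x * u x) \<in> L3" "L3_norm (\<lambda>x. v x * u x) \<le> S * L3_norm u"
proof -
  have S: "S \<ge> 0" using order_trans[OF norm_ge_zero v(2)] .
  have 1: "(\<lambda>x. v x * u x) \<in> borel_measurable borel"
    using v(1) L3_measurable[OF u] by simp
  have 2: "cmod (v x * u x) \<le> cmod (of_real S * u x)" for x
    using v(2)[of x] S by (simp add: norm_mult mult_right_mono)
  show "(\<lambda>x. v x * u x) \<in> L3" "L3_norm (\<lambda>x. v x * u x) \<le> S * L3_norm u"
    using L3_bound[OF L3_cmult(1)[OF u] 1 2] L3_cmult(2)[OF u, of "of_real S"] S by simp_all
qed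

text \<open>Convexity of the cube, with equality when \<open>s\<close> : \<open>t\<close> =
  \<open>a\<close> : \<open>b\<close>. Taking the norms of two functions for \<open>a\<close> and
  \<open>b\<close> turns it into Minkowski's inequality after integration.\<close>

lemma cube_add_le:
  fixes a b s t :: real
  assumes "a > 0" "b > 0" "s \<ge> 0" "t \<ge> 0"
  shows "(s + t) ^ 3 \<le> (a + b)\<^sup>2 * (s ^ 3 / a\<^sup>2 + t ^ 3 / b\<^sup>2)"
proof (rule cube_le_if_parametric)
  have *: "3 * s * r\<^sup>2 \<le> s ^ 3 / a\<^sup>2 + 2 * r ^ 3 * a" if "a > 0" "s \<ge> 0" "r > 0" for a s r :: real
  proof -
    have "a * (3 * (s / a) * r\<^sup>2) \<le> a * ((s / a) ^ 3 + 2 * r ^ 3)"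
      using that by (intro mult_left_mono amgm3) auto
    moreover have "a * (3 * (s / a) * r\<^sup>2) = 3 * s * r\<^sup>2" using that by simp
    moreover have "a * ((s / a) ^ 3 + 2 * r ^ 3) = s ^ 3 / a\<^sup>2 + 2 * r ^ 3 * a"
      using that by (simp add: power2_eq_square power3_eq_cube field_simps)
    ultimately show ?thesis by simp
  qed
  fix r :: real assume "r > 0"
  with *[of a s r] *[of b t r] assms
  show "3 * (s + t) * r\<^sup>2 \<le> s ^ 3 / a\<^sup>2 + t ^ 3 / b\<^sup>2 + 2 * r ^ 3 * (a + b)"
    by (simp add: distrib_left distrib_right)
qed (use assms in auto)

lemma L3_add:
  assumes u: "u \<in> L3" and v: "v \<in> L3"
  shows "(\<lambda>x. u x + v x) \<in> L3" "L3_norm (\<lambda>x. u x + v x) \<le> L3_norm u + L3_norm v"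
proof -
  note [measurable] = L3_measurable[OF u] L3_measurable[OF v]
  have b: "cmod (u x + v x) ^ 3 \<le> (a + b)\<^sup>2 / a\<^sup>2 * cmod (u x) ^ 3 + (a + b)\<^sup>2 / b\<^sup>2 * cmod (v x) ^ 3"
    if "a > 0" "b > 0" for a b x
  proof -
    have "cmod (u x + v x) ^ 3 \<le> (cmod (u x) + cmod (v x)) ^ 3"
      by (intro power_mono norm_triangle_ineq) auto
    also have "\<dots> \<le> (a + b)\<^sup>2 * (cmod (u x) ^ 3 / a\<^sup>2 + cmod (v x) ^ 3 / b\<^sup>2)"
      using that by (intro cube_add_le) auto
    finally show ?thesis by (simp add: distrib_left)
  qed
  have i: "integrable lborel (\<lambda>x. (a + b)\<^sup>2 / a\<^sup>2 * cmod (u x) ^ 3 + (a + b)\<^sup>2 / b\<^sup>2 * cmod (v x) ^ 3)" for a b :: real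
    by (intro Bochner_Integration.integrable_add integrable_mult_right L3_integrable u v)
  have s: "integrable lborel (\<lambda>x. cmod (u x + v x) ^ 3)"
  proof (rule Bochner_Integration.integrable_bound[OF i[of 1 1]])
    show "AE x in lborel. norm (cmod (u x + v x) ^ 3) \<le> norm ((1 + 1)\<^sup>2 / 1\<^sup>2 * cmod (u x) ^ 3 + (1 + 1)\<^sup>2 / 1\<^sup>2 * cmod (v x) ^ 3)"
      using b[of 1 1] by (intro AE_I2) (auto intro: order_trans[OF _ abs_ge_self])
  qed measurable
  then show "(\<lambda>x. u x + v x) \<in> L3"
    unfolding L3_iff by simp
  show "L3_norm (\<lambda>x. u x + v x) \<le> L3_norm u + L3_norm v"
  proof (rule field_le_epsilon)
    fix e :: real assume e: "e > 0"
    \<comment> \<open>The two norms, enlarged by e/2 so that division by them is legitimate when a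
      norm is 0.\<close>
    define a b where "a = L3_norm u + e / 2" and "b = L3_norm v + e / 2"
    have ab: "a > 0" "b > 0" "L3_norm u \<le> a" "L3_norm v \<le> b"
      using e by (auto simp: a_def b_def add_nonneg_pos)
    have "(LINT x|lborel. cmod (u x + v x) ^ 3) \<le> (LINT x|lborel. (a + b)\<^sup>2 / a\<^sup>2 * cmod (u x) ^ 3 + (a + b)\<^sup>2 / b\<^sup>2 * cmod (v x) ^ 3)"
      using ab by (intro integral_mono s i b)
    also have "\<dots> = (a + b)\<^sup>2 / a\<^sup>2 * L3_norm u ^ 3 + (a + b)\<^sup>2 / b\<^sup>2 * L3_norm v ^ 3"
      using u v by (simp add: L3_norm_cubed L3_integrable)
    also have "\<dots> \<le> (a + b)\<^sup>2 / a\<^sup>2 * a ^ 3 + (a + b)\<^sup>2 / b\<^sup>2 * b ^ 3"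
      using ab by (intro add_mono mult_left_mono power_mono) auto
    also have "\<dots> = (a + b) ^ 3"
      using ab by (simp add: power2_eq_square power3_eq_cube field_simps)
    finally have "L3_norm (\<lambda>x. u x + v x) \<le> a + b"
      using ab by (subst L3_norm_le_iff) auto
    then show "L3_norm (\<lambda>x. u x + v x) \<le> L3_norm u + L3_norm v + e"
      by (simp add: a_def b_def)
  qed
qed

lemma L3_diff:
  assumes u: "u \<in> L3" and v: "v \<in> L3"
  shows "(\<lambda>x. u x - v x) \<in> L3" "L3_norm (\<lambda>x. u x - v x) \<le> L3_norm u + L3_norm v"
  using L3_add[OF u L3_cmult(1)[OF v, of "-1"]] L3_cmult(2)[OF v, of "-1"] by simp_all

lemma L3_norm_minus_commute: "L3_norm (\<lambda>x. u x - v x) = L3_norm (\<lambda>x. v x - u x)"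
  by (simp add: L3_norm_def norm_minus_commute)

text \<open>Hoelder's inequality for \<open>w\<close> in L^1 and L^\<infinity>, with ||w||_{3/2}^3
  bounded by ||w||_1^2 S. Keeping the two norms of \<open>w\<close> apart is what allows one of them
  to tend to 0 while the other merely stays bounded.\<close>

lemma L3_pairing:
  assumes u: "u \<in> L3" and w: "integrable lborel w" and S: "\<And>x. cmod (w x) \<le> S"
  shows "integrable lborel (\<lambda>x. u x * w x)"
    and "integrable lborel (\<lambda>x. w x * u x)"
    and "(LINT x|lborel. cmod (w x) * cmod (u x)) ^ 3 \<le> (LINT x|lborel. cmod (w x))\<^sup>2 * S * L3_norm u ^ 3"
    and "cmod (LINT x|lborel. u x * w x) ^ 3 \<le> (LINT x|lborel. cmod (w x))\<^sup>2 * S * L3_norm u ^ 3"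
    and "cmod (LINT x|lborel. w x * u x) ^ 3 \<le> (LINT x|lborel. cmod (w x))\<^sup>2 * S * L3_norm u ^ 3"
proof -
  have [measurable]: "w \<in> borel_measurable borel" using w by auto
  note [measurable] = L3_measurable[OF u]
  have S0: "S \<ge> 0" using order_trans[OF norm_ge_zero S] .
  have iw: "integrable lborel (\<lambda>x. cmod (w x) * cmod (u x) ^ 3)"
  proof (rule Bochner_Integration.integrable_bound)
    show "integrable lborel (\<lambda>x. S * cmod (u x) ^ 3)"
      by (intro integrable_mult_right L3_integrable u)
    show "AE x in lborel. norm (cmod (w x) * cmod (u x) ^ 3) \<le> norm (S * cmod (u x) ^ 3)"
      using S S0 by (auto simp: abs_mult intro!: mult_right_mono)
  qed measurable
  note k = weighted_cube_inequality[of lborel "\<lambda>x. cmod (w x)" "\<lambda>x. cmod (u x)", OF integrable_norm[OF w] _ iw]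
  have "integrable lborel (\<lambda>x. cmod (w x) * cmod (u x))"
    by (rule k(1)) auto
  then show i: "integrable lborel (\<lambda>x. w x * u x)"
    by (subst integrable_norm_iff[symmetric]) (auto simp: norm_mult)
  then show "integrable lborel (\<lambda>x. u x * w x)" by (simp add: mult.commute)
  have "(LINT x|lborel. cmod (w x) * cmod (u x)) ^ 3 \<le> (LINT x|lborel. cmod (w x))\<^sup>2 * (LINT x|lborel. cmod (w x) * cmod (u x) ^ 3)"
    by (rule k(2)) auto
  also have "\<dots> \<le> (LINT x|lborel. cmod (w x))\<^sup>2 * (LINT x|lborel. S * cmod (u x) ^ 3)"
    by (intro mult_left_mono integral_mono iw integrable_mult_right L3_integrable u mult_right_mono S) auto
  also have "\<dots> = (LINT x|lborel. cmod (w x))\<^sup>2 * S * L3_norm u ^ 3"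
    by (simp add: L3_norm_cubed)
  finally show 1: "(LINT x|lborel. cmod (w x) * cmod (u x)) ^ 3 \<le> (LINT x|lborel. cmod (w x))\<^sup>2 * S * L3_norm u ^ 3" .
  have "cmod (LINT x|lborel. w x * u x) \<le> (LINT x|lborel. cmod (w x) * cmod (u x))"
    using integral_norm_bound[of lborel "\<lambda>x. w x * u x"] by (simp add: norm_mult)
  then have "cmod (LINT x|lborel. w x * u x) ^ 3 \<le> (LINT x|lborel. cmod (w x) * cmod (u x)) ^ 3"
    by (rule power_mono) simp
  from order_trans[OF this 1] show "cmod (LINT x|lborel. w x * u x) ^ 3 \<le> (LINT x|lborel. cmod (w x))\<^sup>2 * S * L3_norm u ^ 3" .
  then show "cmod (LINT x|lborel. u x * w x) ^ 3 \<le> (LINT x|lborel. cmod (w x))\<^sup>2 * S * L3_norm u ^ 3"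
    by (simp add: mult.commute)
qed

lemma L3_locally_integrable:
  assumes u: "u \<in> L3"
  shows "integrable lborel (\<lambda>x. indicator (cball 0 R) x * cmod (u x))"
proof -
  have "integrable lborel (\<lambda>x. u x * indicator (cball 0 R) x)"
  proof (rule L3_pairing(1)[OF u, of _ 1])
    have "integrable lborel (indicator (cball (0::R3) R) :: R3 \<Rightarrow> real)"
      using emeasure_lborel_cball_finite[of "0::R3" R] by (simp add: top.not_eq_extremum)
    then have "integrable lborel (\<lambda>x. complex_of_real (indicator (cball (0::R3) R) x))"
      by (rule integrable_of_real)
    moreover have "(indicator (cball (0::R3) R) :: R3 \<Rightarrow> complex) = (\<lambda>x. complex_of_real (indicator (cball (0::R3) R) x))"
      by (auto simp: fun_eq_iff indicator_def)
    ultimately show "integrable lborel (indicator (cball (0::R3) R) :: R3 \<Rightarrow> complex)"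
      by (simp only:)
  qed (auto simp: indicator_def)
  moreover have "cmod (u x * indicator (cball 0 R) x) = indicator (cball 0 R) x * cmod (u x)" for x
    by (auto simp: indicator_def)
  ultimately show ?thesis
    using integrable_norm by fastforce
qed

lemma schwartz_L3: assumes f: "f \<in> schwartz" shows "f \<in> L3"
proof -
  have "integrable lborel (\<lambda>x. f x * (f x * f x))"
    by (intro schwartz_integrable schwartz_mult f)
  from integrable_norm[OF this] show ?thesis
    unfolding L3_iff using schwartz_measurable[OF f] by (simp add: norm_mult power3_eq_cube mult.assoc)
qed

text \<open>The summand 1 makes the constant at least 1, so that its lower powers may be enlarged to
  its cube before cube roots are taken.\<close>

definition weight_const :: real where
  "weight_const = 1 + (LINT x|lborel. weight x)"

lemma weight_const_ge: "1 \<le> weight_const" "(LINT x|lborel. weight x) \<le> weight_const"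
  by (simp_all add: weight_const_def weight_bounds)

lemma schwartz_le_weight: "f \<in> schwartz \<Longrightarrow> cmod (f x) \<le> schwartz_seminorm 6 [] f * weight x"
  by (intro le_weight schwartz_seminorm_upper)

lemma L3_norm_le_seminorm:
  assumes f: "f \<in> schwartz" shows "L3_norm f \<le> weight_const * schwartz_seminorm 6 [] f"
proof -
  let ?S = "schwartz_seminorm 6 [] f"
  have S0: "?S \<ge> 0" by (rule schwartz_seminorm_nonneg[OF f])
  have "cmod (f x) ^ 3 \<le> ?S ^ 3 * weight x" for x
  proof -
    have "cmod (f x) ^ 3 \<le> ?S ^ 3 * weight x ^ 3"
      using power_mono[OF schwartz_le_weight[OF f]] by (simp add: power_mult_distrib)
    also have "weight x ^ 3 \<le> weight x ^ 1"
      by (intro power_decreasing weight_bounds) simp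
    finally show ?thesis using S0 by (simp add: mult_left_mono)
  qed
  then have "(LINT x|lborel. cmod (f x) ^ 3) \<le> (LINT x|lborel. ?S ^ 3 * weight x)"
    by (intro integral_mono L3_integrable schwartz_L3 f integrable_mult_right integrable_weight)
  also have "\<dots> \<le> ?S ^ 3 * weight_const ^ 3"
    using S0 weight_const_ge power_increasing[of 1 3 weight_const]
    by (simp add: mult_left_mono)
  finally show ?thesis
    using S0 weight_const_ge(1) by (subst L3_norm_le_iff) (auto simp: power_mult_distrib mult.commute)
qed

section \<open>Convolution of a Schwartz kernel with an L^3 function\<close>

definition conv :: "func \<Rightarrow> func \<Rightarrow> func" where
  "conv k u x = (LINT y|lborel. k (x - y) * u y)"

context
  fixes k u :: func
  assumes k: "k \<in> schwartz" and u: "u \<in> L3"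
begin

lemma conv_integrable: "integrable lborel (\<lambda>y. k (x - y) * u y)"
  by (rule L3_pairing(2)[OF u schwartz_integrable[OF schwartz_convolution_point[OF k]]])
    (rule schwartz_le_seminorm[OF k])

lemma kernel_reflect_L1: "(LINT y|lborel. cmod (k (x - y))) = (LINT x|lborel. cmod (k x))"
  by (rule integral_reflect_shift) (use schwartz_measurable[OF k] in measurable)

lemma conv_sup_le:
  assumes S: "\<And>x. cmod (k x) \<le> S"
  shows "(LINT y|lborel. cmod (k (x - y)) * cmod (u y)) ^ 3 \<le> (LINT x|lborel. cmod (k x))\<^sup>2 * S * L3_norm u ^ 3"
    "cmod (conv k u x) ^ 3 \<le> (LINT x|lborel. cmod (k x))\<^sup>2 * S * L3_norm u ^ 3"
  unfolding conv_def
  using L3_pairing(3,5)[OF u schwartz_integrable[OF schwartz_convolution_point[OF k, of x]] S]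
  by (simp_all add: kernel_reflect_L1)

text \<open>A convergent sequence of points is bounded, so the translated kernels share a multiple
  of \<open>weight\<close> as majorant. Continuity matters because \<open>dist_function\<close>
  selects a continuous representative.\<close>

lemma conv_continuous: "continuous_on UNIV (conv k u)"
  unfolding continuous_on_sequentially
proof safe
  fix x :: "nat \<Rightarrow> R3" and a assume xa: "x \<longlonglongrightarrow> a"
  note [measurable] = L3_measurable[OF u] schwartz_measurable[OF k]
  obtain C where C: "C > 0" "\<And>x. (1 + norm x) ^ 6 * cmod (k x) \<le> C"
    using rapidD[OF schwartz_rapid[OF k]] by metis
  have "Bseq x" using xa by (meson convergent_def convergent_imp_Bseq)
  then obtain b where b: "b > 0" "\<And>n. norm (x n) \<le> b" unfolding Bseq_def by blast
  have bd: "cmod (k (x n - y) * u y) \<le> C * (1 + b) ^ 6 * (weight y * cmod (u y))" for n y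
  proof -
    have "cmod (k (x n - y)) \<le> C * (1 + b) ^ 6 * weight y"
      using C(2)[of "x n - y"] b(2)[of n] by (intro le_weight_shift[of y "- x n"]) (auto simp: norm_minus_commute)
    then have "cmod (k (x n - y)) * cmod (u y) \<le> C * (1 + b) ^ 6 * weight y * cmod (u y)"
      by (rule mult_right_mono) simp
    then show ?thesis by (simp add: norm_mult mult.assoc)
  qed
  have "(\<lambda>n. conv k u (x n)) \<longlonglongrightarrow> conv k u a"
    unfolding conv_def
  proof (rule integral_dominated_convergence)
    have "integrable lborel (\<lambda>y. u y * of_real (weight y))"
      by (rule L3_pairing(1)[OF u, of _ 1]) (simp_all add: integrable_weight weight_bounds)
    from integrable_norm[OF this] have "integrable lborel (\<lambda>y. weight y * cmod (u y))"
      by (simp add: norm_mult mult.commute weight_bounds)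
    then show "integrable lborel (\<lambda>y. C * (1 + b) ^ 6 * (weight y * cmod (u y)))"
      by (rule integrable_mult_right)
    show "AE y in lborel. (\<lambda>n. k (x n - y) * u y) \<longlonglongrightarrow> k (a - y) * u y"
    proof (intro AE_I2 tendsto_mult tendsto_const)
      fix y
      show "(\<lambda>n. k (x n - y)) \<longlonglongrightarrow> k (a - y)"
        by (rule continuous_on_tendsto_compose[OF schwartz_continuous[OF k]]) (auto intro!: tendsto_intros xa)
    qed
    show "AE y in lborel. cmod (k (x n - y) * u y) \<le> C * (1 + b) ^ 6 * (weight y * cmod (u y))" for n
      using bd by blast
  qed measurable
  then show "(conv k u \<circ> x) \<longlonglongrightarrow> conv k u a" by (simp add: o_def)
qed

text \<open>Young's inequality L^1 * L^3 -> L^3: pointwise Hoelder with |k(x - y)| as the weight,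
  then integration in \<open>x\<close> by \<open>Young_L1\<close>.\<close>

lemma conv_L3: "conv k u \<in> L3" "L3_norm (conv k u) \<le> (LINT x|lborel. cmod (k x)) * L3_norm u"
proof -
  define K where "K = (LINT x|lborel. cmod (k x))"
  let ?I = "\<lambda>x. LINT y|lborel. cmod (k (x - y)) * cmod (u y) ^ 3"
  note [measurable] = L3_measurable[OF u] schwartz_measurable[OF k]
  note Y = Young_L1[OF integrable_norm[OF schwartz_integrable[OF k]] norm_ge_zero L3_integrable[OF u]]
  have b: "cmod (conv k u x) ^ 3 \<le> K\<^sup>2 * ?I x" for x
  proof -
    let ?S = "schwartz_seminorm 0 [] k"
    have iw: "integrable lborel (\<lambda>y. cmod (k (x - y)) * cmod (u y) ^ 3)"
    proof (rule Bochner_Integration.integrable_bound)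
      show "integrable lborel (\<lambda>y. ?S * cmod (u y) ^ 3)"
        by (intro integrable_mult_right L3_integrable u)
      show "AE y in lborel. norm (cmod (k (x - y)) * cmod (u y) ^ 3) \<le> norm (?S * cmod (u y) ^ 3)"
        using schwartz_le_seminorm[OF k] schwartz_seminorm_nonneg[OF k] by (auto simp: abs_mult intro!: mult_right_mono)
    qed measurable
    have "cmod (conv k u x) ^ 3 \<le> (LINT y|lborel. cmod (k (x - y) * u y)) ^ 3"
      unfolding conv_def by (intro power_mono integral_norm_bound) auto
    also have "\<dots> \<le> (LINT y|lborel. cmod (k (x - y)))\<^sup>2 * ?I x"
      unfolding norm_mult
      by (rule weighted_cube_inequality(2)[OF integrable_norm[OF schwartz_integrable[OF schwartz_convolution_point[OF k]]] _ iw]) auto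
    finally show ?thesis by (simp add: kernel_reflect_L1 K_def)
  qed
  have m: "conv k u \<in> borel_measurable borel"
    by (intro borel_measurable_continuous_onI conv_continuous)
  have i3: "integrable lborel (\<lambda>x. cmod (conv k u x) ^ 3)"
    by (rule Bochner_Integration.integrable_bound[OF integrable_mult_right[OF Y(2), of "K\<^sup>2"]])
       (use m b in \<open>auto intro!: AE_I2 order_trans[OF b abs_ge_self]\<close>)
  then show "conv k u \<in> L3"
    unfolding L3_iff using m by simp
  have "(LINT x|lborel. cmod (conv k u x) ^ 3) \<le> (LINT x|lborel. K\<^sup>2 * ?I x)"
    by (intro integral_mono i3 integrable_mult_right Y b)
  also have "\<dots> = K\<^sup>2 * (K * L3_norm u ^ 3)"
    by (simp add: Y L3_norm_cubed K_def)
  also have "\<dots> = (K * L3_norm u) ^ 3"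
    by (simp add: power2_eq_square power3_eq_cube)
  finally show "L3_norm (conv k u) \<le> (LINT x|lborel. cmod (k x)) * L3_norm u"
    unfolding K_def[symmetric] by (subst L3_norm_le_iff) (auto simp: K_def)
qed

lemma conv_test:
  assumes \<phi>: "integrable lborel \<phi>"
  shows "(LINT y|lborel. u y * (LINT x|lborel. k (x - y) * \<phi> x)) = (LINT x|lborel. conv k u x * \<phi> x)"
proof -
  note [measurable] = L3_measurable[OF u] schwartz_measurable[OF k]
  have "(LINT x|lborel. \<phi> x * (LINT y|lborel. k (x - y) * u y)) = (LINT y|lborel. LINT x|lborel. \<phi> x * (k (x - y) * u y))"
  proof (rule Fubini_bounded_kernel(1)[OF \<phi> _ conv_integrable])
    fix x
    let ?J = "LINT y|lborel. cmod (k (x - y)) * cmod (u y)"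
    have J0: "0 \<le> ?J" by (intro Bochner_Integration.integral_nonneg) auto
    \<comment> \<open>\<open>conv_sup_le\<close> controls the cube only; this turns it into the
      uniform linear bound that Fubini needs.\<close>
    have "?J \<le> ?J ^ 3 + 1"
      using J0 zero_le_power[OF J0, of 3] amgm3[OF J0 zero_le_one] unfolding power_one mult_1_right by linarith
    then show "(LINT y|lborel. norm (k (x - y) * u y)) \<le> (LINT x|lborel. cmod (k x))\<^sup>2 * schwartz_seminorm 0 [] k * L3_norm u ^ 3 + 1"
      using conv_sup_le(1)[OF schwartz_le_seminorm[OF k], of x] by (simp add: norm_mult)
  qed measurable
  also have "\<dots> = (LINT y|lborel. u y * (LINT x|lborel. k (x - y) * \<phi> x))"
    by (simp add: mult_ac flip: integral_mult_right_zero)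
  finally show ?thesis by (simp add: conv_def mult.commute)
qed

end

section \<open>Completeness, density and uniqueness\<close>

lemma L3_norm_tendsto_zeroI:
  assumes "(\<lambda>n. LINT x|lborel. cmod (v n x) ^ 3) \<longlonglongrightarrow> 0"
  shows "(\<lambda>n::nat. L3_norm (v n)) \<longlonglongrightarrow> 0"
proof (rule LIMSEQ_I)
  fix e :: real assume e: "e > 0"
  then obtain n0 where "\<And>n. n \<ge> n0 \<Longrightarrow> norm ((LINT x|lborel. cmod (v n x) ^ 3) - 0) < (e / 2) ^ 3"
    using LIMSEQ_D[OF assms, of "(e / 2) ^ 3"] by auto
  then have "L3_norm (v n) \<le> e / 2" if "n \<ge> n0" for n
    using that e by (subst L3_norm_le_iff) (auto intro!: less_imp_le)
  then show "\<exists>n0. \<forall>n\<ge>n0. norm (L3_norm (v n) - 0) < e"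
    using e by (intro exI[of _ n0]) fastforce
qed

lemma L3_norm_cong_AE:
  assumes "u \<in> L3" "v \<in> L3" "AE x in lborel. u x = v x"
  shows "L3_norm u = L3_norm v"
  unfolding L3_norm_def
  using assms(3) L3_measurable[OF assms(1)] L3_measurable[OF assms(2)]
  by (intro arg_cong[where f = "\<lambda>r. r powr (1/3)"] integral_cong_AE) (auto elim: AE_mp)

lemma L3_dominated_convergence:
  fixes W :: "R3 \<Rightarrow> real"
  assumes [measurable]: "\<And>n::nat. v n \<in> borel_measurable borel" "h \<in> borel_measurable borel"
    and W: "integrable lborel (\<lambda>x. W x ^ 3)"
    and lim: "AE x in lborel. (\<lambda>n. v n x) \<longlonglongrightarrow> h x"
    and b: "\<And>n x. cmod (v n x) \<le> W x"
  shows "(\<lambda>n. L3_norm (\<lambda>x. h x - v n x)) \<longlonglongrightarrow> 0"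
proof (rule L3_norm_tendsto_zeroI)
  have "(\<lambda>n. LINT x|lborel. cmod (h x - v n x) ^ 3) \<longlonglongrightarrow> (LINT x|(lborel :: R3 measure). (0::real))"
  proof (rule integral_dominated_convergence)
    show "integrable lborel (\<lambda>x. 8 * W x ^ 3)"
      by (intro integrable_mult_right W)
    show "AE x in lborel. (\<lambda>n. cmod (h x - v n x) ^ 3) \<longlonglongrightarrow> 0"
      using lim
    proof eventually_elim
      fix x assume "(\<lambda>n. v n x) \<longlonglongrightarrow> h x"
      then have "(\<lambda>n. cmod (h x - v n x) ^ 3) \<longlonglongrightarrow> cmod (h x - h x) ^ 3"
        by (intro tendsto_intros)
      then show "(\<lambda>n. cmod (h x - v n x) ^ 3) \<longlonglongrightarrow> 0" by simp
    qed
    show "AE x in lborel. norm (cmod (h x - v n x) ^ 3) \<le> 8 * W x ^ 3" for n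
      using lim
    proof eventually_elim
      fix x assume "(\<lambda>n. v n x) \<longlonglongrightarrow> h x"
      then have "cmod (h x) \<le> W x"
        by (rule LIMSEQ_le_const2[OF tendsto_norm]) (use b in blast)
      then have "cmod (h x - v n x) \<le> 2 * W x"
        using norm_triangle_ineq4[of "h x" "v n x"] b[of n x] by linarith
      then have "cmod (h x - v n x) ^ 3 \<le> (2 * W x) ^ 3"
        by (rule power_mono) simp
      then show "norm (cmod (h x - v n x) ^ 3) \<le> 8 * W x ^ 3"
        by (simp add: power_mult_distrib)
    qed
  qed measurable
  then show "(\<lambda>n. LINT x|lborel. cmod (h x - v n x) ^ 3) \<longlonglongrightarrow> 0" by simp
qed

lemma nn_integral_L3: "u \<in> L3 \<Longrightarrow> (\<integral>\<^sup>+x. ennreal (cmod (u x) ^ 3) \<partial>lborel) = ennreal (L3_norm u ^ 3)"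
  unfolding L3_norm_cubed by (subst nn_integral_eq_integral) (auto intro!: L3_integrable)

lemma L3_Fatou:
  assumes v: "\<And>k::nat. v k \<in> L3" and w [measurable]: "w \<in> borel_measurable borel"
    and lim: "AE x in lborel. (\<lambda>k. v k x) \<longlonglongrightarrow> w x"
    and e: "\<forall>\<^sub>F k in sequentially. L3_norm (v k) \<le> e" "e \<ge> 0"
  shows "w \<in> L3" "L3_norm w \<le> e"
proof -
  let ?J = "\<lambda>u. \<integral>\<^sup>+x. ennreal (cmod (u x) ^ 3) \<partial>lborel"
  note [measurable] = L3_measurable[OF v]
  have "?J w = (\<integral>\<^sup>+x. liminf (\<lambda>k. ennreal (cmod (v k x) ^ 3)) \<partial>lborel)"
  proof (rule nn_integral_cong_AE, use lim in eventually_elim)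
    fix x assume "(\<lambda>k. v k x) \<longlonglongrightarrow> w x"
    then have "(\<lambda>k. ennreal (cmod (v k x) ^ 3)) \<longlonglongrightarrow> ennreal (cmod (w x) ^ 3)"
      by (intro tendsto_ennrealI tendsto_intros)
    then show "ennreal (cmod (w x) ^ 3) = liminf (\<lambda>k. ennreal (cmod (v k x) ^ 3))"
      by (rule lim_imp_Liminf[OF sequentially_bot, symmetric])
  qed
  also have "\<dots> \<le> liminf (\<lambda>k. ?J (v k))"
    by (rule nn_integral_liminf) measurable
  also have "\<dots> \<le> limsup (\<lambda>k. ?J (v k))"
    by (rule Liminf_le_Limsup) simp
  also have "\<dots> \<le> ennreal (e ^ 3)"
    by (rule Limsup_bounded, rule eventually_mono[OF e(1)])
      (auto simp: nn_integral_L3 v intro!: ennreal_leI power_mono)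
  finally have le: "?J w \<le> ennreal (e ^ 3)" .
  have "integrable lborel (\<lambda>x. cmod (w x) ^ 3)"
    by (rule integrableI_bounded) (use le in \<open>auto intro: le_less_trans\<close>)
  then show wL: "w \<in> L3" by (simp add: L3_iff)
  show "L3_norm w \<le> e"
    using le e(2) by (simp add: nn_integral_L3 wL ennreal_le_iff L3_norm_le_iff L3_norm_cubed)
qed

text \<open>Riesz-Fischer. Along a subsequence the increments d_k have norm at most 4^{-k}, so the
  integrals of 8^k |d_k|^3 are at most 8^{-k} and have a finite sum. Hence almost everywhere |d_k|
  <= 2^{-k} eventually, which gives pointwise convergence; Fatou's lemma then returns to the
  norm.\<close>

lemma L3_complete:
  assumes X: "\<And>n::nat. X n \<in> L3"
    and cauchy: "\<And>e. e > 0 \<Longrightarrow> \<exists>M. \<forall>m\<ge>M. \<forall>n\<ge>M. L3_norm (\<lambda>x. X m x - X n x) < e"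
  obtains u where "u \<in> L3" "(\<lambda>n. L3_norm (\<lambda>x. X n x - u x)) \<longlonglongrightarrow> 0"
proof -
  note [measurable] = L3_measurable[OF X]
  have "\<forall>k. \<exists>M. \<forall>m\<ge>M. \<forall>n\<ge>M. L3_norm (\<lambda>x. X m x - X n x) < (1 / 4) ^ k"
    by (intro allI cauchy) simp
  then obtain M where M: "\<And>k m n. m \<ge> M k \<Longrightarrow> n \<ge> M k \<Longrightarrow> L3_norm (\<lambda>x. X m x - X n x) < (1 / 4) ^ k"
    by metis
  \<comment> \<open>Summing the thresholds makes both \<open>r k\<close> and
    \<open>r (Suc k)\<close> at least \<open>M k\<close>; the summand \<open>k\<close> makes the
    indices tend to infinity.\<close>
  define r where "r k = k + (\<Sum>i\<le>k. M i)" for k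
  have "M k \<le> (\<Sum>i\<le>k. M i)" for k
    by (rule member_le_sum) auto
  then have rM: "r k \<ge> M k" "r (Suc k) \<ge> M k" for k
    unfolding r_def by (simp_all add: trans_le_add2 trans_le_add1 le_SucI)
  have r_ge: "r k \<ge> k" for k by (simp add: r_def)
  define d where "d k x = X (r (Suc k)) x - X (r k) x" for k x
  have dL: "d k \<in> L3" and dn: "L3_norm (d k) \<le> (1 / 4) ^ k" for k
    unfolding d_def[abs_def] using M[OF rM(2) rM(1), of k] by (auto intro!: L3_diff X)
  note [measurable] = L3_measurable[OF dL]
  have "(\<integral>\<^sup>+x. (\<Sum>k. ennreal (8 ^ k * cmod (d k x) ^ 3)) \<partial>lborel) = (\<Sum>k. \<integral>\<^sup>+x. ennreal (8 ^ k * cmod (d k x) ^ 3) \<partial>lborel)"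
    by (rule nn_integral_suminf) measurable
  also have "\<dots> \<le> (\<Sum>k. ennreal ((1 / 8) ^ k))"
  proof (rule suminf_le)
    fix k
    have "(\<integral>\<^sup>+x. ennreal (8 ^ k * cmod (d k x) ^ 3) \<partial>lborel) = ennreal (8 ^ k * L3_norm (d k) ^ 3)"
      by (simp add: ennreal_mult nn_integral_cmult nn_integral_L3 dL)
    also have "8 ^ k * L3_norm (d k) ^ 3 \<le> 8 ^ k * ((1 / 4) ^ k) ^ 3"
      by (intro mult_left_mono power_mono dn) auto
    also have "\<dots> = (8 * (1 / 4) ^ 3) ^ k"
      by (simp only: power_mult_distrib power_mult[symmetric] mult.commute)
    also have "8 * (1 / 4) ^ 3 = (1 / 8 :: real)"
      by (simp add: power3_eq_cube)
    finally show "(\<integral>\<^sup>+x. ennreal (8 ^ k * cmod (d k x) ^ 3) \<partial>lborel) \<le> ennreal ((1 / 8) ^ k)"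
      by (simp add: ennreal_leI)
  qed auto
  also have "\<dots> = ennreal (\<Sum>k. (1 / 8) ^ k)"
    by (rule suminf_ennreal2) (auto intro!: summable_geometric)
  finally have "(\<integral>\<^sup>+x. (\<Sum>k. ennreal (8 ^ k * cmod (d k x) ^ 3)) \<partial>lborel) \<noteq> \<infinity>"
    by (auto simp: top_unique)
  then have "AE x in lborel. (\<Sum>k. ennreal (8 ^ k * cmod (d k x) ^ 3)) \<noteq> \<infinity>"
    by (intro nn_integral_PInf_AE) measurable
  then have conv: "AE x in lborel. convergent (\<lambda>k. X (r k) x)"
  proof eventually_elim
    fix x assume "(\<Sum>k. ennreal (8 ^ k * cmod (d k x) ^ 3)) \<noteq> \<infinity>"
    then have "summable (\<lambda>k. 8 ^ k * cmod (d k x) ^ 3)"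
      by (intro summable_suminf_not_top) auto
    then have "(\<lambda>k. 8 ^ k * cmod (d k x) ^ 3) \<longlonglongrightarrow> 0"
      by (rule summable_LIMSEQ_zero)
    then have "\<forall>\<^sub>F k in sequentially. 8 ^ k * cmod (d k x) ^ 3 < 1"
      by (rule order_tendstoD) simp
    then have "\<forall>\<^sub>F k in sequentially. norm (d k x) \<le> (1 / 2) ^ k"
    proof eventually_elim
      fix k assume "8 ^ k * cmod (d k x) ^ 3 < 1"
      moreover have "(2 ^ k) ^ 3 = (8::real) ^ k"
        by (simp only: power_mult[symmetric] mult.commute[of k]) (simp add: power_mult)
      ultimately have "(2 ^ k * cmod (d k x)) ^ 3 < 1 ^ 3"
        by (simp add: power_mult_distrib)
      then have "2 ^ k * cmod (d k x) < 1"
        by (rule power_less_imp_less_base) simp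
      then show "norm (d k x) \<le> (1 / 2) ^ k"
        by (simp add: power_divide field_simps)
    qed
    then have "summable (\<lambda>k. d k x)"
      by (rule summable_comparison_test_ev) (auto intro!: summable_geometric)
    then have "(\<lambda>n. \<Sum>k<n. d k x) \<longlonglongrightarrow> (\<Sum>k. d k x)"
      by (rule summable_LIMSEQ)
    then have "(\<lambda>n. (\<Sum>k<n. d k x) + X (r 0) x) \<longlonglongrightarrow> (\<Sum>k. d k x) + X (r 0) x"
      by (intro tendsto_intros)
    moreover have "(\<Sum>k<n. d k x) + X (r 0) x = X (r n) x" for n
      unfolding d_def by (subst sum_lessThan_telescope) simp
    ultimately show "convergent (\<lambda>k. X (r k) x)"
      by (auto simp: convergent_def)
  qed
  define u where "u x = lim (\<lambda>k. X (r k) x)" for x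
  have [measurable]: "u \<in> borel_measurable borel"
    unfolding u_def by (intro borel_measurable_lim_metric) measurable
  have ulim: "AE x in lborel. (\<lambda>k. X (r k) x) \<longlonglongrightarrow> u x"
    using conv by eventually_elim (simp add: u_def convergent_LIMSEQ_iff)
  have bound: "(\<lambda>x. u x - X n x) \<in> L3 \<and> L3_norm (\<lambda>x. u x - X n x) \<le> e"
    if e: "e > 0" and n: "\<And>m. m \<ge> n \<Longrightarrow> L3_norm (\<lambda>x. X m x - X n x) < e" for n e
  proof -
    have lim: "AE x in lborel. (\<lambda>k. X (r k) x - X n x) \<longlonglongrightarrow> u x - X n x"
      using ulim by eventually_elim (intro tendsto_intros)
    have "L3_norm (\<lambda>x. X (r k) x - X n x) \<le> e" if "n \<le> k" for k
      using n[OF order_trans[OF that r_ge]] by simp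
    then have ev: "\<forall>\<^sub>F k in sequentially. L3_norm (\<lambda>x. X (r k) x - X n x) \<le> e"
      by (rule eventually_sequentiallyI[of n])
    have m: "(\<lambda>x. u x - X n x) \<in> borel_measurable borel" by measurable
    show ?thesis
      using L3_Fatou[OF L3_diff(1)[OF X X] m lim ev less_imp_le[OF e]] by blast
  qed
  have uL: "u \<in> L3"
  proof -
    obtain n where n: "\<And>m k. m \<ge> n \<Longrightarrow> k \<ge> n \<Longrightarrow> L3_norm (\<lambda>x. X m x - X k x) < 1"
      using cauchy[of 1] by auto
    have "(\<lambda>x. u x - X n x) \<in> L3"
      using bound[OF zero_less_one n[OF _ order_refl]] by (rule conjunct1)
    from L3_add(1)[OF this X, of n] show ?thesis by simp
  qed
  show thesis
  proof (rule that[OF uL], rule LIMSEQ_I)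
    fix e :: real assume e: "e > 0"
    then obtain n0 where n0: "\<And>m n. m \<ge> n0 \<Longrightarrow> n \<ge> n0 \<Longrightarrow> L3_norm (\<lambda>x. X m x - X n x) < e / 2"
      using cauchy[of "e / 2"] by auto
    have "norm (L3_norm (\<lambda>x. X n x - u x) - 0) < e" if "n \<ge> n0" for n
    proof -
      have "L3_norm (\<lambda>x. u x - X n x) \<le> e / 2"
        using bound[of "e / 2" n] n0[OF _ that] order_trans[OF that] e by simp
      then show ?thesis using e by (simp add: L3_norm_minus_commute[of "X n" u])
    qed
    then show "\<exists>n0. \<forall>n\<ge>n0. norm (L3_norm (\<lambda>x. X n x - u x) - 0) < e" by blast
  qed
qed

text \<open>Truncating both the argument and the values costs little by dominated convergence. The
  truncated function, divided by a bound \<open>N\<close>, is within reach of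
  \<open>schwartz_AE_approximation\<close>, whose majorant is in L^3.\<close>

lemma (in lp_cutoff) schwartz_dense_L3:
  assumes u: "u \<in> L3" and e: "e > 0"
  obtains \<phi> where "\<phi> \<in> schwartz" "L3_norm (\<lambda>x. u x - \<phi> x) < e"
proof -
  note [measurable] = L3_measurable[OF u]
  define h where "h n x = (if norm x \<le> real n \<and> cmod (u x) \<le> real n then u x else 0)" for n x
  have hm [measurable]: "h n \<in> borel_measurable borel" for n
    unfolding h_def[abs_def] by measurable
  have "(\<lambda>n. L3_norm (\<lambda>x. u x - h n x)) \<longlonglongrightarrow> 0"
  proof (rule L3_dominated_convergence[where W = "\<lambda>x. cmod (u x)"])
    show "AE x in lborel. (\<lambda>n. h n x) \<longlonglongrightarrow> u x"
    proof (rule AE_I2)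
      fix x
      obtain m where m: "max (norm x) (cmod (u x)) \<le> real m" using real_arch_simple by blast
      have "\<forall>\<^sub>F n in sequentially. h n x = u x"
        by (rule eventually_sequentiallyI[of m]) (use m in \<open>auto simp: h_def\<close>)
      then show "(\<lambda>n. h n x) \<longlonglongrightarrow> u x" by (rule tendsto_eventually)
    qed
  qed (auto simp: h_def L3_integrable u)
  then obtain n where n: "L3_norm (\<lambda>x. u x - h n x) < e / 2"
    using e LIMSEQ_D[of _ 0 "e / 2"] by fastforce
  define N where "N = real n + 1"
  have N: "N > 0" by (simp add: N_def)
  have "cmod (h n x) \<le> N" for x
    by (auto simp: h_def N_def)
  then have h1: "cmod (h n x / of_real N) \<le> 1" for x
    using N by (simp add: norm_divide divide_le_eq)
  have h0: "h n x / of_real N = 0" if "norm x > real n" for x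
    using that by (simp add: h_def)
  have hm': "(\<lambda>x. h n x / of_real N) \<in> borel_measurable borel"
    by measurable
  obtain \<phi> B R where \<phi>: "\<And>k::nat. \<phi> k \<in> schwartz" "AE x in lborel. (\<lambda>k. \<phi> k x) \<longlonglongrightarrow> h n x / of_real N"
    and bd: "\<And>k x. cmod (\<phi> k x) \<le> B * indicator (cball 0 R) x" "B > 0"
    by (rule schwartz_AE_approximation[OF hm' h1 h0]) blast+
  note [measurable] = schwartz_measurable[OF \<phi>(1)]
  have "(\<lambda>k. L3_norm (\<lambda>x. h n x - of_real N * \<phi> k x)) \<longlonglongrightarrow> 0"
  proof (rule L3_dominated_convergence[where W = "\<lambda>x. N * (B * indicator (cball 0 R) x)"])
    have "integrable lborel (\<lambda>x::R3. (N * B) ^ 3 * indicator (cball 0 R) x)"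
      using emeasure_lborel_cball_finite[of "0::R3" R]
      by (intro integrable_mult_right) (simp add: top.not_eq_extremum)
    moreover have "(N * B) ^ 3 * indicator (cball 0 R) x = (N * (B * indicator (cball 0 R) x)) ^ 3" for x :: R3
      by (simp add: indicator_def)
    ultimately show "integrable lborel (\<lambda>x::R3. (N * (B * indicator (cball 0 R) x)) ^ 3)"
      by simp
    show "AE x in lborel. (\<lambda>k. of_real N * \<phi> k x) \<longlonglongrightarrow> h n x"
      using \<phi>(2)
    proof eventually_elim
      fix x assume "(\<lambda>k. \<phi> k x) \<longlonglongrightarrow> h n x / of_real N"
      from tendsto_mult[OF tendsto_const[of "of_real N"] this]
      show "(\<lambda>k. of_real N * \<phi> k x) \<longlonglongrightarrow> h n x" using N by simp
    qed
    show "cmod (of_real N * \<phi> k x) \<le> N * (B * indicator (cball 0 R) x)" for k x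
      using bd(1)[of k x] N by (simp add: norm_mult)
  qed measurable
  then obtain k where k: "L3_norm (\<lambda>x. h n x - of_real N * \<phi> k x) < e / 2"
    using e LIMSEQ_D[of _ 0 "e / 2"] by fastforce
  have \<psi>: "(\<lambda>x. of_real N * \<phi> k x) \<in> schwartz"
    by (intro schwartz_cmult \<phi>)
  have hL: "h n \<in> L3"
    by (rule L3_bound(1)[OF u]) (auto simp: h_def)
  have "L3_norm (\<lambda>x. (u x - h n x) + (h n x - of_real N * \<phi> k x)) < e"
    using L3_add(2)[OF L3_diff(1)[OF u hL] L3_diff(1)[OF hL schwartz_L3[OF \<psi>]]] n k by linarith
  then show thesis using \<psi> by (intro that) simp_all
qed

section \<open>Regular distributions and uniqueness of representatives\<close>

lemma on_schwartz_apply [simp]: "\<phi> \<in> schwartz \<Longrightarrow> on_schwartz T \<phi> = T \<phi>"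
  and on_schwartz_outside [simp]: "\<phi> \<notin> schwartz \<Longrightarrow> on_schwartz T \<phi> = 0"
  by (simp_all add: on_schwartz_def)

lemma regular_apply: "\<phi> \<in> schwartz \<Longrightarrow> regular u \<phi> = (LINT x|lborel. u x * \<phi> x)"
  and regular_outside: "\<phi> \<notin> schwartz \<Longrightarrow> regular u \<phi> = 0"
  by (simp_all add: regular_def)

lemma L3_times_schwartz_integrable:
  "u \<in> L3 \<Longrightarrow> \<phi> \<in> schwartz \<Longrightarrow> integrable lborel (\<lambda>x. u x * \<phi> x)"
  by (rule L3_pairing(1)[OF _ schwartz_integrable]) (auto intro: schwartz_le_seminorm)

lemma regular_add: "u \<in> L3 \<Longrightarrow> v \<in> L3 \<Longrightarrow> regular (\<lambda>x. u x + v x) = regular u + regular v"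
  by (rule ext, rename_tac \<phi>, case_tac "\<phi> \<in> schwartz")
    (simp_all add: regular_apply regular_outside distrib_right L3_times_schwartz_integrable)

lemma regular_diff: "u \<in> L3 \<Longrightarrow> v \<in> L3 \<Longrightarrow> regular (\<lambda>x. u x - v x) = regular u - regular v"
  by (rule ext, rename_tac \<phi>, case_tac "\<phi> \<in> schwartz")
    (simp_all add: regular_apply regular_outside left_diff_distrib L3_times_schwartz_integrable)

lemma regular_cmult: "regular (\<lambda>x. c * u x) = (\<lambda>\<phi>. c * regular u \<phi>)"
  by (rule ext, rename_tac \<phi>, case_tac "\<phi> \<in> schwartz")
    (simp_all add: regular_apply regular_outside mult.assoc)

lemma regular_zero: "regular (\<lambda>x. 0) = 0"
  by (rule ext, rename_tac \<phi>, case_tac "\<phi> \<in> schwartz")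
    (simp_all add: regular_apply regular_outside)

lemma zero_L3: "(\<lambda>x. 0) \<in> L3"
  by (simp add: L3_iff)

lemma regular_cong_AE:
  assumes "AE x in lborel. u x = v x" and [measurable]: "u \<in> borel_measurable borel" "v \<in> borel_measurable borel"
  shows "regular u = regular v"
proof
  fix \<phi>
  show "regular u \<phi> = regular v \<phi>"
  proof (cases "\<phi> \<in> schwartz")
    case True
    note [measurable] = schwartz_measurable[OF True]
    have "AE x in lborel. u x * \<phi> x = v x * \<phi> x"
      using assms(1) by eventually_elim simp
    then show ?thesis
      unfolding regular_apply[OF True] by (intro integral_cong_AE) auto
  qed (simp add: regular_outside)
qed

context lp_cutoff
begin

text \<open>The integrability assumptions are kept abstract because the lemma is applied both to L^3
  functions and to continuous functions of polynomial growth.\<close>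

lemma regular_inj_AE:
  assumes "u \<in> borel_measurable borel" "v \<in> borel_measurable borel"
    and "\<And>R. integrable lborel (\<lambda>x. indicator (cball 0 R) x * cmod (u x - v x))"
    and "\<And>\<phi>. \<phi> \<in> schwartz \<Longrightarrow> integrable lborel (\<lambda>x. u x * \<phi> x)"
    and "\<And>\<phi>. \<phi> \<in> schwartz \<Longrightarrow> integrable lborel (\<lambda>x. v x * \<phi> x)"
    and eq: "regular u = regular v"
  shows "AE x in lborel. u x = v x"
proof -
  have "AE x in lborel. u x - v x = 0"
  proof (rule AE_zero_if_orthogonal_schwartz)
    show "(\<lambda>x. u x - v x) \<in> borel_measurable borel"
      using assms(1,2) by simp
    fix \<phi> assume \<phi>: "\<phi> \<in> schwartz"
    have "regular u \<phi> = regular v \<phi>" using eq by simp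
    then show "(LINT x|lborel. (u x - v x) * \<phi> x) = 0"
      using assms(4,5)[OF \<phi>] by (simp add: regular_apply[OF \<phi>] left_diff_distrib)
  qed (rule assms(3))
  then show ?thesis by simp
qed

lemma regular_inj_L3:
  assumes u: "u \<in> L3" and v: "v \<in> L3" and eq: "regular u = regular v"
  shows "AE x in lborel. u x = v x"
  by (rule regular_inj_AE)
    (intro L3_measurable L3_locally_integrable L3_diff L3_times_schwartz_integrable u v eq | assumption)+

text \<open>The definite description is resolved by uniqueness almost everywhere of the
  representative.\<close>

lemma Lp_norm_regular: assumes u: "u \<in> L3" shows "Lp_norm 3 (regular u) = L3_norm u"
  unfolding Lp_norm_def
proof (rule the_equality)
  show "\<exists>v\<in>L3. regular u = regular v \<and> L3_norm u = (LINT x|lborel. cmod (v x) powr 3) powr (1 / 3)"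
    using u by (auto simp: L3_norm_def)
  fix r assume "\<exists>v\<in>L3. regular u = regular v \<and> r = (LINT x|lborel. cmod (v x) powr 3) powr (1 / 3)"
  then obtain v where v: "v \<in> L3" "regular u = regular v" "r = L3_norm v"
    by (auto simp: L3_norm_def)
  then show "r = L3_norm u"
    using L3_norm_cong_AE[OF u v(1) regular_inj_L3[OF u v(1,2)]] by simp
qed

end

section \<open>Topologies given by seminorms\<close>

lemma seminorm_topology_subbasis:
  "x \<in> V \<Longrightarrow> p \<in> P \<Longrightarrow> 0 < r \<Longrightarrow> openin (seminorm_topology V P) {y \<in> V. p (y - x) < r}"
  unfolding seminorm_topology_def by (rule topology_generated_by_Basis) blast

lemma openin_seminorm_topologyI:
  assumes "U \<subseteq> V" and "\<And>p. p \<in> P \<Longrightarrow> p 0 = 0"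
    and "\<And>x. x \<in> U \<Longrightarrow> \<exists>p\<in>P. \<exists>r>0. \<forall>y\<in>V. p (y - x) < r \<longrightarrow> y \<in> U"
  shows "openin (seminorm_topology V P) U"
proof (subst openin_subopen, rule ballI)
  fix x assume x: "x \<in> U"
  then obtain p r where pr: "p \<in> P" "r > 0" "\<forall>y\<in>V. p (y - x) < r \<longrightarrow> y \<in> U" using assms(3) by blast
  have "x \<in> V" using x assms(1) by blast
  then have "openin (seminorm_topology V P) {y \<in> V. p (y - x) < r}" "x \<in> {y \<in> V. p (y - x) < r}" "{y \<in> V. p (y - x) < r} \<subseteq> U"
    using pr assms(2)[OF pr(1)] by (auto intro!: seminorm_topology_subbasis)
  then show "\<exists>T. openin (seminorm_topology V P) T \<and> x \<in> T \<and> T \<subseteq> U" by blast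
qed

lemma topspace_seminorm_topology:
  assumes "P \<noteq> {}" "\<And>p. p \<in> P \<Longrightarrow> p 0 = 0"
  shows "topspace (seminorm_topology V P) = V"
proof
  show "topspace (seminorm_topology V P) \<subseteq> V"
    unfolding seminorm_topology_def topology_generated_by_topspace by blast
  have "openin (seminorm_topology V P) V"
    by (rule openin_seminorm_topologyI) (use assms in \<open>auto intro: exI[of _ "1::real"]\<close>)
  then show "V \<subseteq> topspace (seminorm_topology V P)" by (rule openin_subset)
qed

text \<open>Restricted to differences of points of \<open>V\<close>: \<open>Lp_norm\<close> is a
  definite description and carries no information outside its space.\<close>

definition seminorm_triangle :: "('a \<Rightarrow> complex) set \<Rightarrow> (('a \<Rightarrow> complex) \<Rightarrow> real) set \<Rightarrow> bool" where
  "seminorm_triangle V P \<longleftrightarrow> (\<forall>p\<in>P. \<forall>x\<in>V. \<forall>y\<in>V. \<forall>z\<in>V. p (y - z) \<le> p (y - x) + p (x - z))"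

text \<open>Subbasic balls may have any centre in \<open>V\<close>; the triangle inequality
  recentres them at \<open>x\<close>. A finite intersection is handled by joining the seminorm sets
  and taking the smaller radius.\<close>

lemma openin_seminorm_topologyD:
  assumes tri: "seminorm_triangle V P" and U: "openin (seminorm_topology V P) U" and x: "x \<in> U"
  shows "\<exists>F r. finite F \<and> F \<subseteq> P \<and> 0 < r \<and> {y \<in> V. \<forall>p\<in>F. p (y - x) < r} \<subseteq> U"
proof -
  let ?B = "{{y \<in> V. p (y - x) < r} | x p r. x \<in> V \<and> p \<in> P \<and> 0 < r}"
  have "generate_topology_on ?B U"
    using U unfolding seminorm_topology_def openin_topology_generated_by_iff .
  then show ?thesis
    using x
  proof (induction arbitrary: x rule: generate_topology_on.induct)
    case Empty
    then show ?case by simp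
  next
    case (Int a b)
    obtain F r G s where F: "finite F" "F \<subseteq> P" "0 < r" "{y \<in> V. \<forall>p\<in>F. p (y - x) < r} \<subseteq> a"
      and G: "finite G" "G \<subseteq> P" "0 < s" "{y \<in> V. \<forall>p\<in>G. p (y - x) < s} \<subseteq> b"
      using Int.IH(1)[of x] Int.IH(2)[of x] Int.prems by blast
    have "{y \<in> V. \<forall>p\<in>F \<union> G. p (y - x) < min r s} \<subseteq> {y \<in> V. \<forall>p\<in>F. p (y - x) < r} \<inter> {y \<in> V. \<forall>p\<in>G. p (y - x) < s}"
      by auto
    also have "\<dots> \<subseteq> a \<inter> b" using F(4) G(4) by blast
    finally show ?case
      using F(1-3) G(1-3) by (intro exI[of _ "F \<union> G"] exI[of _ "min r s"] conjI) (simp_all only: finite_Un Un_subset_iff min_less_iff_conj simp_thms)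
  next
    case (UN K)
    from UN.prems obtain k where k: "k \<in> K" "x \<in> k" by (rule UnionE)
    from UN.IH[OF k] obtain F r where F: "finite F" "F \<subseteq> P" "0 < r" "{y \<in> V. \<forall>p\<in>F. p (y - x) < r} \<subseteq> k"
      by (elim exE conjE)
    from F(4) Union_upper[OF k(1)] have "{y \<in> V. \<forall>p\<in>F. p (y - x) < r} \<subseteq> \<Union> K"
      by (rule subset_trans)
    with F(1-3) show ?case by (intro exI conjI)
  next
    case (Basis s)
    then obtain z p r where s: "s = {y \<in> V. p (y - z) < r}" "z \<in> V" "p \<in> P" "0 < r" by blast
    have x: "x \<in> V" "p (x - z) < r" using Basis.prems s by auto
    have "{y \<in> V. \<forall>q\<in>{p}. q (y - x) < r - p (x - z)} \<subseteq> s"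
    proof
      fix y assume "y \<in> {y \<in> V. \<forall>q\<in>{p}. q (y - x) < r - p (x - z)}"
      then have y: "y \<in> V" "p (y - x) < r - p (x - z)" by auto
      have "p (y - z) \<le> p (y - x) + p (x - z)"
        using tri x y s unfolding seminorm_triangle_def by blast
      then show "y \<in> s" using y s by simp
    qed
    moreover have "finite {p}" "{p} \<subseteq> P" "0 < r - p (x - z)" using s x by simp_all
    ultimately show ?case
      by (intro exI conjI)
  qed
qed

text \<open>It suffices to pull back subbasic balls, and for these a Lipschitz bound by one seminorm
  of the source, together with the triangle inequality in the target, gives a ball inside the
  preimage.\<close>

lemma continuous_map_seminorm_topology:
  assumes P: "P \<noteq> {}" "\<And>p. p \<in> P \<Longrightarrow> p 0 = 0" and f: "f ` V \<subseteq> W" and Q: "Q \<noteq> {}" "\<And>q. q \<in> Q \<Longrightarrow> q 0 = 0"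
    and tri: "seminorm_triangle W Q"
    and b: "\<And>q. q \<in> Q \<Longrightarrow> \<exists>p\<in>P. \<exists>C>0. \<forall>x\<in>V. \<forall>y\<in>V. q (f y - f x) \<le> C * p (y - x)"
  shows "continuous_map (seminorm_topology V P) (seminorm_topology W Q) f"
proof -
  have tV: "topspace (seminorm_topology V P) = V"
    using P by (intro topspace_seminorm_topology) auto
  show ?thesis
    unfolding seminorm_topology_def[of W Q]
  proof (rule continuous_on_generated_topo)
    let ?B = "{{y \<in> W. q (y - x) < r} | x q r. x \<in> W \<and> q \<in> Q \<and> 0 < r}"
    show "f ` topspace (seminorm_topology V P) \<subseteq> \<Union> ?B"
    proof -
      obtain q where q: "q \<in> Q" using Q by blast
      have "w \<in> \<Union> ?B" if "w \<in> W" for w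
      proof (rule UnionI)
        show "{y \<in> W. q (y - w) < 1} \<in> ?B"
          using that q by (intro CollectI exI[of _ w] exI[of _ q] exI[of _ "1::real"]) simp
        show "w \<in> {y \<in> W. q (y - w) < 1}"
          using that Q(2)[OF q] by simp
      qed
      then have "W \<subseteq> \<Union> ?B" by (rule subsetI)
      then show ?thesis using f unfolding tV by (rule subset_trans[rotated])
    qed
    fix U assume "U \<in> ?B"
    then obtain w q r where U: "U = {y \<in> W. q (y - w) < r}" "w \<in> W" "q \<in> Q" "0 < r"
      by (elim CollectE exE conjE)
    obtain p C where pC: "p \<in> P" "C > 0" "\<And>x y. x \<in> V \<Longrightarrow> y \<in> V \<Longrightarrow> q (f y - f x) \<le> C * p (y - x)"
      using b[OF U(3)] by blast
    show "openin (seminorm_topology V P) (f -` U \<inter> topspace (seminorm_topology V P))"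
      unfolding tV
    proof (rule openin_seminorm_topologyI)
      fix x assume "x \<in> f -` U \<inter> V"
      then have x: "x \<in> V" "f x \<in> W" "q (f x - w) < r" using U by auto
      define s where "s = (r - q (f x - w)) / C"
      have "s > 0" using x pC by (simp add: s_def)
      moreover have "y \<in> f -` U \<inter> V" if y: "y \<in> V" "p (y - x) < s" for y
      proof -
        have "q (f y - f x) < r - q (f x - w)"
          using pC(3)[OF x(1) y(1)] y(2) pC(2) by (simp add: s_def field_simps)
        moreover have "f y \<in> W" using f y by blast
        moreover have "q (f y - w) \<le> q (f y - f x) + q (f x - w)"
          using tri U x \<open>f y \<in> W\<close> unfolding seminorm_triangle_def by blast
        ultimately show ?thesis using U y by simp
      qed
      ultimately show "\<exists>p\<in>P. \<exists>r>0. \<forall>y\<in>V. p (y - x) < r \<longrightarrow> y \<in> f -` U \<inter> V"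
        using pC(1) by blast
    qed (use P(2) in auto)
  qed
qed

lemma continuous_map_seminorm_topology_euclidean:
  fixes f :: "('a \<Rightarrow> complex) \<Rightarrow> complex"
  assumes P: "p \<in> P" "\<And>p. p \<in> P \<Longrightarrow> p 0 = 0"
    and b: "C > 0" "\<And>x y. x \<in> V \<Longrightarrow> y \<in> V \<Longrightarrow> cmod (f y - f x) \<le> C * p (y - x)"
  shows "continuous_map (seminorm_topology V P) euclidean f"
proof -
  have tV: "topspace (seminorm_topology V P) = V"
    using P by (intro topspace_seminorm_topology) auto
  show ?thesis
    unfolding continuous_map_def tV
  proof (intro conjI allI impI)
    fix U :: "complex set" assume "openin euclidean U"
    then have U: "open U" by simp
    show "openin (seminorm_topology V P) {x \<in> V. f x \<in> U}"
    proof (rule openin_seminorm_topologyI)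
      fix x assume "x \<in> {x \<in> V. f x \<in> U}"
      then obtain e where e: "e > 0" "\<And>z. dist z (f x) < e \<Longrightarrow> z \<in> U" and x: "x \<in> V"
        using U unfolding open_dist by blast
      have "y \<in> {x \<in> V. f x \<in> U}" if "y \<in> V" "p (y - x) < e / C" for y
        using b(2)[OF x that(1)] that b(1) by (auto intro!: e(2) simp: dist_norm field_simps)
      then show "\<exists>p\<in>P. \<exists>r>0. \<forall>y\<in>V. p (y - x) < r \<longrightarrow> y \<in> {x \<in> V. f x \<in> U}"
        using e(1) b(1) P(1) by (intro bexI[of _ p] exI[of _ "e / C"]) auto
    qed (use P(2) in auto)
  qed simp
qed

lemma schwartz_seminorm_zero: "schwartz_seminorm k is 0 = 0"
proof -
  have "partials is (\<lambda>x. 0) = (\<lambda>x. 0)"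
    by (induction "is") (simp_all add: partial_zero)
  then show ?thesis
    by (simp add: schwartz_seminorm_def zero_fun_def)
qed

lemma schwartz_minus: "f \<in> schwartz \<Longrightarrow> g \<in> schwartz \<Longrightarrow> f - g \<in> schwartz"
  using schwartz_diff_fun by (simp add: fun_diff_def)

lemma schwartz_plus: "f \<in> schwartz \<Longrightarrow> g \<in> schwartz \<Longrightarrow> f + g \<in> schwartz"
  using schwartz_add_fun by (simp add: plus_fun_def)

text \<open>With S the seminorm of order 6 and C the weight constant, \<open>f\<close> has sup norm
  at most S and L^1 norm at most S C. \<open>L3_pairing\<close> then bounds the cube of the pairing
  by C^2 S^3 ||u||^3, and C >= 1 permits the cube root.\<close>

lemma L3_pairing_le_seminorm:
  assumes u: "u \<in> L3" and f: "f \<in> schwartz"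
  shows "cmod (LINT x|lborel. u x * f x) \<le> weight_const * L3_norm u * schwartz_seminorm 6 [] f"
proof -
  let ?S = "schwartz_seminorm 6 [] f" and ?C = weight_const
  have S0: "?S \<ge> 0" by (rule schwartz_seminorm_nonneg[OF f])
  have C1: "?C \<ge> 1" by (rule weight_const_ge)
  have b: "cmod (f x) \<le> ?S" for x
    using order_trans[OF schwartz_le_weight[OF f] mult_left_le[OF weight_bounds(2) S0]] .
  have "(LINT x|lborel. cmod (f x)) \<le> (LINT x|lborel. ?S * weight x)"
    by (intro schwartz_le_weight integral_mono integrable_norm schwartz_integrable f integrable_mult_right integrable_weight)
  also have "\<dots> \<le> ?S * ?C"
    using S0 weight_const_ge(2) by (simp add: mult_left_mono)
  finally have f1: "(LINT x|lborel. cmod (f x)) \<le> ?S * ?C" .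
  have "cmod (LINT x|lborel. u x * f x) ^ 3 \<le> (LINT x|lborel. cmod (f x))\<^sup>2 * ?S * L3_norm u ^ 3"
    by (rule L3_pairing(4)[OF u schwartz_integrable[OF f] b])
  also have "\<dots> \<le> (?S * ?C)\<^sup>2 * ?S * L3_norm u ^ 3"
    using f1 S0 by (intro mult_right_mono power_mono) auto
  also have "\<dots> = ?C\<^sup>2 * (?S * L3_norm u) ^ 3"
    by (simp add: power2_eq_square power3_eq_cube)
  also have "\<dots> \<le> ?C ^ 3 * (?S * L3_norm u) ^ 3"
    using S0 C1 by (intro mult_right_mono power_increasing) auto
  also have "\<dots> = (?C * L3_norm u * ?S) ^ 3"
    by (simp only: power_mult_distrib mult_ac)
  finally show ?thesis
    using C1 S0 by (subst (asm) power_mono_iff) auto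
qed

lemma regular_tempered:
  assumes u: "u \<in> L3" shows "regular u \<in> tempered"
proof -
  have "clinear_on schwartz (regular u)"
    unfolding clinear_on_def
    by (auto simp: regular_apply schwartz_plus schwartz_cmult distrib_left mult.left_commute L3_times_schwartz_integrable u)
  moreover have "continuous_map schwartz_topology euclidean (regular u)"
    unfolding schwartz_topology_def
  proof (rule continuous_map_seminorm_topology_euclidean[where p = "schwartz_seminorm 6 []" and C = "weight_const * L3_norm u + 1"])
    show "schwartz_seminorm 6 [] \<in> {schwartz_seminorm k is |k is. True}" by blast
    show "p 0 = 0" if "p \<in> {schwartz_seminorm k is |k is. True}" for p
      using that schwartz_seminorm_zero by auto
    \<comment> \<open>The summand 1 is there because the continuity criterion asks for a strictly
      positive constant, while the norm of \<open>u\<close> may be 0.\<close>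
    show "0 < weight_const * L3_norm u + 1" using weight_const_ge by (intro add_nonneg_pos) auto
    fix f g assume f: "f \<in> schwartz" and g: "g \<in> schwartz"
    have d: "g - f \<in> schwartz" using f g by (intro schwartz_minus)
    have "regular u g - regular u f = (LINT x|lborel. u x * (g - f) x)"
      using f g by (simp add: regular_apply right_diff_distrib L3_times_schwartz_integrable u)
    also have "cmod \<dots> \<le> weight_const * L3_norm u * schwartz_seminorm 6 [] (g - f)"
      by (rule L3_pairing_le_seminorm[OF u d])
    also have "\<dots> \<le> (weight_const * L3_norm u + 1) * schwartz_seminorm 6 [] (g - f)"
      using schwartz_seminorm_nonneg[OF d] by (intro mult_right_mono) auto
    finally show "cmod (regular u g - regular u f) \<le> (weight_const * L3_norm u + 1) * schwartz_seminorm 6 [] (g - f)" .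
  qed
  moreover have "on_schwartz (regular u) = regular u"
    by (rule ext) (simp add: regular_def on_schwartz_def)
  ultimately show ?thesis unfolding tempered_def by (intro CollectI conjI)
qed

lemma Lp_space_cases:
  assumes "T \<in> Lp_space 3" obtains u where "u \<in> L3" "T = regular u"
  using assms unfolding Lp_space_def by blast

lemma regular_Lp_space: "u \<in> L3 \<Longrightarrow> regular u \<in> Lp_space 3"
  by (simp add: Lp_space_def)

lemma Lp_space_minus:
  assumes "S \<in> Lp_space 3" "T \<in> Lp_space 3" shows "S - T \<in> Lp_space 3"
proof -
  obtain u v where u: "u \<in> L3" "S = regular u" and v: "v \<in> L3" "T = regular v"
    using assms by (elim Lp_space_cases)
  then show ?thesis
    using regular_Lp_space[OF L3_diff(1)[OF u(1) v(1)]] by (simp only: regular_diff)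
qed

lemma seminorm_triangle_tempered: "seminorm_triangle V {\<lambda>T. cmod (T \<phi>) | \<phi>. \<phi> \<in> schwartz}"
proof -
  have "cmod (y \<phi> - z \<phi>) \<le> cmod (y \<phi> - x \<phi>) + cmod (x \<phi> - z \<phi>)" for x y z :: dist and \<phi>
    using norm_triangle_ineq[of "y \<phi> - x \<phi>" "x \<phi> - z \<phi>"] by simp
  then show ?thesis
    by (auto simp: seminorm_triangle_def)
qed

text \<open>A neighbourhood of \<open>T\<close> contains one defined by finitely many test
  functions, so convergence on each test function is enough.\<close>

lemma tempered_limitinI:
  assumes T: "T \<in> tempered" and X: "\<And>j. X j \<in> tempered"
    and lim: "\<And>\<phi>. \<phi> \<in> schwartz \<Longrightarrow> ((\<lambda>j. X j \<phi>) \<longlongrightarrow> T \<phi>) F"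
  shows "limitin tempered_topology X T F"
  unfolding limitin_def
proof (intro conjI allI impI)
  let ?P = "{\<lambda>T. cmod (T \<phi>) | \<phi>. \<phi> \<in> schwartz}"
  have "topspace tempered_topology = tempered"
    unfolding tempered_topology_def using schwartz_0 by (intro topspace_seminorm_topology) auto
  then show "T \<in> topspace tempered_topology" using T by simp
  fix U assume U: "openin tempered_topology U \<and> T \<in> U"
  then obtain Q r where Q: "finite Q" "Q \<subseteq> ?P" "0 < r" "{y \<in> tempered. \<forall>p\<in>Q. p (y - T) < r} \<subseteq> U"
    using openin_seminorm_topologyD[OF seminorm_triangle_tempered, of tempered U T]
    unfolding tempered_topology_def by (elim conjE) (drule (1) meta_mp, blast)
  have "\<forall>\<^sub>F j in F. p (X j - T) < r" if p: "p \<in> Q" for p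
  proof -
    from p Q(2) obtain \<phi> where \<phi>: "p = (\<lambda>T. cmod (T \<phi>))" "\<phi> \<in> schwartz" by blast
    have "((\<lambda>j. cmod (X j \<phi> - T \<phi>)) \<longlongrightarrow> cmod (T \<phi> - T \<phi>)) F"
      by (intro tendsto_intros lim \<phi>)
    then have "\<forall>\<^sub>F j in F. cmod (X j \<phi> - T \<phi>) < r"
      by (rule order_tendstoD) (use Q(3) in simp)
    then show ?thesis by (simp add: \<phi>)
  qed
  then have "\<forall>\<^sub>F j in F. \<forall>p\<in>Q. p (X j - T) < r"
    using Q(1) by (simp add: eventually_ball_finite_distrib)
  then show "\<forall>\<^sub>F j in F. X j \<in> U"
    by eventually_elim (use Q(4) X in blast)
qed

section \<open>L^3 as an invariant Banach space of distributions\<close>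

context lp_cutoff
begin

lemma Lp_norm_zero: "Lp_norm 3 0 = 0"
  using Lp_norm_regular[OF zero_L3] L3_norm_eqI[of 0 "\<lambda>x. 0"] by (simp add: regular_zero)

lemma seminorm_triangle_Lp: "seminorm_triangle (Lp_space 3) {Lp_norm 3}"
  unfolding seminorm_triangle_def
proof safe
  fix x y z assume "x \<in> Lp_space 3" "y \<in> Lp_space 3" "z \<in> Lp_space 3"
  then obtain u v w where L: "u \<in> L3" "v \<in> L3" "w \<in> L3" and eq: "x = regular u" "y = regular v" "z = regular w"
    by (meson Lp_space_cases)
  have "L3_norm (\<lambda>x. v x - w x) \<le> L3_norm (\<lambda>x. v x - u x) + L3_norm (\<lambda>x. u x - w x)"
    using L3_add(2)[OF L3_diff(1)[OF L(2,1)] L3_diff(1)[OF L(1,3)]] by simp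
  then show "Lp_norm 3 (y - z) \<le> Lp_norm 3 (y - x) + Lp_norm 3 (x - z)"
    using L by (simp only: eq regular_diff[symmetric] Lp_norm_regular L3_diff)
qed

lemma complex_banach_Lp: "complex_banach (Lp_space 3) (Lp_norm 3)"
  unfolding complex_banach_def
proof (intro conjI ballI allI impI)
  have m: "module (\<lambda>(c::complex) (f::func \<Rightarrow> complex) x. c * f x)"
    using vector_space_cfun module_iff_vector_space by blast
  show "module.subspace (\<lambda>c f x. c * f x) (Lp_space 3)"
    unfolding module.subspace_def[OF m]
  proof (intro conjI ballI allI)
    show "0 \<in> Lp_space 3" using regular_Lp_space[OF zero_L3] by (simp add: regular_zero)
    fix S T c assume ST: "S \<in> Lp_space 3"
    then obtain u where u: "u \<in> L3" "S = regular u" by (rule Lp_space_cases)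
    show "(\<lambda>\<phi>. c * S \<phi>) \<in> Lp_space 3"
      using regular_Lp_space[OF L3_cmult(1)[OF u(1), of c]] by (simp only: u(2) regular_cmult)
    assume "T \<in> Lp_space 3"
    then obtain v where v: "v \<in> L3" "T = regular v" by (rule Lp_space_cases)
    show "S + T \<in> Lp_space 3"
      using regular_Lp_space[OF L3_add(1)[OF u(1) v(1)]] by (simp only: u(2) v(2) regular_add[OF u(1) v(1)])
  qed
next
  fix S assume "S \<in> Lp_space 3"
  then obtain u where u: "u \<in> L3" and S: "S = regular u" by (rule Lp_space_cases)
  note [measurable] = L3_measurable[OF u]
  show "0 \<le> Lp_norm 3 S" by (simp add: S Lp_norm_regular u)
  show "Lp_norm 3 S = 0 \<longleftrightarrow> S = 0"
  proof
    assume "Lp_norm 3 S = 0"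
    then have "(LINT x|lborel. cmod (u x) ^ 3) = 0"
      using L3_norm_cubed[of u] by (simp add: S Lp_norm_regular u)
    then have "AE x in lborel. cmod (u x) ^ 3 = 0"
      by (subst (asm) integral_nonneg_eq_0_iff_AE[OF L3_integrable[OF u]]) auto
    then have "AE x in lborel. u x = 0" by simp
    then have "regular u = regular (\<lambda>x. 0)"
      by (rule regular_cong_AE) auto
    then show "S = 0" by (simp add: S regular_zero)
  qed (simp add: Lp_norm_zero)
  show "Lp_norm 3 (\<lambda>\<phi>. c * S \<phi>) = cmod c * Lp_norm 3 S" for c
    unfolding S regular_cmult[symmetric] using u by (simp add: Lp_norm_regular L3_cmult)
  fix T assume "T \<in> Lp_space 3"
  then obtain v where v: "v \<in> L3" and T: "T = regular v" by (rule Lp_space_cases)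
  show "Lp_norm 3 (S + T) \<le> Lp_norm 3 S + Lp_norm 3 T"
    unfolding S T regular_add[OF u v, symmetric] using u v L3_add by (simp add: Lp_norm_regular)
next
  fix X :: "nat \<Rightarrow> dist" assume X: "(\<forall>n. X n \<in> Lp_space 3) \<and> (\<forall>e>0. \<exists>M. \<forall>m\<ge>M. \<forall>n\<ge>M. Lp_norm 3 (X m - X n) < e)"
  then have "\<forall>n. \<exists>u. u \<in> L3 \<and> X n = regular u" by (meson Lp_space_cases)
  then obtain U where U: "\<And>n. U n \<in> L3" "\<And>n. X n = regular (U n)" by metis
  have eq: "Lp_norm 3 (X m - regular v) = L3_norm (\<lambda>x. U m x - v x)" if "v \<in> L3" for m v
    using that U by (simp only: U regular_diff[symmetric] Lp_norm_regular L3_diff)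
  obtain u where u: "u \<in> L3" "(\<lambda>n. L3_norm (\<lambda>x. U n x - u x)) \<longlonglongrightarrow> 0"
  proof (rule L3_complete[OF U(1)])
    fix e :: real assume "e > 0"
    then have "\<exists>M. \<forall>m\<ge>M. \<forall>n\<ge>M. Lp_norm 3 (X m - X n) < e" using X by blast
    then show "\<exists>M. \<forall>m\<ge>M. \<forall>n\<ge>M. L3_norm (\<lambda>x. U m x - U n x) < e"
      using eq[OF U(1)] by (simp only: U(2)[symmetric])
  qed blast
  show "\<exists>T\<in>Lp_space 3. (\<lambda>n. Lp_norm 3 (X n - T)) \<longlonglongrightarrow> 0"
    using u by (intro bexI[of _ "regular u"] regular_Lp_space) (simp_all only: eq)
qed

lemma continuous_regular_Lp: "continuous_map schwartz_topology (seminorm_topology (Lp_space 3) {Lp_norm 3}) regular"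
  unfolding schwartz_topology_def
proof (rule continuous_map_seminorm_topology)
  fix q assume q: "q \<in> {Lp_norm 3}"
  have "q (regular g - regular f) \<le> weight_const * schwartz_seminorm 6 [] (g - f)" if f: "f \<in> schwartz" and g: "g \<in> schwartz" for f g
  proof -
    have "q (regular g - regular f) = L3_norm (\<lambda>x. g x - f x)"
      using q f g by (simp add: regular_diff[symmetric] schwartz_L3 Lp_norm_regular L3_diff)
    also have "\<dots> = L3_norm (g - f)" by (simp add: fun_diff_def)
    also have "\<dots> \<le> weight_const * schwartz_seminorm 6 [] (g - f)"
      by (intro L3_norm_le_seminorm schwartz_minus f g)
    finally show ?thesis .
  qed
  then show "\<exists>p\<in>{schwartz_seminorm k is |k is. True}. \<exists>C>0. \<forall>x\<in>schwartz. \<forall>y\<in>schwartz. q (regular y - regular x) \<le> C * p (y - x)"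
    using weight_const_ge(1) by (intro bexI[of _ "schwartz_seminorm 6 []"] exI[of _ weight_const]) auto
qed (auto simp: schwartz_seminorm_zero Lp_norm_zero seminorm_triangle_Lp intro!: regular_Lp_space schwartz_L3)

lemma continuous_Lp_tempered: "continuous_map (seminorm_topology (Lp_space 3) {Lp_norm 3}) tempered_topology (\<lambda>T. T)"
  unfolding tempered_topology_def
proof (rule continuous_map_seminorm_topology)
  fix q assume "q \<in> {\<lambda>T. cmod (T \<phi>) | \<phi>. \<phi> \<in> schwartz}"
  then obtain \<phi> where q: "q = (\<lambda>T. cmod (T \<phi>))" and \<phi>: "\<phi> \<in> schwartz" by blast
  define D where "D = weight_const * schwartz_seminorm 6 [] \<phi> + 1"
  have D: "D > 0"
    unfolding D_def using weight_const_ge(1) schwartz_seminorm_nonneg[OF \<phi>] by (intro add_nonneg_pos) auto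
  have "q (T - S) \<le> D * Lp_norm 3 (T - S)" if S: "S \<in> Lp_space 3" and T: "T \<in> Lp_space 3" for S T
  proof -
    obtain w where w: "w \<in> L3" "T - S = regular w"
      using Lp_space_minus[OF T S] by (rule Lp_space_cases)
    have "q (T - S) = cmod (LINT x|lborel. w x * \<phi> x)"
      unfolding w q regular_apply[OF \<phi>] ..
    also have "\<dots> \<le> weight_const * L3_norm w * schwartz_seminorm 6 [] \<phi>"
      by (rule L3_pairing_le_seminorm[OF w(1) \<phi>])
    also have "\<dots> \<le> D * L3_norm w"
      using L3_norm_nonneg[of w] by (simp add: D_def algebra_simps)
    finally show ?thesis unfolding w Lp_norm_regular[OF w(1)] .
  qed
  then show "\<exists>p\<in>{Lp_norm 3}. \<exists>C>0. \<forall>x\<in>Lp_space 3. \<forall>y\<in>Lp_space 3. q (y - x) \<le> C * p (y - x)"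
    using D by blast
next
  show "(\<lambda>T. T) ` Lp_space 3 \<subseteq> tempered"
    using regular_tempered by (auto elim!: Lp_space_cases)
  show "seminorm_triangle tempered {\<lambda>T. cmod (T \<phi>) | \<phi>. \<phi> \<in> schwartz}"
    by (rule seminorm_triangle_tempered)
qed (use schwartz_0 Lp_norm_zero in auto)

lemma schwartz_dense_Lp: "seminorm_topology (Lp_space 3) {Lp_norm 3} closure_of (regular ` schwartz) = Lp_space 3"
proof (rule set_eqI)
  fix T
  have ts: "topspace (seminorm_topology (Lp_space 3) {Lp_norm 3}) = Lp_space 3"
    by (rule topspace_seminorm_topology) (auto simp: Lp_norm_zero)
  show "T \<in> seminorm_topology (Lp_space 3) {Lp_norm 3} closure_of (regular ` schwartz) \<longleftrightarrow> T \<in> Lp_space 3"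
  proof
    assume T: "T \<in> Lp_space 3"
    then obtain u where u: "u \<in> L3" "T = regular u" by (rule Lp_space_cases)
    have "\<exists>y\<in>regular ` schwartz. y \<in> U" if U: "openin (seminorm_topology (Lp_space 3) {Lp_norm 3}) U" "T \<in> U" for U
    proof -
      obtain F r where F: "F \<subseteq> {Lp_norm 3}" "0 < r" "{y \<in> Lp_space 3. \<forall>p\<in>F. p (y - T) < r} \<subseteq> U"
        using openin_seminorm_topologyD[OF seminorm_triangle_Lp U] by blast
      obtain \<phi> where \<phi>: "\<phi> \<in> schwartz" "L3_norm (\<lambda>x. u x - \<phi> x) < r"
        using schwartz_dense_L3[OF u(1) F(2)] by blast
      have "Lp_norm 3 (regular \<phi> - T) < r"
        using \<phi> u by (simp add: regular_diff[symmetric] Lp_norm_regular L3_diff schwartz_L3 L3_norm_minus_commute[of \<phi>])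
      then have "regular \<phi> \<in> {y \<in> Lp_space 3. \<forall>p\<in>F. p (y - T) < r}"
        using F(1) \<phi>(1) by (auto intro: regular_Lp_space schwartz_L3)
      then show ?thesis using F(3) \<phi>(1) by blast
    qed
    then show "T \<in> seminorm_topology (Lp_space 3) {Lp_norm 3} closure_of (regular ` schwartz)"
      unfolding in_closure_of ts using T by blast
  qed (use ts in \<open>auto simp: in_closure_of\<close>)
qed

text \<open>The exponent equals the dimension: the factor r^3 from cubing r u(r x - x0) cancels the
  Jacobian r^{-3}.\<close>

lemma Lp_rescale:
  assumes T: "T \<in> Lp_space 3" and r: "r > 0"
  shows "dist_rescale r x0 T \<in> Lp_space 3" "Lp_norm 3 (dist_rescale r x0 T) = Lp_norm 3 T"
proof -
  obtain u where u: "u \<in> L3" "T = regular u" using T by (rule Lp_space_cases)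
  note [measurable] = L3_measurable[OF u(1)]
  define v where "v x = of_real r * u (r *\<^sub>R x + (- x0))" for x
  have c: "cmod (v x) ^ 3 = r ^ 3 * (\<lambda>y. cmod (u y) ^ 3) (r *\<^sub>R x + (- x0))" for x
    using r by (simp add: v_def norm_mult power_mult_distrib)
  have vL: "v \<in> L3"
    unfolding L3_iff
  proof
    show "v \<in> borel_measurable borel" unfolding v_def[abs_def] by measurable
    show "integrable lborel (\<lambda>x. cmod (v x) ^ 3)"
      unfolding c using r by (intro integrable_mult_right integrable_affine[OF L3_integrable[OF u(1)]]) simp
  qed
  have vn: "L3_norm v = L3_norm u"
  proof (rule L3_norm_eqI)
    have "(LINT x|lborel. cmod (v x) ^ 3) = r ^ 3 * (LINT x|lborel. (\<lambda>y. cmod (u y) ^ 3) (r *\<^sub>R x + (- x0)))"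
      unfolding c by simp
    also have "(LINT x|lborel. (\<lambda>y. cmod (u y) ^ 3) (r *\<^sub>R x + (- x0))) = (1 / \<bar>r\<bar> ^ 3) *\<^sub>R (LINT y|lborel. cmod (u y) ^ 3)"
      using r by (intro integral_affine) auto
    finally show "(LINT x|lborel. cmod (v x) ^ 3) = L3_norm u ^ 3"
      using r by (simp add: L3_norm_cubed)
  qed simp
  have "dist_rescale r x0 T = regular v"
  proof
    fix \<phi>
    show "dist_rescale r x0 T \<phi> = regular v \<phi>"
    proof (cases "\<phi> \<in> schwartz")
      case True
      note [measurable] = schwartz_measurable[OF True]
      have "(\<lambda>y. \<phi> ((1 / r) *\<^sub>R y + (1 / r) *\<^sub>R x0)) \<in> schwartz"
        using r by (intro schwartz_rescale True) simp
      then have \<psi>: "(\<lambda>y. \<phi> ((1 / r) *\<^sub>R (y + x0))) \<in> schwartz"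
        by (simp add: scaleR_add_right)
      have "regular v \<phi> = (LINT x|lborel. of_real r * (\<lambda>y. u y * \<phi> ((1 / r) *\<^sub>R (y + x0))) (r *\<^sub>R x + (- x0)))"
        using r by (simp add: regular_apply[OF True] v_def mult.assoc)
      also have "\<dots> = of_real r * (LINT x|lborel. (\<lambda>y. u y * \<phi> ((1 / r) *\<^sub>R (y + x0))) (r *\<^sub>R x + (- x0)))"
        by (rule integral_mult_right_zero)
      also have "(LINT x|lborel. (\<lambda>y. u y * \<phi> ((1 / r) *\<^sub>R (y + x0))) (r *\<^sub>R x + (- x0)))
         = (1 / \<bar>r\<bar> ^ 3) *\<^sub>R (LINT y|lborel. u y * \<phi> ((1 / r) *\<^sub>R (y + x0)))"
        using r by (intro integral_affine) auto
      finally show ?thesis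
        using r by (simp add: dist_rescale_def on_schwartz_apply[OF True] u(2) regular_apply[OF \<psi>] scaleR_conv_of_real[where 'a=complex])
    qed (simp add: dist_rescale_def regular_outside)
  qed
  then show "dist_rescale r x0 T \<in> Lp_space 3" "Lp_norm 3 (dist_rescale r x0 T) = Lp_norm 3 T"
    using vL vn u by (simp_all add: regular_Lp_space Lp_norm_regular)
qed

end

section \<open>Littlewood-Paley operators on \<open>L\<^sup>3\<close>\<close>

lemma integral_reflect:
  fixes f :: "R3 \<Rightarrow> 'b :: {banach, second_countable_topology}"
  assumes "f \<in> borel_measurable borel"
  shows "(LINT x|lborel. f (- x)) = (LINT x|lborel. f x)"
  using integral_reflect_shift[OF assms, of 0] by simp

lemma fourier_multiplier_apply:
  assumes m: "m \<in> schwartz" and \<phi>: "\<phi> \<in> schwartz"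
  shows "fourier_multiplier m T \<phi> = T (fourier (\<lambda>\<xi>. m \<xi> * inv_fourier \<phi> \<xi>))"
  by (simp add: fourier_multiplier_def dist_inv_fourier_def dist_mult_def dist_fourier_def
      inv_fourier_schwartz schwartz_mult m \<phi>)

lemma fourier_multiplier_outside: "\<phi> \<notin> schwartz \<Longrightarrow> fourier_multiplier m T \<phi> = 0"
  by (simp add: fourier_multiplier_def dist_inv_fourier_def)

text \<open>The transpose of the multiplier acts on test functions as convolution with the reflected
  kernel, hence the argument y - x. The outer exponential is absorbed into the symbol as a
  modulation \<open>a\<close>, and the multiplication formula moves the inner transform onto
  \<open>a\<close>.\<close>

lemma fourier_mult_inv_fourier:
  assumes m: "m \<in> schwartz" and \<phi>: "\<phi> \<in> schwartz"
  shows "fourier (\<lambda>\<xi>. m \<xi> * inv_fourier \<phi> \<xi>) x = (LINT y|lborel. inv_fourier m (y - x) * \<phi> y)"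
proof -
  define c where "c = complex_of_real (1 / (2 * pi) ^ 3)"
  define a where "a \<xi> = echar (\<xi> \<bullet> x) * m \<xi>" for \<xi>
  note [measurable] = schwartz_measurable[OF m] schwartz_measurable[OF \<phi>] schwartz_measurable[OF fourier_schwartz[OF m]]
  have ia: "integrable lborel a"
    unfolding a_def by (intro integrable_exp_mult schwartz_integrable m)
  have "fourier (\<lambda>\<xi>. m \<xi> * inv_fourier \<phi> \<xi>) x = (LINT \<xi>|lborel. c * (a \<xi> * fourier (\<lambda>y. \<phi> (- y)) \<xi>))"
    unfolding fourier_def[of "\<lambda>\<xi>. m \<xi> * inv_fourier \<phi> \<xi>"]
    by (simp add: inv_fourier_eq c_def a_def mult_ac fourier_scale[of \<phi> "-1", simplified])
  also have "\<dots> = c * (LINT \<xi>|lborel. fourier a \<xi> * \<phi> (- \<xi>))"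
    using fourier_multiplication_formula[OF ia schwartz_integrable[OF schwartz_reflect[OF \<phi>]]] by simp
  also have "\<dots> = c * (LINT \<xi>|lborel. (\<lambda>y. fourier m (x - y) * \<phi> y) (- \<xi>))"
    by (simp add: a_def[abs_def] fourier_modulate add.commute)
  also have "\<dots> = c * (LINT y|lborel. fourier m (x - y) * \<phi> y)"
  proof -
    have "(\<lambda>y. fourier m (x - y) * \<phi> y) \<in> borel_measurable borel" by measurable
    from integral_reflect[OF this] show ?thesis by (rule arg_cong)
  qed
  finally show ?thesis
    by (simp add: inv_fourier_eq c_def mult.assoc)
qed

text \<open>Young's inequality for the convolution of the preceding lemma. Since all low-pass
  kernels have the same L^1 norm, it bounds frequency truncations uniformly in L^1.\<close>

lemma fourier_mult_inv_fourier_L1: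
  assumes m: "m \<in> schwartz" and \<phi>: "\<phi> \<in> schwartz"
  shows "(LINT x|lborel. cmod (fourier (\<lambda>\<xi>. m \<xi> * inv_fourier \<phi> \<xi>) x)) \<le>
    (LINT x|lborel. cmod (inv_fourier m x)) * (LINT x|lborel. cmod (\<phi> x))"
proof -
  let ?k = "inv_fourier m"
  have k: "?k \<in> schwartz" by (rule inv_fourier_schwartz[OF m])
  note [measurable] = schwartz_measurable[OF k] schwartz_measurable[OF \<phi>]
  note Y = Young_L1[OF integrable_norm[OF schwartz_integrable[OF schwartz_reflect[OF k]]] norm_ge_zero
    integrable_norm[OF schwartz_integrable[OF \<phi>]]]
  have i2: "integrable lborel (\<lambda>x. LINT y|lborel. cmod (?k (y - x) * \<phi> y))"
    using Y(2) by (simp add: norm_mult)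
  have v: "(LINT x|lborel. LINT y|lborel. cmod (?k (y - x) * \<phi> y)) = (LINT x|lborel. cmod (?k x)) * (LINT x|lborel. cmod (\<phi> x))"
    using Y(1) integral_reflect[of "\<lambda>x. cmod (?k x)"] by (simp add: norm_mult)
  have "(LINT x|lborel. cmod (fourier (\<lambda>\<xi>. m \<xi> * inv_fourier \<phi> \<xi>) x)) \<le> (LINT x|lborel. LINT y|lborel. cmod (?k (y - x) * \<phi> y))"
  proof (rule integral_mono[OF _ i2])
    show "integrable lborel (\<lambda>x. cmod (fourier (\<lambda>\<xi>. m \<xi> * inv_fourier \<phi> \<xi>) x))"
      by (intro integrable_norm schwartz_integrable fourier_schwartz schwartz_mult m inv_fourier_schwartz \<phi>)
    show "cmod (fourier (\<lambda>\<xi>. m \<xi> * inv_fourier \<phi> \<xi>) x) \<le> (LINT y|lborel. cmod (?k (y - x) * \<phi> y))" for x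
      unfolding fourier_mult_inv_fourier[OF m \<phi>] by (rule integral_norm_bound)
  qed
  then show ?thesis by (simp add: v)
qed

lemma L3_regular_fourier_diff:
  assumes "u \<in> L3" "f \<in> schwartz" "g \<in> schwartz"
  shows "regular u (fourier (\<lambda>\<xi>. f \<xi> - g \<xi>)) = regular u (fourier f) - regular u (fourier g)"
  using assms
  by (simp add: fourier_diff schwartz_integrable regular_apply schwartz_diff_fun fourier_schwartz right_diff_distrib
      L3_times_schwartz_integrable)

section \<open>Low-pass kernels and the operators S_j and Delta_j\<close>

context lp_cutoff
begin

definition kernel :: "int \<Rightarrow> func" where
  "kernel j = inv_fourier (low_pass j)"

lemma kernel_schwartz: "kernel j \<in> schwartz"
  unfolding kernel_def by (intro inv_fourier_schwartz low_pass_schwartz)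

lemma kernel_scale: "kernel j x = of_real ((2 powi j) ^ 3) * kernel 0 ((2 powi j) *\<^sub>R x)"
proof -
  have "fourier (low_pass j) = fourier (\<lambda>\<xi>. low_pass 0 ((2 powi (- j)) *\<^sub>R \<xi>))"
    by (intro arg_cong[where f = fourier] ext) (rule low_pass_scale)
  then show ?thesis
    by (simp add: kernel_def inv_fourier_eq fourier_scale schwartz_measurable low_pass_schwartz power_int_minus
       field_simps)
qed

definition kernel_L1 :: real where "kernel_L1 = (LINT x|lborel. cmod (kernel 0 x))"

lemma kernel_L1_nonneg: "kernel_L1 \<ge> 0"
  by (simp add: kernel_L1_def)

lemma kernel_integral: "(LINT x|lborel. cmod (kernel j x)) = kernel_L1"
proof -
  have "(LINT x|lborel. cmod (kernel j x)) = (2 powi j) ^ 3 * (LINT x|lborel. cmod (kernel 0 ((2 powi j) *\<^sub>R x + 0)))"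
    by (subst kernel_scale) (simp add: norm_mult norm_power norm_power_int)
  also have "(LINT x|lborel. cmod (kernel 0 ((2 powi j) *\<^sub>R x + 0))) = (1 / \<bar>2 powi j\<bar> ^ 3) *\<^sub>R kernel_L1"
    unfolding kernel_L1_def
    by (rule integral_affine) (use schwartz_measurable[OF kernel_schwartz] in auto)
  finally show ?thesis by simp
qed

lemma kernel_bound: "cmod (kernel j x) \<le> (2 powi j) ^ 3 * schwartz_seminorm 0 [] (kernel 0)"
  by (subst kernel_scale) (simp add: norm_mult norm_power norm_power_int schwartz_le_seminorm kernel_schwartz)

lemma conv_kernel_L3:
  assumes "u \<in> L3"
  shows "conv (kernel j) u \<in> L3" "L3_norm (conv (kernel j) u) \<le> kernel_L1 * L3_norm u"
    "continuous_on UNIV (conv (kernel j) u)"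
  using conv_L3[OF kernel_schwartz assms] conv_continuous[OF kernel_schwartz assms]
  by (simp_all add: kernel_integral)

text \<open>The summand 1 makes the constant at least 1, hence at most its own cube; this allows
  cube roots in \<open>conv_kernel_sup\<close>.\<close>

definition bernstein :: real where
  "bernstein = 1 + kernel_L1\<^sup>2 * schwartz_seminorm 0 [] (kernel 0)"

lemma bernstein_ge: "bernstein \<ge> 1"
  by (simp add: bernstein_def schwartz_seminorm_nonneg kernel_schwartz)

text \<open>Bernstein's inequality from L^3 to L^\<infinity>. The L^1 norm of the kernel does not
  depend on \<open>j\<close>, while its sup norm carries the factor 2^{3j}, whose cube root is
  2^j.\<close>

lemma conv_kernel_sup:
  assumes u: "u \<in> L3"
  shows "cmod (conv (kernel j) u x) \<le> bernstein * 2 powi j * L3_norm u"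
proof -
  let ?S = "schwartz_seminorm 0 [] (kernel 0)"
  have "cmod (conv (kernel j) u x) ^ 3 \<le> kernel_L1\<^sup>2 * ((2 powi j) ^ 3 * ?S) * L3_norm u ^ 3"
    using conv_sup_le(2)[OF kernel_schwartz u kernel_bound, of j x] by (simp add: kernel_integral)
  also have "\<dots> = (kernel_L1\<^sup>2 * ?S) * (2 powi j * L3_norm u) ^ 3"
    by (simp add: power_mult_distrib)
  also have "\<dots> \<le> bernstein ^ 3 * (2 powi j * L3_norm u) ^ 3"
    using power_increasing[OF _ bernstein_ge, of 1 3]
    by (intro mult_right_mono) (simp_all add: bernstein_def)
  also have "\<dots> = (bernstein * 2 powi j * L3_norm u) ^ 3"
    by (simp only: power_mult_distrib mult.assoc)
  finally show ?thesis
    using bernstein_ge by (subst (asm) power_mono_iff) auto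
qed

lemma low_pass_multiplier:
  assumes u: "u \<in> L3" and \<phi>: "\<phi> \<in> schwartz"
  shows "regular u (fourier (\<lambda>\<xi>. low_pass j \<xi> * inv_fourier \<phi> \<xi>)) = regular (conv (kernel j) u) \<phi>"
proof -
  have "regular u (fourier (\<lambda>\<xi>. low_pass j \<xi> * inv_fourier \<phi> \<xi>)) = (LINT y|lborel. u y * (LINT x|lborel. kernel j (x - y) * \<phi> x))"
    by (simp add: regular_apply fourier_schwartz schwartz_mult low_pass_schwartz inv_fourier_schwartz \<phi>
       fourier_mult_inv_fourier kernel_def)
  also have "\<dots> = (LINT x|lborel. conv (kernel j) u x * \<phi> x)"
    by (rule conv_test[OF kernel_schwartz u schwartz_integrable[OF \<phi>]])
  finally show ?thesis by (simp add: regular_apply[OF \<phi>])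
qed

lemma LP_S_eq: "LP_S \<phi>0 j = fourier_multiplier (low_pass j)"
  unfolding LP_S_def by (simp add: low_pass_def[abs_def])

lemma LP_S_regular: assumes u: "u \<in> L3" shows "LP_S \<phi>0 j (regular u) = regular (conv (kernel j) u)"
proof
  fix \<phi>
  show "LP_S \<phi>0 j (regular u) \<phi> = regular (conv (kernel j) u) \<phi>"
    by (cases "\<phi> \<in> schwartz")
      (simp_all add: LP_S_eq fourier_multiplier_apply low_pass_schwartz low_pass_multiplier u
        fourier_multiplier_outside regular_outside)
qed

lemma LP_Delta_eq: "LP_Delta \<phi>0 j = fourier_multiplier (\<lambda>\<xi>. low_pass (j + 1) \<xi> - low_pass j \<xi>)"
proof -
  have "(4::real) powi (- j) = 4 powi (- (j + 1)) * 4"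
    using power_int_add[of "4::real" "- (j + 1)" 1] by simp
  then have "4 powi (- j) * (norm \<xi>)\<^sup>2 / 4 = 4 powi (- (j + 1)) * (norm \<xi>)\<^sup>2" for \<xi> :: R3
    by (simp only:)
  then show ?thesis
    unfolding LP_Delta_def Let_def low_pass_def by (simp only:)
qed

lemma LP_Delta_regular:
  assumes u: "u \<in> L3"
  shows "LP_Delta \<phi>0 j (regular u) = regular (\<lambda>x. conv (kernel (j + 1)) u x - conv (kernel j) u x)"
proof
  fix \<phi>
  show "LP_Delta \<phi>0 j (regular u) \<phi> = regular (\<lambda>x. conv (kernel (j + 1)) u x - conv (kernel j) u x) \<phi>"
  proof (cases "\<phi> \<in> schwartz")
    case True
    have "LP_Delta \<phi>0 j (regular u) \<phi> = regular u (fourier (\<lambda>\<xi>. low_pass (j + 1) \<xi> * inv_fourier \<phi> \<xi> - low_pass j \<xi> * inv_fourier \<phi> \<xi>))"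
      by (simp add: LP_Delta_eq fourier_multiplier_apply schwartz_diff_fun low_pass_schwartz True left_diff_distrib)
    also have "\<dots> = regular (conv (kernel (j + 1)) u) \<phi> - regular (conv (kernel j) u) \<phi>"
      by (subst L3_regular_fourier_diff)
        (simp_all add: u schwartz_mult low_pass_schwartz inv_fourier_schwartz True low_pass_multiplier)
    finally show ?thesis
      by (simp add: regular_diff conv_kernel_L3 u)
  qed (simp add: LP_Delta_eq fourier_multiplier_outside regular_outside)
qed

lemma LP_Delta_Lp:
  assumes u: "u \<in> L3"
  shows "LP_Delta \<phi>0 j (regular u) \<in> Lp_space 3" "Lp_norm 3 (LP_Delta \<phi>0 j (regular u)) \<le> 2 * kernel_L1 * L3_norm u"
proof -
  have "(\<lambda>x. conv (kernel (j + 1)) u x - conv (kernel j) u x) \<in> L3"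
    by (intro L3_diff conv_kernel_L3 u)
  moreover have "L3_norm (\<lambda>x. conv (kernel (j + 1)) u x - conv (kernel j) u x) \<le> 2 * kernel_L1 * L3_norm u"
    using L3_diff(2)[OF conv_kernel_L3(1)[OF u] conv_kernel_L3(1)[OF u], of "j + 1" j]
      conv_kernel_L3(2)[OF u, of j] conv_kernel_L3(2)[OF u, of "j + 1"] by simp
  ultimately show "LP_Delta \<phi>0 j (regular u) \<in> Lp_space 3" "Lp_norm 3 (LP_Delta \<phi>0 j (regular u)) \<le> 2 * kernel_L1 * L3_norm u"
    by (simp_all add: LP_Delta_regular[OF u] Lp_norm_regular regular_Lp_space)
qed

lemma two_powi_at_bot: "((\<lambda>j::int. (2::real) powi j) \<longlongrightarrow> 0) at_bot"
proof (rule tendstoI)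
  fix e :: real assume e: "e > 0"
  then obtain n where n: "(1 / 2) ^ n < e"
    using real_arch_pow_inv[of e "1 / 2"] by auto
  have "dist ((2::real) powi j) 0 < e" if "j \<le> - int n" for j
  proof -
    have "(2::real) powi j \<le> 2 powi (- int n)"
      using that by (intro power_int_increasing) auto
    also have "\<dots> = (1 / 2) ^ n"
      by (simp add: power_int_minus power_divide field_simps)
    finally show ?thesis using n by simp
  qed
  then show "\<forall>\<^sub>F j in at_bot. dist ((2::real) powi j) 0 < e"
    unfolding eventually_at_bot_linorder by blast
qed

text \<open>Bernstein's inequality paired with the integrable test function gives a bound O(2^j),
  which tends to 0 as j tends to minus infinity.\<close>

lemma LP_S_tendsto_zero:
  assumes T: "T \<in> Lp_space 3"
  shows "limitin tempered_topology (\<lambda>j. LP_S \<phi>0 j T) 0 at_bot"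
proof (rule tempered_limitinI)
  obtain u where u: "u \<in> L3" "T = regular u" using T by (rule Lp_space_cases)
  show "0 \<in> tempered"
    using regular_tempered[OF zero_L3] by (simp add: regular_zero)
  show "LP_S \<phi>0 j T \<in> tempered" for j
    unfolding u(2) LP_S_regular[OF u(1)] by (intro regular_tempered conv_kernel_L3 u)
  fix \<phi> assume \<phi>: "\<phi> \<in> schwartz"
  define A where "A = bernstein * L3_norm u * (LINT x|lborel. cmod (\<phi> x))"
  have b: "cmod (LP_S \<phi>0 j T \<phi>) \<le> 2 powi j * A" for j
  proof -
    have "cmod (LP_S \<phi>0 j T \<phi>) = cmod (LINT x|lborel. conv (kernel j) u x * \<phi> x)"
      unfolding u(2) LP_S_regular[OF u(1)] regular_apply[OF \<phi>] ..
    also have "\<dots> \<le> (LINT x|lborel. bernstein * 2 powi j * L3_norm u * cmod (\<phi> x))"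
    proof (rule Bochner_Integration.integral_norm_bound_integral)
      show "integrable lborel (\<lambda>x. conv (kernel j) u x * \<phi> x)"
        by (intro L3_times_schwartz_integrable conv_kernel_L3 u \<phi>)
      show "integrable lborel (\<lambda>x. bernstein * 2 powi j * L3_norm u * cmod (\<phi> x))"
        by (intro integrable_mult_right integrable_norm schwartz_integrable \<phi>)
      show "cmod (conv (kernel j) u x * \<phi> x) \<le> bernstein * 2 powi j * L3_norm u * cmod (\<phi> x)" for x
        unfolding norm_mult by (intro mult_right_mono conv_kernel_sup u) simp
    qed
    also have "\<dots> = 2 powi j * A" by (simp add: A_def)
    finally show ?thesis .
  qed
  have "((\<lambda>j::int. 2 powi j * A) \<longlongrightarrow> 0 * A) at_bot"
    by (intro tendsto_mult two_powi_at_bot tendsto_const)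
  then have "((\<lambda>j. LP_S \<phi>0 j T \<phi>) \<longlongrightarrow> 0) at_bot"
    by (intro Lim_null_comparison[OF always_eventually[OF allI[OF b]]]) simp
  then show "((\<lambda>j. LP_S \<phi>0 j T \<phi>) \<longlongrightarrow> 0 \<phi>) at_bot" by simp
qed

lemma functional_space_Lp: "functional_space \<phi>0 (Lp_space 3) (Lp_norm 3)"
  unfolding functional_space_def
proof (intro conjI ballI)
  show "regular ` schwartz \<subseteq> Lp_space 3" by (auto intro: regular_Lp_space schwartz_L3)
  show "Lp_space 3 \<subseteq> tempered" using regular_tempered by (auto elim!: Lp_space_cases)
qed (intro complex_banach_Lp continuous_regular_Lp continuous_Lp_tempered LP_S_tendsto_zero disjI1 schwartz_dense_Lp | assumption)+

end

section \<open>Spectral localisation\<close>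

definition vanishes_on :: "dist \<Rightarrow> R3 set \<Rightarrow> bool" where
  "vanishes_on F U \<longleftrightarrow>
     (\<forall>\<phi>\<in>schwartz. compact (closure {x. \<phi> x \<noteq> 0}) \<and> closure {x. \<phi> x \<noteq> 0} \<subseteq> U \<longrightarrow> F \<phi> = 0)"

lemma not_in_dist_supportD:
  assumes "x \<notin> dist_support F" obtains U where "open U" "x \<in> U" "vanishes_on F U"
  using assms unfolding dist_support_def vanishes_on_def by blast

text \<open>Multiplying by \<open>1 - b\<close> for the bump functions \<open>b\<close> of a finite cover removes the whole support
  without changing the value of the functional; this replaces a partition of unity.\<close>

lemma vanishes_mult_prod:
  assumes add: "\<And>\<phi> \<psi>. \<phi> \<in> schwartz \<Longrightarrow> \<psi> \<in> schwartz \<Longrightarrow> F (\<lambda>x. \<phi> x - \<psi> x) = F \<phi> - F \<psi>"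
    and I: "finite I" and b: "\<And>i. i \<in> I \<Longrightarrow> b i \<in> schwartz"
    and U: "\<And>i. i \<in> I \<Longrightarrow> vanishes_on F (U i)"
    and supp: "\<And>i. i \<in> I \<Longrightarrow> compact (closure {x. b i x \<noteq> 0}) \<and> closure {x. b i x \<noteq> 0} \<subseteq> U i"
    and \<phi>: "\<phi> \<in> schwartz"
  shows "(\<lambda>x. \<phi> x * (\<Prod>i\<in>I. 1 - b i x)) \<in> schwartz \<and> F (\<lambda>x. \<phi> x * (\<Prod>i\<in>I. 1 - b i x)) = F \<phi>"
  using I b U supp
proof (induction I rule: finite_induct)
  case empty
  then show ?case using \<phi> by simp
next
  case (insert i I)
  define \<psi> where "\<psi> x = \<phi> x * (\<Prod>i\<in>I. 1 - b i x)" for x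
  have \<psi>: "\<psi> \<in> schwartz" "F \<psi> = F \<phi>"
    using insert unfolding \<psi>_def[abs_def] by auto
  have p: "(\<lambda>x. \<psi> x * b i x) \<in> schwartz"
    using insert.prems(1)[of i] by (intro schwartz_mult \<psi>) simp
  have sub: "closure {x. \<psi> x * b i x \<noteq> 0} \<subseteq> closure {x. b i x \<noteq> 0}"
    by (intro closure_mono) auto
  have "compact (closure {x. b i x \<noteq> 0})" "closure {x. b i x \<noteq> 0} \<subseteq> U i"
    using insert.prems(3)[of i] by simp_all
  then have "compact (closure {x. \<psi> x * b i x \<noteq> 0})" "closure {x. \<psi> x * b i x \<noteq> 0} \<subseteq> U i"
    using sub bounded_subset[OF compact_imp_bounded sub] by (simp_all add: compact_eq_bounded_closed subset_trans[OF sub])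
  then have z: "F (\<lambda>x. \<psi> x * b i x) = 0"
    using insert.prems(2)[OF insertI1] p unfolding vanishes_on_def by (auto dest: bspec[OF _ p])
  have eq: "(\<lambda>x. \<phi> x * (\<Prod>i\<in>insert i I. 1 - b i x)) = (\<lambda>x. \<psi> x - \<psi> x * b i x)"
    using insert.hyps by (simp add: \<psi>_def fun_eq_iff algebra_simps)
  show ?case
    unfolding eq add[OF \<psi>(1) p] using schwartz_diff_fun[OF \<psi>(1) p] z \<psi>(2) by simp
qed

context lp_cutoff
begin

text \<open>Passes from the local vanishing in the definition of the support to a whole compact set:
  finitely many bumps equal to 1 somewhere cover \<open>K\<close>, so the product of the 1 - b
  vanishes on \<open>K\<close>, and the modified test function, with the same value under
  \<open>F\<close>, is 0.\<close>

lemma vanishes_off_dist_support: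
  assumes add: "\<And>\<phi> \<psi>. \<phi> \<in> schwartz \<Longrightarrow> \<psi> \<in> schwartz \<Longrightarrow> F (\<lambda>x. \<phi> x - \<psi> x) = F \<phi> - F \<psi>"
    and \<phi>: "\<phi> \<in> schwartz" and K: "compact K" "\<And>x. x \<notin> K \<Longrightarrow> \<phi> x = 0" "K \<inter> dist_support F = {}"
  shows "F \<phi> = 0"
proof -
  have "\<exists>U n. x \<in> K \<longrightarrow> vanishes_on F U \<and> cball x (2 powi n) \<subseteq> U" for x
  proof (cases "x \<in> K")
    case True
    then have "x \<notin> dist_support F" using K(3) by blast
    then obtain U where U: "open U" "x \<in> U" "vanishes_on F U" by (rule not_in_dist_supportD)
    then obtain e where e: "e > 0" "cball x e \<subseteq> U" using open_contains_cball by blast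
    obtain n where "(1 / 2) ^ n < e"
      using real_arch_pow_inv[of e "1 / 2"] e(1) by auto
    then have "2 powi (- int n) \<le> e"
      by (simp add: power_int_minus power_divide field_simps)
    then have "cball x (2 powi (- int n)) \<subseteq> U"
      using e(2) subset_cball[of "2 powi (- int n)" e x] by blast
    then show ?thesis using U(3) by blast
  qed simp
  then obtain U n where Un: "\<And>x. x \<in> K \<Longrightarrow> vanishes_on F (U x)" "\<And>x. x \<in> K \<Longrightarrow> cball x (2 powi (n x)) \<subseteq> U x"
    by metis
  \<comment> \<open>Half the radius: there the translated bump \<open>low_pass (n x)\<close> equals
    1, while its support still lies in the larger ball inside \<open>U x\<close>.\<close>
  have cov: "K \<subseteq> (\<Union>x\<in>K. ball x (2 powi (n x - 1)))" by auto
  obtain I where I: "I \<subseteq> K" "finite I" "K \<subseteq> (\<Union>x\<in>I. ball x (2 powi (n x - 1)))"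
    by (rule compactE_image[OF K(1), of K "\<lambda>x. ball x (2 powi (n x - 1))", OF open_ball cov])
  define b where "b y x = low_pass (n y) (x + (- y))" for y x
  have supp: "{x. b y x \<noteq> 0} \<subseteq> cball y (2 powi (n y))" for y
  proof
    fix x assume "x \<in> {x. b y x \<noteq> 0}"
    then have "\<not> norm (x + - y) > 2 powi (n y)"
      unfolding b_def using low_pass_eq_0 by blast
    then show "x \<in> cball y (2 powi (n y))" by (simp add: dist_norm norm_minus_commute)
  qed
  have csupp: "closure {x. b y x \<noteq> 0} \<subseteq> cball y (2 powi (n y))" for y
    by (rule closure_minimal[OF supp closed_cball])
  have "(\<lambda>x. \<phi> x * (\<Prod>y\<in>I. 1 - b y x)) \<in> schwartz \<and> F (\<lambda>x. \<phi> x * (\<Prod>y\<in>I. 1 - b y x)) = F \<phi>"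
  proof (rule vanishes_mult_prod[where U = U, OF add I(2) _ _ _ \<phi>])
    show "b y \<in> schwartz" for y
      unfolding b_def[abs_def] by (intro schwartz_shift low_pass_schwartz)
    show "vanishes_on F (U y)" if "y \<in> I" for y
      using that I(1) Un(1) by blast
    show "compact (closure {x. b y x \<noteq> 0}) \<and> closure {x. b y x \<noteq> 0} \<subseteq> U y" if "y \<in> I" for y
    proof
      show "compact (closure {x. b y x \<noteq> 0})"
        using bounded_subset[OF bounded_cball csupp] by (simp add: compact_eq_bounded_closed)
      show "closure {x. b y x \<noteq> 0} \<subseteq> U y"
        using csupp[of y] Un(2)[of y] that I(1) by blast
    qed
  qed
  moreover have "\<phi> x * (\<Prod>y\<in>I. 1 - b y x) = 0" for x
  proof (cases "x \<in> K")
    case True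
    then obtain y where y: "y \<in> I" "x \<in> ball y (2 powi (n y - 1))" using I(3) by blast
    then have "b y x = 1"
      unfolding b_def by (intro low_pass_eq_1) (simp add: dist_norm norm_minus_commute)
    then have "(\<Prod>y\<in>I. 1 - b y x) = 0"
      using y(1) I(2) by (auto simp: prod_zero_iff)
    then show ?thesis by simp
  qed (simp add: K(2))
  ultimately have "F \<phi> = F (\<lambda>x. 0)" by simp
  moreover have "F (\<lambda>x. 0) = 0"
    using add[OF schwartz_0 schwartz_0] by simp
  ultimately show ?thesis by simp
qed

text \<open>The truncations \<open>low_pass n \<cdot> h\<close> have compact support. Passing to the limit only needs the
  sup norm of the remainder to vanish and its \<open>L\<^sup>1\<close> norm to stay bounded.\<close>

lemma regular_fourier_eq_0:
  assumes u: "u \<in> L3" and supp: "dist_support (dist_fourier (regular u)) \<subseteq> dyadic_annulus k"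
    and h: "h \<in> schwartz" and h0: "\<And>\<xi>. norm \<xi> < 2 powi (k + 2) \<Longrightarrow> h \<xi> = 0"
  shows "regular u (fourier h) = 0"
proof -
  let ?F = "dist_fourier (regular u)"
  define c where "c n \<xi> = low_pass (int n) \<xi> * h \<xi>" for n \<xi>
  have cS: "c n \<in> schwartz" for n
    unfolding c_def[abs_def] by (intro schwartz_mult low_pass_schwartz h)
  define r where "r n \<xi> = h \<xi> - c n \<xi>" for n \<xi>
  have rS: "r n \<in> schwartz" for n
    unfolding r_def[abs_def] by (intro schwartz_diff_fun h cS)
  have c_zero: "regular u (fourier (c n)) = 0" for n
  proof -
    have "?F (c n) = 0"
    \<comment> \<open>The truncated function lives on the shell 2^{k+2} <= |\<xi>| <= 2^n, which
      misses the annulus because that ends at 2^{k+1}.\<close>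
    proof (rule vanishes_off_dist_support[where F = ?F and \<phi> = "c n" and K = "cball 0 (2 powi (int n)) - ball 0 (2 powi (k + 2))"])
      show "?F (\<lambda>x. \<phi> x - \<psi> x) = ?F \<phi> - ?F \<psi>" if "\<phi> \<in> schwartz" "\<psi> \<in> schwartz" for \<phi> \<psi>
        using that by (simp add: dist_fourier_def schwartz_diff_fun L3_regular_fourier_diff u)
      show "compact (cball 0 (2 powi (int n)) - ball (0::R3) (2 powi (k + 2)))"
        by (intro compact_diff compact_cball open_ball)
      show "c n x = 0" if "x \<notin> cball 0 (2 powi (int n)) - ball 0 (2 powi (k + 2))" for x
        using that h0[of x] low_pass_eq_0[of "int n" x] by (auto simp: c_def)
      show "(cball 0 (2 powi (int n)) - ball 0 (2 powi (k + 2))) \<inter> dist_support ?F = {}"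
      proof -
        have "(2::real) powi (k + 1) < 2 powi (k + 2)"
          by (intro power_int_strict_increasing) auto
        then show ?thesis
          using supp by (auto simp: dyadic_annulus_def subset_iff)
      qed
    qed (rule cS)
    then show ?thesis by (simp add: dist_fourier_def cS)
  qed
  let ?\<psi> = "fourier h" and ?N = "\<lambda>f::func. LINT x|lborel. cmod (f x)"
  have \<psi>: "?\<psi> \<in> schwartz" by (rule fourier_schwartz[OF h])
  \<comment> \<open>By inversion \<open>h\<close> is 1/\<kappa> times the inverse transform of
    \<open>?\<psi>\<close>, so truncating \<open>h\<close> convolves \<open>?\<psi>\<close> with a
    low-pass kernel. Therefore \<open>A\<close> bounds the L^1 norm of the transformed remainder for
    every \<open>n\<close>.\<close>
  define A where "A = ?N ?\<psi> + cmod (1 / \<kappa>) * (kernel_L1 * ?N ?\<psi>)"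
  \<comment> \<open>The L^1 norm of the remainder in frequency; it bounds the sup norm of its
    transform and tends to 0.\<close>
  define \<epsilon> where "\<epsilon> n = (LINT \<xi>|lborel. cmod (r n \<xi>))" for n
  have L1: "?N (fourier (r n)) \<le> A" for n
  proof -
    have "h = (\<lambda>\<xi>. (1 / \<kappa>) * inv_fourier ?\<psi> \<xi>)"
      using \<kappa>_nonzero by (simp add: inv_fourier_fourier[OF h] fun_eq_iff)
    then have "fourier (c n) = fourier (\<lambda>\<xi>. (1 / \<kappa>) * (low_pass (int n) \<xi> * inv_fourier ?\<psi> \<xi>))"
      unfolding c_def by (intro arg_cong[where f = fourier] ext) (metis mult.left_commute)
    then have fc: "fourier (c n) = (\<lambda>x. (1 / \<kappa>) * fourier (\<lambda>\<xi>. low_pass (int n) \<xi> * inv_fourier ?\<psi> \<xi>) x)"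
      by (simp only: fourier_cmult)
    have "?N (fourier (c n)) = cmod (1 / \<kappa>) * ?N (fourier (\<lambda>\<xi>. low_pass (int n) \<xi> * inv_fourier ?\<psi> \<xi>))"
      unfolding fc norm_mult by simp
    also have "\<dots> \<le> cmod (1 / \<kappa>) * (kernel_L1 * ?N ?\<psi>)"
      using fourier_mult_inv_fourier_L1[OF low_pass_schwartz \<psi>, of "int n"]
      unfolding kernel_def[symmetric] kernel_integral by (intro mult_left_mono) auto
    finally have 1: "?N (fourier (c n)) \<le> cmod (1 / \<kappa>) * (kernel_L1 * ?N ?\<psi>)" .
    have i: "integrable lborel (\<lambda>x. cmod (f x))" if "f \<in> schwartz" for f
      using that by (intro integrable_norm schwartz_integrable)
    have "?N (fourier (r n)) \<le> (LINT x|lborel. cmod (?\<psi> x) + cmod (fourier (c n) x))"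
    proof (rule integral_mono)
      show "cmod (fourier (r n) x) \<le> cmod (?\<psi> x) + cmod (fourier (c n) x)" for x
        unfolding r_def[abs_def]
        by (simp add: fourier_diff schwartz_integrable h cS norm_triangle_ineq4)
    qed (intro Bochner_Integration.integrable_add i fourier_schwartz rS h cS)+
    also have "\<dots> = ?N ?\<psi> + ?N (fourier (c n))"
      by (intro Bochner_Integration.integral_add i fourier_schwartz h cS)
    finally show ?thesis using 1 unfolding A_def by linarith
  qed
  have A0: "A \<ge> 0"
    unfolding A_def using kernel_L1_nonneg by (intro add_nonneg_nonneg mult_nonneg_nonneg) auto
  define M where "M = schwartz_seminorm 0 [] (low_pass 0)"
  note M = low_pass_bounded[folded M_def]
  have "\<epsilon> \<longlonglongrightarrow> (LINT \<xi>|(lborel :: R3 measure). 0)"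
    unfolding \<epsilon>_def
  proof (rule integral_dominated_convergence)
    show "integrable lborel (\<lambda>\<xi>. (1 + M) * cmod (h \<xi>))"
      by (intro integrable_mult_right integrable_norm schwartz_integrable h)
    show "AE \<xi> in lborel. norm (cmod (r n \<xi>)) \<le> (1 + M) * cmod (h \<xi>)" for n
    proof (rule AE_I2)
      fix \<xi> :: R3
      have "cmod (r n \<xi>) \<le> cmod (h \<xi>) + cmod (low_pass (int n) \<xi> * h \<xi>)"
        unfolding r_def c_def by (rule norm_triangle_ineq4)
      also have "\<dots> \<le> cmod (h \<xi>) + M * cmod (h \<xi>)"
        unfolding norm_mult by (intro add_left_mono mult_right_mono M) auto
      finally show "norm (cmod (r n \<xi>)) \<le> (1 + M) * cmod (h \<xi>)" by (simp add: distrib_right)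
    qed
    show "AE \<xi> in lborel. (\<lambda>n. cmod (r n \<xi>)) \<longlonglongrightarrow> 0"
    proof (rule AE_I2)
      fix \<xi> :: R3
      obtain n0 :: nat where n0: "norm \<xi> \<le> 2 powi (int n0 - 1)" using two_powi_ge by blast
      have "r n \<xi> = 0" if "n \<ge> n0" for n
      proof -
        have "(2::real) powi (int n0 - 1) \<le> 2 powi (int n - 1)"
          using that by (intro power_int_increasing) auto
        then have "low_pass (int n) \<xi> = 1" using n0 by (intro low_pass_eq_1) simp
        then show ?thesis by (simp add: r_def c_def)
      qed
      then have "\<forall>\<^sub>F n in sequentially. cmod (r n \<xi>) = 0"
        by (intro eventually_sequentiallyI[of n0]) simp
      then show "(\<lambda>n. cmod (r n \<xi>)) \<longlonglongrightarrow> 0" by (rule tendsto_eventually)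
    qed
    show "(\<lambda>\<xi>. cmod (r n \<xi>)) \<in> borel_measurable lborel" for n
      using schwartz_measurable[OF rS] by simp
  qed simp
  then have e0: "\<epsilon> \<longlonglongrightarrow> 0" by simp
  have b: "cmod (regular u (fourier h)) ^ 3 \<le> A\<^sup>2 * \<epsilon> n * L3_norm u ^ 3" for n
  proof -
    have "regular u (fourier (r n)) = regular u (fourier h) - regular u (fourier (c n))"
      unfolding r_def[abs_def] by (rule L3_regular_fourier_diff[OF u h cS])
    then have "regular u (fourier h) = (LINT x|lborel. u x * fourier (r n) x)"
      using c_zero by (simp add: regular_apply fourier_schwartz rS)
    also have "cmod \<dots> ^ 3 \<le> (?N (fourier (r n)))\<^sup>2 * \<epsilon> n * L3_norm u ^ 3"
      unfolding \<epsilon>_def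
      by (rule L3_pairing(4)[OF u]) (intro schwartz_integrable fourier_schwartz rS cmod_fourier_le)+
    also have "\<dots> \<le> A\<^sup>2 * \<epsilon> n * L3_norm u ^ 3"
      by (intro mult_right_mono power_mono L1) (auto simp: \<epsilon>_def)
    finally show ?thesis .
  qed
  have "(\<lambda>n. A\<^sup>2 * \<epsilon> n * L3_norm u ^ 3) \<longlonglongrightarrow> A\<^sup>2 * 0 * L3_norm u ^ 3"
    by (intro tendsto_intros e0)
  from LIMSEQ_le_const[OF this, of "cmod (regular u (fourier h)) ^ 3"] b
  have "cmod (regular u (fourier h)) ^ 3 \<le> 0" by auto
  then have "cmod (regular u (fourier h)) \<le> 0"
    by (simp add: power_le_zero_eq)
  then show ?thesis by simp
qed

text \<open>Two continuous representatives of polynomial growth agree almost everywhere, hence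
  everywhere, which resolves the definite description.\<close>

lemma dist_function_regular:
  assumes c: "continuous_on UNIV u" and b: "\<And>x. cmod (u x) \<le> C * (1 + norm x) ^ n"
  shows "dist_function (regular u) = u"
  unfolding dist_function_def
proof (rule the_equality)
  show "continuous_on UNIV u \<and> (\<exists>C k. \<forall>x. cmod (u x) \<le> C * (1 + norm x) ^ k) \<and> regular u = regular u"
    using c b by blast
next
  fix v assume "continuous_on UNIV v \<and> (\<exists>C k. \<forall>x. cmod (v x) \<le> C * (1 + norm x) ^ k) \<and> regular u = regular v"
  then obtain D m where v: "continuous_on UNIV v" "\<And>x. cmod (v x) \<le> D * (1 + norm x) ^ m" "regular u = regular v"
    by blast
  have i: "integrable lborel (\<lambda>x. w x * \<phi> x)"
    if "continuous_on UNIV w" "\<And>x. cmod (w x) \<le> C * (1 + norm x) ^ n" "\<phi> \<in> schwartz" for w \<phi> C n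
  proof (rule rapid_integrable)
    show "rapid (\<lambda>x. w x * \<phi> x)"
      by (rule rapid_mult_le[OF schwartz_rapid[OF that(3)], of _ C n])
        (auto simp: norm_mult intro!: mult_right_mono that(2))
    show "(\<lambda>x. w x * \<phi> x) \<in> borel_measurable borel"
      by (intro borel_measurable_times borel_measurable_continuous_onI that(1) schwartz_continuous that(3))
  qed
  have "AE x in lborel. u x = v x"
  proof (rule regular_inj_AE[OF _ _ _ i[OF c b] i[OF v(1,2)] v(3)])
    show "integrable lborel (\<lambda>x. indicator (cball 0 R) x * cmod (u x - v x))" for R
      using borel_integrable_compact[OF compact_cball, of 0 R "\<lambda>x. cmod (u x - v x)"]
        continuous_on_subset[OF c, of "cball 0 R"] continuous_on_subset[OF v(1), of "cball 0 R"]
      by (simp add: continuous_on_norm continuous_on_diff)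
  qed (intro borel_measurable_continuous_onI c v(1) | assumption)+
  then have "AE x in lborel. v x - u x = 0" by eventually_elim simp
  then have "v x - u x = 0" for x
    by (rule continuous_AE_zero[rotated]) (intro continuous_intros c v(1))
  then show "v = u" by (simp add: fun_eq_iff)
qed

text \<open>\<open>low_pass (k + 3)\<close> is 1 up to radius 2^{k+2}, a ball containing the annulus
  of outer radius 2^{k+1} in its interior. The factor 1/\<kappa> corrects the constant in Fourier
  inversion.\<close>

definition reproduce :: "int \<Rightarrow> func \<Rightarrow> func" where
  "reproduce k u = (\<lambda>x. (1 / \<kappa>) * conv (kernel (k + 3)) u x)"

text \<open>The factor 8 is 2^3, from evaluating Bernstein's inequality at k + 3.\<close>

definition reproduce_const :: real where
  "reproduce_const = cmod (1 / \<kappa>) * bernstein * 8"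

lemma reproduce_L3: "u \<in> L3 \<Longrightarrow> reproduce k u \<in> L3"
  unfolding reproduce_def by (intro L3_cmult conv_kernel_L3)

lemma reproduce_bound:
  assumes u: "u \<in> L3" shows "cmod (reproduce k u x) \<le> reproduce_const * 2 powi k * L3_norm u"
proof -
  have "cmod (reproduce k u x) \<le> cmod (1 / \<kappa>) * (bernstein * 2 powi (k + 3) * L3_norm u)"
    unfolding norm_mult reproduce_def by (intro mult_left_mono conv_kernel_sup u) simp
  also have "(2::real) powi (k + 3) = 2 powi k * 8"
    by (subst power_int_add) auto
  finally show ?thesis by (simp add: reproduce_const_def mult_ac)
qed

text \<open>After inversion, the difference of both sides tests the transform of \<open>u\<close>
  against (1 - \<open>low_pass (k + 3)\<close>) times a Schwartz function, which vanishes for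
  |\<xi>| < 2^{k+2}; \<open>regular_fourier_eq_0\<close> applies.\<close>

lemma regular_reproduced:
  assumes u: "u \<in> L3" and supp: "dist_support (dist_fourier (regular u)) \<subseteq> dyadic_annulus k"
  shows "regular u = regular (reproduce k u)"
proof
  fix \<phi>
  show "regular u \<phi> = regular (reproduce k u) \<phi>"
  proof (cases "\<phi> \<in> schwartz")
    case True
    let ?h = "inv_fourier \<phi>"
    let ?lh = "\<lambda>\<xi>. low_pass (k + 3) \<xi> * ?h \<xi>"
    have h: "?h \<in> schwartz" by (rule inv_fourier_schwartz[OF True])
    have lh: "?lh \<in> schwartz" by (intro schwartz_mult low_pass_schwartz h)
    have "regular u (fourier (\<lambda>\<xi>. ?h \<xi> - ?lh \<xi>)) = 0"
    proof (rule regular_fourier_eq_0[OF u supp])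
      show "?h \<xi> - ?lh \<xi> = 0" if "norm \<xi> < 2 powi (k + 2)" for \<xi>
      proof -
        have "low_pass (k + 3) \<xi> = 1" by (rule low_pass_eq_1) (use that in \<open>simp add: add.commute\<close>)
        then show ?thesis by simp
      qed
    qed (intro schwartz_diff_fun h lh)
    then have "regular u (fourier ?h) = regular u (fourier ?lh)"
      by (simp add: L3_regular_fourier_diff u h lh)
    also have "\<dots> = regular (conv (kernel (k + 3)) u) \<phi>"
      by (rule low_pass_multiplier[OF u True])
    finally have "regular u (fourier ?h) = regular (conv (kernel (k + 3)) u) \<phi>" .
    moreover have "regular u (fourier ?h) = \<kappa> * regular u \<phi>"
      by (simp add: regular_apply fourier_schwartz h True fourier_inv_fourier mult.left_commute[of _ \<kappa>])
    ultimately show ?thesis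
      using \<kappa>_nonzero by (simp only: reproduce_def regular_cmult) (simp add: eq_divide_eq mult.commute)
  qed (simp add: regular_outside)
qed

lemma dist_function_band_limited:
  assumes u: "u \<in> L3" and supp: "dist_support (dist_fourier (regular u)) \<subseteq> dyadic_annulus k"
  shows "dist_function (regular u) = reproduce k u"
proof -
  have "continuous_on UNIV (reproduce k u)"
    unfolding reproduce_def by (intro continuous_on_mult continuous_on_const conv_kernel_L3 u)
  then have "dist_function (regular (reproduce k u)) = reproduce k u"
    by (rule dist_function_regular[where C = "reproduce_const * 2 powi k * L3_norm u" and n = 0])
      (use reproduce_bound[OF u, of k] in simp)
  then show ?thesis
    by (simp only: regular_reproduced[OF u supp, symmetric])
qed

text \<open>The transform of a product of band-limited functions is a convolution of compactly supported
  functions.\<close>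

lemma inv_fourier_kernel_mult:
  assumes q: "q \<in> schwartz" and q0: "\<And>\<xi>. norm \<xi> \<le> R \<Longrightarrow> q \<xi> = 0" and \<xi>: "norm \<xi> + 2 powi m \<le> R"
  shows "inv_fourier (\<lambda>x. kernel m (x - y) * fourier q x) \<xi> = 0"
proof -
  define c where "c = complex_of_real (1 / (2 * pi) ^ 3)"
  have c0: "c \<noteq> 0" by (simp add: c_def)
  define a where "a x = echar (x \<bullet> (- \<xi>)) * fourier q x" for x
  define \<mu> where "\<mu> \<eta> = echar (\<eta> \<bullet> y) * low_pass m \<eta>" for \<eta>
  note [measurable] = schwartz_measurable[OF q] schwartz_measurable[OF low_pass_schwartz]
  have ia: "integrable lborel a"
    unfolding a_def by (intro integrable_exp_mult schwartz_integrable fourier_schwartz q)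
  have i\<mu>: "integrable lborel \<mu>"
    unfolding \<mu>_def by (intro integrable_exp_mult schwartz_integrable low_pass_schwartz)
  have i\<mu>': "integrable lborel (\<lambda>\<eta>. \<mu> (- \<eta>))"
    using integrable_affine[OF i\<mu>, of "-1" 0] by simp
  have \<mu>m: "\<mu> \<in> borel_measurable borel" using i\<mu> by auto
  have k: "kernel m (x - y) = c * fourier (\<lambda>\<eta>. \<mu> (- \<eta>)) x" for x
  proof -
    have "fourier (\<lambda>\<eta>. \<mu> (- \<eta>)) x = fourier \<mu> (- x)"
      by (rule fourier_reflect[OF \<mu>m])
    also have "\<dots> = fourier (low_pass m) (- x + y)"
      unfolding \<mu>_def[abs_def] by (rule fourier_modulate)
    finally show ?thesis
      by (simp add: kernel_def inv_fourier_eq c_def)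
  qed
  \<comment> \<open>Up to a constant, \<open>fourier a\<close> at \<eta> is q(\<xi> - \<eta>), by
    inversion. For |\<eta>| <= 2^m it vanishes because |\<xi> - \<eta>| <= R; for larger |\<eta>|
    the low-pass symbol vanishes.\<close>
  have fa: "fourier a \<eta> * \<mu> (- \<eta>) = 0" for \<eta>
  proof (cases "norm \<eta> > 2 powi m")
    case True
    then have "low_pass m (- \<eta>) = 0" by (intro low_pass_eq_0) simp
    then show ?thesis by (simp add: \<mu>_def)
  next
    case False
    have "norm (\<xi> - \<eta>) \<le> R"
      using False \<xi> norm_triangle_ineq4[of \<xi> \<eta>] by linarith
    then have "c * fourier (fourier q) (- (\<xi> - \<eta>)) = 0"
      using inv_fourier_fourier[OF q, of "\<xi> - \<eta>"] q0 by (simp add: inv_fourier_eq c_def)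
    then have "fourier (fourier q) (\<eta> + - \<xi>) = 0"
      using c0 by simp
    then show ?thesis
      unfolding a_def[abs_def] fourier_modulate by simp
  qed
  have "inv_fourier (\<lambda>x. kernel m (x - y) * fourier q x) \<xi> = c * (LINT x|lborel. echar (x \<bullet> (- \<xi>)) * (kernel m (x - y) * fourier q x))"
    by (simp add: inv_fourier_eq fourier_def c_def)
  also have "(LINT x|lborel. echar (x \<bullet> (- \<xi>)) * (kernel m (x - y) * fourier q x)) = (LINT x|lborel. c * (a x * fourier (\<lambda>\<eta>. \<mu> (- \<eta>)) x))"
    by (intro Bochner_Integration.integral_cong refl) (simp add: k a_def mult_ac)
  also have "\<dots> = c * (LINT x|lborel. fourier a x * \<mu> (- x))"
    using fourier_multiplication_formula[OF ia i\<mu>'] by simp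
  also have "\<dots> = 0"
    by (simp add: fa)
  finally show ?thesis by simp
qed

text \<open>\<open>conv_test\<close> moves the kernel from \<open>u\<close> onto \<open>w\<close>
  times the test function. For each \<open>y\<close> the inner integral tests \<open>w\<close>
  against a function whose inverse transform vanishes for |\<xi>| < 2^{l+2}, so the spectral
  condition gives 0. That condition is carried by \<open>v\<close>, whereas the product uses another
  representative \<open>w\<close> of the same distribution.\<close>

lemma product_spectrum:
  assumes u: "u \<in> L3" and v: "v \<in> L3" and w: "w \<in> L3"
    and supp: "dist_support (dist_fourier (regular v)) \<subseteq> dyadic_annulus l"
    and vw: "regular v = regular w"
    and q: "q \<in> schwartz" and q0: "\<And>\<xi>. norm \<xi> \<le> 2 powi (l + 2) + 2 powi m \<Longrightarrow> q \<xi> = 0"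
  shows "(LINT x|lborel. conv (kernel m) u x * w x * fourier q x) = 0"
proof -
  let ?\<psi> = "fourier q"
  have \<psi>: "?\<psi> \<in> schwartz" by (rule fourier_schwartz[OF q])
  have iw: "integrable lborel (\<lambda>x. w x * ?\<psi> x)"
    by (rule L3_times_schwartz_integrable[OF w \<psi>])
  have inner: "(LINT x|lborel. kernel m (x - y) * (w x * ?\<psi> x)) = 0" for y
  proof -
    define \<omega> where "\<omega> x = kernel m (x - y) * ?\<psi> x" for x
    have \<omega>: "\<omega> \<in> schwartz"
      unfolding \<omega>_def[abs_def] using schwartz_shift[OF kernel_schwartz, of m "- y"]
      by (intro schwartz_mult \<psi>) simp
    have "regular v (fourier (inv_fourier \<omega>)) = 0"
    proof (rule regular_fourier_eq_0[OF v supp inv_fourier_schwartz[OF \<omega>]])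
      fix \<xi> :: R3 assume "norm \<xi> < 2 powi (l + 2)"
      then show "inv_fourier \<omega> \<xi> = 0"
        unfolding \<omega>_def[abs_def] by (intro inv_fourier_kernel_mult[OF q q0]) auto
    qed
    moreover have "regular v (fourier (inv_fourier \<omega>)) = \<kappa> * regular v \<omega>"
      by (simp add: regular_apply fourier_schwartz inv_fourier_schwartz \<omega> fourier_inv_fourier mult.left_commute[of _ \<kappa>])
    ultimately have "regular w \<omega> = 0" using \<kappa>_nonzero vw by simp
    then show ?thesis
      by (simp add: regular_apply[OF \<omega>] \<omega>_def mult_ac)
  qed
  have "(LINT x|lborel. conv (kernel m) u x * (w x * ?\<psi> x)) = (LINT y|lborel. u y * (LINT x|lborel. kernel m (x - y) * (w x * ?\<psi> x)))"
    by (rule conv_test[OF kernel_schwartz u iw, symmetric])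
  also have "\<dots> = 0" by (simp add: inner)
  finally show ?thesis by (simp add: mult.assoc)
qed

lemma LP_Delta_product_eq_0:
  assumes u: "u \<in> L3" and v: "v \<in> L3"
    and su: "dist_support (dist_fourier (regular u)) \<subseteq> dyadic_annulus k"
    and sv: "dist_support (dist_fourier (regular v)) \<subseteq> dyadic_annulus l"
    and j: "max (k - j) (l - j) < - 5"
  shows "LP_Delta \<phi>0 j (dist_product (regular u) (regular v)) = 0"
proof
  fix \<phi>
  show "LP_Delta \<phi>0 j (dist_product (regular u) (regular v)) \<phi> = 0 \<phi>"
  proof (cases "\<phi> \<in> schwartz")
    case True
    let ?p = "\<lambda>\<xi>. low_pass (j + 1) \<xi> - low_pass j \<xi>"
    let ?q = "\<lambda>\<xi>. ?p \<xi> * inv_fourier \<phi> \<xi>"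
    have p: "?p \<in> schwartz" by (intro schwartz_diff_fun low_pass_schwartz)
    have q: "?q \<in> schwartz" by (intro schwartz_mult p inv_fourier_schwartz True)
    \<comment> \<open>Source of the threshold -5. With M = max k l the radius is at most 2^{M+5},
      and j >= M + 6 puts it below 2^{j-1}, where both low-pass symbols are 1 and cancel. The
      exponent k + 3 is that of the kernel in \<open>reproduce k u\<close>.\<close>
    have q0: "?q \<xi> = 0" if "norm \<xi> \<le> 2 powi (l + 2) + 2 powi (k + 3)" for \<xi>
    proof -
      define M where "M = max k l"
      have jM: "M + 6 \<le> j" using j unfolding M_def by auto
      have "(2::real) powi (l + 2) \<le> 2 powi (M + 4)" "(2::real) powi (k + 3) \<le> 2 powi (M + 4)"
        by (intro power_int_increasing; auto simp: M_def)+
      then have "norm \<xi> \<le> 2 * 2 powi (M + 4)" using that by simp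
      also have "\<dots> = 2 powi (M + 5)"
        using power_int_add[of "2::real" "M + 4" 1] by (simp add: add.commute)
      also have "\<dots> \<le> 2 powi (j - 1)" using jM by (intro power_int_increasing) auto
      finally have n: "norm \<xi> \<le> 2 powi (j - 1)" .
      have "(2::real) powi (j - 1) \<le> 2 powi (j + 1 - 1)" by (intro power_int_increasing) auto
      then have "low_pass j \<xi> = 1" "low_pass (j + 1) \<xi> = 1"
        using n by (intro low_pass_eq_1; simp)+
      then show ?thesis by simp
    qed
    have z: "(LINT x|lborel. conv (kernel (k + 3)) u x * reproduce l v x * fourier ?q x) = 0"
      by (rule product_spectrum[OF u v reproduce_L3[OF v] sv regular_reproduced[OF v sv] q q0])
    have "LP_Delta \<phi>0 j (dist_product (regular u) (regular v)) \<phi>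
        = (LINT x|lborel. dist_function (regular u) x * dist_function (regular v) x * fourier ?q x)"
      unfolding LP_Delta_eq fourier_multiplier_apply[OF p True] dist_product_def regular_apply[OF fourier_schwartz[OF q]] ..
    also have "\<dots> = (LINT x|lborel. (1 / \<kappa>) * (conv (kernel (k + 3)) u x * reproduce l v x * fourier ?q x))"
      unfolding dist_function_band_limited[OF u su] dist_function_band_limited[OF v sv] reproduce_def[of k]
      by (simp add: mult_ac)
    also have "\<dots> = (1 / \<kappa>) * (LINT x|lborel. conv (kernel (k + 3)) u x * reproduce l v x * fourier ?q x)"
      by (rule integral_mult_right_zero)
    finally show ?thesis by (simp only: z mult_zero_right zero_fun_apply)
  qed (simp add: LP_Delta_eq fourier_multiplier_outside)
qed

text \<open>The factor of lower frequency is taken in sup norm and the other in L^3, which produces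
  the minimum of \<open>k\<close> and \<open>l\<close>.\<close>

lemma dist_product_Lp:
  assumes u: "u \<in> L3" and v: "v \<in> L3" and su: "dist_support (dist_fourier (regular u)) \<subseteq> dyadic_annulus k"
    and sv: "dist_support (dist_fourier (regular v)) \<subseteq> dyadic_annulus l"
  obtains w where "w \<in> L3" "dist_product (regular u) (regular v) = regular w"
    "L3_norm w \<le> reproduce_const * 2 powi (min k l) * L3_norm u * L3_norm v"
proof -
  let ?f = "reproduce k u" and ?g = "reproduce l v"
  note f = reproduce_L3[OF u, of k] and g = reproduce_L3[OF v, of l]
  \<comment> \<open>No constant is lost: \<open>reproduce k u\<close> and \<open>u\<close> define
    the same distribution and so have the same norm.\<close>
  have nf: "L3_norm ?f = L3_norm u"
    using Lp_norm_regular[OF u] Lp_norm_regular[OF f] regular_reproduced[OF u su] by (simp only:)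
  have ng: "L3_norm ?g = L3_norm v"
    using Lp_norm_regular[OF v] Lp_norm_regular[OF g] regular_reproduced[OF v sv] by (simp only:)
  note 1 = L3_mult_bounded[OF g L3_measurable[OF f] reproduce_bound[OF u]]
  note 2 = L3_mult_bounded[OF f L3_measurable[OF g] reproduce_bound[OF v]]
  have "L3_norm (\<lambda>x. ?f x * ?g x) \<le> reproduce_const * 2 powi (min k l) * L3_norm u * L3_norm v"
  proof (cases "k \<le> l")
    case True
    then show ?thesis using 1(2) unfolding ng by (simp add: min_absorb1)
  next
    case False
    have "(\<lambda>x. ?f x * ?g x) = (\<lambda>x. ?g x * ?f x)" by (simp add: mult.commute)
    then show ?thesis using 2(2) False unfolding nf by (simp add: min_absorb2 mult_ac)
  qed
  moreover have "dist_product (regular u) (regular v) = regular (\<lambda>x. ?f x * ?g x)"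
    unfolding dist_product_def dist_function_band_limited[OF u su] dist_function_band_limited[OF v sv] ..
  ultimately show thesis
    using 1(1) by (intro that)
qed

lemma summable_two_powi_tail: "(\<lambda>n::int. if n \<ge> - 5 then C * 2 powi (- n) else (0::real)) summable_on UNIV"
proof -
  have "(\<lambda>n::nat. (1 / 2 :: real) ^ n) summable_on UNIV"
    by (rule norm_summable_imp_summable_on) (auto intro!: summable_geometric)
  \<comment> \<open>32 = 2^5 accounts for reindexing the integers n >= -5 by the naturals.\<close>
  then have "(\<lambda>n::nat. (C * 32) * (1 / 2 :: real) ^ n) summable_on UNIV"
    by (rule summable_on_cmult_right)
  then have "((\<lambda>n::int. C * 2 powi (- n)) \<circ> (\<lambda>n. int n - 5)) summable_on UNIV"
  proof (rule summable_on_cong[THEN iffD1, rotated])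
    fix n :: nat
    have "(2::real) powi (- (int n - 5)) = 2 powi (- int n) * 2 powi 5"
      by (subst power_int_add[symmetric]) auto
    also have "\<dots> = (1 / 2) ^ n * 32"
      by (simp add: power_int_minus power_divide field_simps)
    finally show "C * 32 * (1 / 2) ^ n = ((\<lambda>n::int. C * 2 powi (- n)) \<circ> (\<lambda>n. int n - 5)) n"
      by (simp only: o_apply mult_ac)
  qed
  moreover have "inj (\<lambda>n. int n - 5)" by (auto intro: injI)
  ultimately have "(\<lambda>n::int. C * 2 powi (- n)) summable_on range (\<lambda>n. int n - 5)"
    by (subst summable_on_reindex) auto
  moreover have "range (\<lambda>n. int n - 5) = {n. n \<ge> - 5}"
  proof safe
    fix n :: int assume "n \<ge> - 5"
    then show "n \<in> range (\<lambda>n. int n - 5)"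
      by (intro image_eqI[of _ _ "nat (n + 5)"]) auto
  qed simp
  ultimately have "(\<lambda>n::int. C * 2 powi (- n)) summable_on {n. n \<ge> - 5}" by simp
  then show ?thesis
    by (rule summable_on_cong_neutral[THEN iffD1, rotated -1]) auto
qed

lemma good_space_L3: "good_space \<phi>0 (Lp_space 3) (Lp_norm 3)"
  unfolding good_space_def
proof (intro conjI ballI allI impI)
  show "functional_space \<phi>0 (Lp_space 3) (Lp_norm 3)" by (rule functional_space_Lp)
  show "dist_rescale r x0 T \<in> Lp_space 3" "Lp_norm 3 (dist_rescale r x0 T) = Lp_norm 3 T"
    if "T \<in> Lp_space 3" "r > 0" for T x0 r
    using Lp_rescale[OF that] by simp_all
  \<comment> \<open>2 \<open>kernel_L1\<close> bounds Delta_j on L^3 as a difference of two low-pass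
    operators; \<open>reproduce_const\<close> comes from the sup bound for one factor of the
    product.\<close>
  define C where "C = 2 * kernel_L1 * reproduce_const"
  have C: "C \<ge> 0" using bernstein_ge kernel_L1_nonneg by (simp add: C_def reproduce_const_def)
  define \<eta> :: "int \<Rightarrow> real" where "\<eta> n = (if n \<ge> - 5 then C * 2 powi (- n) else 0)" for n
  have \<eta>0: "\<eta> n \<ge> 0" for n using C by (simp add: \<eta>_def)
  have "LP_Delta \<phi>0 j (dist_product S T) \<in> Lp_space 3 \<and>
     Lp_norm 3 (LP_Delta \<phi>0 j (dist_product S T)) \<le> \<eta> (max (k - j) (l - j)) * 2 powi (k + l - j) * Lp_norm 3 S * Lp_norm 3 T"
    if S: "S \<in> Lp_space 3" and T: "T \<in> Lp_space 3" and sS: "dist_support (dist_fourier S) \<subseteq> dyadic_annulus k"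
      and sT: "dist_support (dist_fourier T) \<subseteq> dyadic_annulus l" for S T k l j
  proof -
    obtain u where u: "u \<in> L3" "S = regular u" using S by (rule Lp_space_cases)
    obtain v where v: "v \<in> L3" "T = regular v" using T by (rule Lp_space_cases)
    have su: "dist_support (dist_fourier (regular u)) \<subseteq> dyadic_annulus k"
      and sv: "dist_support (dist_fourier (regular v)) \<subseteq> dyadic_annulus l"
      using sS sT u v by simp_all
    obtain w where w: "w \<in> L3" "dist_product (regular u) (regular v) = regular w"
      "L3_norm w \<le> reproduce_const * 2 powi (min k l) * L3_norm u * L3_norm v"
      by (rule dist_product_Lp[OF u(1) v(1) su sv])
    have "Lp_norm 3 (LP_Delta \<phi>0 j (regular w)) \<le> \<eta> (max (k - j) (l - j)) * 2 powi (k + l - j) * L3_norm u * L3_norm v"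
    proof (cases "max (k - j) (l - j) < - 5")
      case True
      have "LP_Delta \<phi>0 j (regular w) = 0"
        using LP_Delta_product_eq_0[OF u(1) v(1) su sv True] w(2) by simp
      then show ?thesis using \<eta>0 by (simp add: Lp_norm_zero)
    next
      case False
      \<comment> \<open>From min + max = k + l: the gain 2^{min(k,l)} splits into the decaying
        factor placed in \<open>\<eta>\<close> and the scaling factor 2^{k+l-j}.\<close>
      have e: "min k l = - max (k - j) (l - j) + (k + l - j)" by auto
      have "Lp_norm 3 (LP_Delta \<phi>0 j (regular w)) \<le> 2 * kernel_L1 * L3_norm w"
        by (rule LP_Delta_Lp(2)[OF w(1)])
      also have "\<dots> \<le> 2 * kernel_L1 * (reproduce_const * 2 powi (min k l) * L3_norm u * L3_norm v)"
        using kernel_L1_nonneg by (intro mult_left_mono w) simp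
      also have "(2::real) powi (min k l) = 2 powi (- max (k - j) (l - j)) * 2 powi (k + l - j)"
        unfolding e by (rule power_int_add) simp
      also have "2 * kernel_L1 * (reproduce_const * (2 powi (- max (k - j) (l - j)) * 2 powi (k + l - j)) * L3_norm u * L3_norm v)
        = \<eta> (max (k - j) (l - j)) * 2 powi (k + l - j) * L3_norm u * L3_norm v"
      proof -
        have "\<eta> (max (k - j) (l - j)) = C * 2 powi (- max (k - j) (l - j))"
          unfolding \<eta>_def by (rule if_P) (use False in linarith)
        then show ?thesis by (simp only: C_def mult_ac)
      qed
      finally show ?thesis .
    qed
    then show ?thesis
      using LP_Delta_Lp(1)[OF w(1)] by (simp add: u v w(2) Lp_norm_regular)
  qed
  moreover have "\<eta> summable_on UNIV"
    unfolding \<eta>_def[abs_def] by (rule summable_two_powi_tail)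
  ultimately show "\<exists>\<eta>::int \<Rightarrow> real. (\<forall>n. 0 \<le> \<eta> n) \<and> \<eta> summable_on UNIV \<and>
        (\<forall>S\<in>Lp_space 3. \<forall>T\<in>Lp_space 3. \<forall>k l j.
           dist_support (dist_fourier S) \<subseteq> dyadic_annulus k \<and> dist_support (dist_fourier T) \<subseteq> dyadic_annulus l \<longrightarrow>
           LP_Delta \<phi>0 j (dist_product S T) \<in> Lp_space 3 \<and>
           Lp_norm 3 (LP_Delta \<phi>0 j (dist_product S T)) \<le> \<eta> (max (k - j) (l - j)) * 2 powi (k + l - j) * Lp_norm 3 S * Lp_norm 3 T)"
    using \<eta>0 by (intro exI[of _ \<eta>]) blast
qed

end

theorem proposition19:
  fixes \<phi>0 :: "real \<Rightarrow> complex"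
  assumes "cutoff \<phi>0"
  shows "good_space \<phi>0 (Lp_space 3) (Lp_norm 3)"
proof -
  interpret lp_cutoff \<phi>0 by standard (rule assms)
  show ?thesis by (rule good_space_L3)
qed

end
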